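(* Let $n,r$ be positive integers. The number of pairwise inequivalent irreducible complex representations of the generalized symmetric group $G(n,r)=\mathbb{Z}_r\wr S_n$ of odd degree equals $r^{|\mathrm{bin}(n)|}A(n)$.
   Context: $G(n,r)=\mathbb{Z}_r^n\rtimes S_n$, where $\mathbb{Z}_r=\mathbb{Z}/r\mathbb{Z}$ and $S_n$ acts on $\mathbb{Z}_r^n$ by permuting coordinates. $\mathrm{bin}(n)$ is the set of powers of $2$ occurring in the binary expansion of $n$, so $|\mathrm{bin}(n)|$ is the number of digits $1$ in the binary expansion of $n$. $A(n)$ is the number of inequivalent irreducible complex representations of the symmetric group $S_n$ of odd dimension. *)

theory Defs
  imports
    "HOL-Algebra.Elementary_Groups"
    "HOL-Algebra.Product_Groups"
    "HOL-Algebra.Sym_Groups"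
    "Jordan_Normal_Form.VS_Connect"
begin

definition semidirect_product ::
    "('a, 'm) monoid_scheme \<Rightarrow> ('b, 'n) monoid_scheme \<Rightarrow> ('b \<Rightarrow> 'a \<Rightarrow> 'a) \<Rightarrow> ('a \<times> 'b) monoid" where
  "semidirect_product N H \<phi> =
     \<lparr>carrier = carrier N \<times> carrier H,
      monoid.mult = (\<lambda>(a, h) (b, k). (a \<otimes>\<^bsub>N\<^esub> \<phi> h b, h \<otimes>\<^bsub>H\<^esub> k)),
      one = (\<one>\<^bsub>N\<^esub>, \<one>\<^bsub>H\<^esub>)\<rparr>"

lemma group_semidirect_product:
  assumes N: "group N" and H: "group H"
    and hom: "\<And>h. h \<in> carrier H \<Longrightarrow> \<phi> h \<in> hom N N"
    and act_one: "\<And>a. a \<in> carrier N \<Longrightarrow> \<phi> \<one>\<^bsub>H\<^esub> a = a"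
    and act_mult: "\<And>h k a. \<lbrakk>h \<in> carrier H; k \<in> carrier H; a \<in> carrier N\<rbrakk> \<Longrightarrow>
      \<phi> (h \<otimes>\<^bsub>H\<^esub> k) a = \<phi> h (\<phi> k a)"
  shows "group (semidirect_product N H \<phi>)"
proof -
  interpret N: group N by (rule N)
  interpret H: group H by (rule H)
  have cl: "\<phi> h a \<in> carrier N" if "h \<in> carrier H" "a \<in> carrier N" for h a
    using hom[OF that(1)] that(2) by (auto simp: hom_def)
  have mul: "\<phi> h (a \<otimes>\<^bsub>N\<^esub> b) = \<phi> h a \<otimes>\<^bsub>N\<^esub> \<phi> h b"
    if "h \<in> carrier H" "a \<in> carrier N" "b \<in> carrier N" for h a b
    using hom[OF that(1)] that(2,3) by (auto simp: hom_def)
  show ?thesis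
  proof (rule groupI)
    fix x assume "x \<in> carrier (semidirect_product N H \<phi>)"
    then obtain a h where x: "x = (a, h)" "a \<in> carrier N" "h \<in> carrier H"
      by (auto simp: semidirect_product_def)
    let ?b = "\<phi> (inv\<^bsub>H\<^esub> h) (inv\<^bsub>N\<^esub> a)"
    have "?b \<otimes>\<^bsub>N\<^esub> \<phi> (inv\<^bsub>H\<^esub> h) a = \<phi> (inv\<^bsub>H\<^esub> h) (inv\<^bsub>N\<^esub> a \<otimes>\<^bsub>N\<^esub> a)"
      using x mul[of "inv\<^bsub>H\<^esub> h" "inv\<^bsub>N\<^esub> a" a] by (simp del: N.l_inv)
    also have "\<dots> = \<one>\<^bsub>N\<^esub>"
      using x hom[of "inv\<^bsub>H\<^esub> h"] hom_one[of "\<phi> (inv\<^bsub>H\<^esub> h)" N N] N by simp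
    finally show "\<exists>y\<in>carrier (semidirect_product N H \<phi>).
        y \<otimes>\<^bsub>semidirect_product N H \<phi>\<^esub> x = \<one>\<^bsub>semidirect_product N H \<phi>\<^esub>"
      using x by (intro bexI[of _ "(?b, inv\<^bsub>H\<^esub> h)"]) (auto simp: semidirect_product_def cl)
  qed (auto simp: semidirect_product_def cl mul act_one act_mult N.m_assoc H.m_assoc)
qed

text \<open>The inverse makes this a left action of the symmetric group on coordinate tuples.\<close>

definition coord_perm :: "nat \<Rightarrow> (nat \<Rightarrow> nat) \<Rightarrow> (nat \<Rightarrow> int) \<Rightarrow> nat \<Rightarrow> int" where
  "coord_perm n \<sigma> a = (\<lambda>i\<in>{1..n}. a (Hilbert_Choice.inv \<sigma> i))"

definition generalized_sym_group :: "nat \<Rightarrow> nat \<Rightarrow> ((nat \<Rightarrow> int) \<times> (nat \<Rightarrow> nat)) monoid" where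
  "generalized_sym_group n r =
     semidirect_product (product_group {1..n} (\<lambda>_. integer_mod_group r)) (sym_group n)
       (coord_perm n)"

lemma group_generalized_sym_group: "group (generalized_sym_group n r)"
proof -
  let ?N = "product_group {1..n} (\<lambda>_. integer_mod_group r)"
  have inv_in: "Hilbert_Choice.inv \<sigma> i \<in> {1..n}" if "\<sigma> permutes {1..n}" "i \<in> {1..n}" for \<sigma> i
    using permutes_in_image[OF permutes_inv[OF that(1)]] that(2) by blast
  show ?thesis
    unfolding generalized_sym_group_def
  proof (rule group_semidirect_product)
    show "group ?N" by simp
    show "group (sym_group n)" by (rule sym_group_is_group)
    fix \<sigma> assume "\<sigma> \<in> carrier (sym_group n)"
    then have \<sigma>: "\<sigma> permutes {1..n}" by (simp add: sym_group_def)
    show "coord_perm n \<sigma> \<in> hom ?N ?N"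
      using inv_in[OF \<sigma>] by (intro homI) (auto simp: coord_perm_def fun_eq_iff PiE_iff)
    fix \<tau> a
    assume "\<tau> \<in> carrier (sym_group n)"
    then have \<tau>: "\<tau> permutes {1..n}" by (simp add: sym_group_def)
    have "Hilbert_Choice.inv (\<sigma> \<circ> \<tau>) = Hilbert_Choice.inv \<tau> \<circ> Hilbert_Choice.inv \<sigma>"
      using \<sigma> \<tau> by (intro o_inv_distrib permutes_bij)
    then show "coord_perm n (\<sigma> \<otimes>\<^bsub>sym_group n\<^esub> \<tau>) a = coord_perm n \<sigma> (coord_perm n \<tau> a)"
      using inv_in[OF \<sigma>] by (auto simp: coord_perm_def sym_group_def fun_eq_iff)
  next
    fix a assume "a \<in> carrier ?N"
    then show "coord_perm n \<one>\<^bsub>sym_group n\<^esub> a = a"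
      by (auto simp: coord_perm_def sym_group_def fun_eq_iff PiE_iff extensional_def)
  qed
qed

abbreviation GL_complex :: "nat \<Rightarrow> complex mat monoid" where
  "GL_complex d \<equiv> units_of (ring_mat TYPE(complex) d ())"

text \<open>
  A finite-dimensional complex representation is given by its degree \<open>d\<close> and a homomorphism
  \<open>\<rho>\<close> into \<open>GL_complex d\<close>. The values of \<open>\<rho>\<close> outside the carrier are arbitrary; the
  equivalence below ignores them.
\<close>

definition complex_rep :: "('g, 'm) monoid_scheme \<Rightarrow> nat \<Rightarrow> ('g \<Rightarrow> complex mat) \<Rightarrow> bool" where
  "complex_rep G d \<rho> \<longleftrightarrow> \<rho> \<in> hom G (GL_complex d)"

definition invariant_subspace ::
    "('g, 'm) monoid_scheme \<Rightarrow> nat \<Rightarrow> ('g \<Rightarrow> complex mat) \<Rightarrow> complex vec set \<Rightarrow> bool" where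
  "invariant_subspace G d \<rho> W \<longleftrightarrow>
     VectorSpace.subspace class_ring W (module_vec TYPE(complex) d) \<and>
     (\<forall>g\<in>carrier G. \<forall>v\<in>W. \<rho> g *\<^sub>v v \<in> W)"

definition irreducible_rep :: "('g, 'm) monoid_scheme \<Rightarrow> nat \<Rightarrow> ('g \<Rightarrow> complex mat) \<Rightarrow> bool" where
  "irreducible_rep G d \<rho> \<longleftrightarrow>
     complex_rep G d \<rho> \<and> d \<noteq> 0 \<and>
     (\<forall>W. invariant_subspace G d \<rho> W \<longrightarrow> W = {0\<^sub>v d} \<or> W = carrier_vec d)"

definition odd_irreps :: "('g, 'm) monoid_scheme \<Rightarrow> (nat \<times> ('g \<Rightarrow> complex mat)) set" where
  "odd_irreps G = {(d, \<rho>). irreducible_rep G d \<rho> \<and> odd d}"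

definition equivalent_reps ::
    "('g, 'm) monoid_scheme \<Rightarrow> nat \<times> ('g \<Rightarrow> complex mat) \<Rightarrow> nat \<times> ('g \<Rightarrow> complex mat) \<Rightarrow> bool" where
  "equivalent_reps G = (\<lambda>(d, \<rho>) (e, \<tau>).
     d = e \<and> (\<exists>P\<in>carrier (GL_complex d). \<forall>g\<in>carrier G. P * \<rho> g = \<tau> g * P))"

definition odd_irreps_equiv ::
    "('g, 'm) monoid_scheme \<Rightarrow> ((nat \<times> ('g \<Rightarrow> complex mat)) \<times> (nat \<times> ('g \<Rightarrow> complex mat))) set" where
  "odd_irreps_equiv G =
     {(x, y). x \<in> odd_irreps G \<and> y \<in> odd_irreps G \<and> equivalent_reps G x y}"

lemma equiv_odd_irreps_equiv: "equiv (odd_irreps G) (odd_irreps_equiv G)"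
proof -
  have car: "\<rho> g \<in> carrier_mat d d" if "(d, \<rho>) \<in> odd_irreps G" "g \<in> carrier G" for d \<rho> g
    using that
    by (auto simp: odd_irreps_def irreducible_rep_def complex_rep_def hom_def units_of_def
        Units_def ring_mat_def)
  have GL: "P \<in> carrier (GL_complex d) \<longleftrightarrow>
      P \<in> carrier_mat d d \<and> (\<exists>Q\<in>carrier_mat d d. Q * P = 1\<^sub>m d \<and> P * Q = 1\<^sub>m d)" for P d
    by (auto simp: units_of_def Units_def ring_mat_def)
  have "refl_on (odd_irreps G) (odd_irreps_equiv G)"
  proof (rule refl_onI)
    fix x assume x: "x \<in> odd_irreps G"
    obtain d \<rho> where [simp]: "x = (d, \<rho>)" by fastforce
    have "1\<^sub>m d \<in> carrier (GL_complex d)"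
      by (auto simp: GL intro!: bexI[of _ "1\<^sub>m d"])
    moreover have "1\<^sub>m d * \<rho> g = \<rho> g * 1\<^sub>m d" if "g \<in> carrier G" for g
      using car[of d \<rho> g] x that by simp
    ultimately show "(x, x) \<in> odd_irreps_equiv G"
      using x by (auto simp: odd_irreps_equiv_def equivalent_reps_def)
  qed
  moreover have "sym (odd_irreps_equiv G)"
  proof (rule symI)
    fix x y assume xy: "(x, y) \<in> odd_irreps_equiv G"
    then obtain d \<rho> \<tau> P where [simp]: "x = (d, \<rho>)" "y = (d, \<tau>)"
      and x: "(d, \<rho>) \<in> odd_irreps G" and y: "(d, \<tau>) \<in> odd_irreps G"
      and P: "P \<in> carrier (GL_complex d)" and eq: "\<forall>g\<in>carrier G. P * \<rho> g = \<tau> g * P"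
      by (auto simp: odd_irreps_equiv_def equivalent_reps_def)
    from P obtain Q where Pc: "P \<in> carrier_mat d d" and Q: "Q \<in> carrier_mat d d"
      "Q * P = 1\<^sub>m d" "P * Q = 1\<^sub>m d" by (auto simp: GL)
    have "Q * \<tau> g = \<rho> g * Q" if g: "g \<in> carrier G" for g
    proof -
      note c = Pc Q(1) car[OF x g] car[OF y g]
      have "Q * \<tau> g = Q * (\<tau> g * (P * Q))" using c Q by simp
      also have "\<dots> = Q * ((\<tau> g * P) * Q)" using c assoc_mult_mat[of "\<tau> g" d d P d Q d] by simp
      also have "\<dots> = Q * ((P * \<rho> g) * Q)" using eq g by simp
      also have "\<dots> = (Q * P) * (\<rho> g * Q)"
        using c assoc_mult_mat[of P d d "\<rho> g" d Q d] assoc_mult_mat[of Q d d P d "\<rho> g * Q" d]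
        by simp
      also have "\<dots> = \<rho> g * Q" using c Q by simp
      finally show ?thesis .
    qed
    moreover have "Q \<in> carrier (GL_complex d)" using Pc Q by (auto simp: GL)
    ultimately show "(y, x) \<in> odd_irreps_equiv G"
      using x y by (auto simp: odd_irreps_equiv_def equivalent_reps_def)
  qed
  moreover have "trans (odd_irreps_equiv G)"
  proof (rule transI)
    fix x y z assume "(x, y) \<in> odd_irreps_equiv G" "(y, z) \<in> odd_irreps_equiv G"
    then obtain d \<rho> \<tau> \<upsilon> P Q where [simp]: "x = (d, \<rho>)" "y = (d, \<tau>)" "z = (d, \<upsilon>)"
      and x: "(d, \<rho>) \<in> odd_irreps G" and y: "(d, \<tau>) \<in> odd_irreps G" and z: "(d, \<upsilon>) \<in> odd_irreps G"
      and P: "P \<in> carrier (GL_complex d)" "\<forall>g\<in>carrier G. P * \<rho> g = \<tau> g * P"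
      and Q: "Q \<in> carrier (GL_complex d)" "\<forall>g\<in>carrier G. Q * \<tau> g = \<upsilon> g * Q"
      by (auto simp: odd_irreps_equiv_def equivalent_reps_def)
    have Pc: "P \<in> carrier_mat d d" and Qc: "Q \<in> carrier_mat d d" using P Q by (auto simp: GL)
    have "monoid (ring_mat TYPE(complex) d ())"
      by (intro semiring.axioms(2) semiring_mat)
    from monoid.Units_m_closed[OF this, of Q P] have "Q * P \<in> carrier (GL_complex d)"
      using P(1) Q(1) by (simp add: units_of_carrier ring_mat_simps)
    moreover have "(Q * P) * \<rho> g = \<upsilon> g * (Q * P)" if g: "g \<in> carrier G" for g
    proof -
      note c = Pc Qc car[OF x g] car[OF y g] car[OF z g]
      have "(Q * P) * \<rho> g = Q * (P * \<rho> g)" using c by (intro assoc_mult_mat)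
      also have "\<dots> = (Q * \<tau> g) * P" using c P g assoc_mult_mat[of Q d d "\<tau> g" d P d] by simp
      also have "\<dots> = \<upsilon> g * (Q * P)" using c Q g assoc_mult_mat[of "\<upsilon> g" d d Q d P d] by simp
      finally show ?thesis .
    qed
    ultimately show "(x, z) \<in> odd_irreps_equiv G"
      using x z by (auto simp: odd_irreps_equiv_def equivalent_reps_def)
  qed
  ultimately show ?thesis by (auto simp: equiv_def odd_irreps_equiv_def)
qed

text \<open>
  Only used for finite groups, which have finitely many equivalence classes of irreducible
  representations, so the convention that infinite sets have cardinality 0 plays no role.
\<close>

definition num_odd_irreps :: "('g, 'm) monoid_scheme \<Rightarrow> nat" where
  "num_odd_irreps G = card (odd_irreps G // odd_irreps_equiv G)"

definition num_odd_irreps_sym :: "nat \<Rightarrow> nat" where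
  "num_odd_irreps_sym n = num_odd_irreps (sym_group n)"

definition binary_powers :: "nat \<Rightarrow> nat set" where
  "binary_powers n = {2 ^ k | k. bit n k}"

end

theory Submission
  imports Defs
    "Jordan_Normal_Form.Spectral_Radius"
    "HOL-Library.Poly_Mapping"
    "HOL-Library.Function_Algebras"
    "HOL-Computational_Algebra.Formal_Power_Series"
    "HOL-Combinatorics.Permutations"
begin

text \<open>
  Colour the coordinates \<open>1, \<dots>, n\<close> by the \<open>r n\<close> pairs \<open>(c, i)\<close> with \<open>c < r\<close> and \<open>i < n\<close>. The
  generalized symmetric group acts monomially on colourings, with the characters of the cyclic group
  of order \<open>r\<close> as weights. Let \<open>a\<close> be the product over \<open>c\<close> of the alternants in the variables
  \<open>x\<^sub>c\<^sub>,\<^sub>i\<close>. Multiplying the generating function of the traces by \<open>a\<close> and taking coefficients gives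
  virtual characters \<open>s\<^sub>b\<close>. By the Jacobi-Trudi identity they are orthonormal, up to the sign caused
  by permuting the exponents of one colour, so each is an irreducible character up to sign. The
  squares of their degrees add up to the group order, so no irreducible character is missed.

  The degree of \<open>s\<^sub>b\<close> is the coefficient of \<open>x\<^sup>b\<close> in \<open>p\<^sub>1\<^sup>n a\<close>. Modulo 2 the power \<open>p\<^sub>1\<^sup>n\<close> equals the
  product \<open>v\<close> of the power sums \<open>p\<^sub>l\<close> over \<open>l\<close> in \<open>bin(n)\<close>. All coefficients of \<open>v a\<close> lie in
  \<open>{-1, 0, 1}\<close>, because at most one hook of length \<open>l\<close> can be removed from a multipartition of size
  less than \<open>2 l\<close>. Hence the number of odd degrees is the squared norm of \<open>v a\<close>, normalised by that
  of \<open>a\<close>, which is the product of \<open>r l\<close> over \<open>l\<close> in \<open>bin(n)\<close>. For \<open>r = 1\<close> this is \<open>A(n)\<close>.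
\<close>

section \<open>Complex representations of finite groups\<close>

text \<open>Partitions never appear as objects. The vectors \<open>b\<close> range over all
  placements of \<open>n\<close> labelled beads per colour at distinct positions, so every
  irreducible character is met exactly \<open>fact n ^ r\<close> times, once for each reordering of
  the beads within the colours. The squared norm of \<open>a\<close> is the same number, and it
  cancels at the end. All norms come from one commutation rule. With \<open>q_l\<close> the adjoint
  of multiplication by \<open>p_l\<close>, the rule is \<open>q_l p_l - p_l q_l = l r\<close>. It
  counts the beads at positions below \<open>l\<close>, so it needs enough variables:
  \<open>n\<close> per colour guarantee that all these positions are filled in every degree that
  occurs. For \<open>l = 1\<close> the rule yields the sum of the squared degrees. For larger
  \<open>l\<close> the term \<open>p_l q_l F\<close> has to vanish, which happens when the degree of
  \<open>F\<close> beyond that of \<open>a\<close> is less than \<open>l\<close>. Multiplying by the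
  powers of 2 in increasing order achieves this, since distinct powers of 2 below
  \<open>2 ^ j\<close> add up to less than \<open>2 ^ j\<close>.\<close>

lemma index_mult_mat_sum:
  assumes "A \<in> carrier_mat m n" "B \<in> carrier_mat n p" "i < m" "j < p"
  shows "(A * B) $$ (i, j) = (\<Sum>k<n. A $$ (i, k) * B $$ (k, j))"
  using assms by (auto simp: scalar_prod_def atLeast0LessThan)

lemma index_mult_mat_vec_sum:
  assumes "A \<in> carrier_mat m n" "v \<in> carrier_vec n" "i < m"
  shows "(A *\<^sub>v v) $ i = (\<Sum>k<n. A $$ (i, k) * v $ k)"
  using assms by (auto simp: scalar_prod_def atLeast0LessThan)

lemma mat_mult_unit_vec:
  fixes A :: "'a :: comm_ring_1 mat"
  assumes "A \<in> carrier_mat m n" "j < n"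
  shows "A *\<^sub>v unit_vec n j = col A j"
proof (rule eq_vecI)
  fix i assume "i < dim_vec (col A j)"
  then have i: "i < m" using assms by auto
  have "(A *\<^sub>v unit_vec n j) $ i = (\<Sum>k<n. if k = j then A $$ (i, k) else 0)"
    unfolding index_mult_mat_vec_sum[OF assms(1) unit_vec_carrier i]
    by (intro sum.cong) (use assms in auto)
  then show "(A *\<^sub>v unit_vec n j) $ i = col A j $ i" using assms i by simp
qed (use assms in auto)

definition mat_trace :: "'a :: comm_ring_1 mat \<Rightarrow> 'a" where
  "mat_trace A = (\<Sum>i<dim_row A. A $$ (i, i))"

lemma mat_trace_mult_comm:
  assumes A: "A \<in> carrier_mat m n" and B: "B \<in> carrier_mat n m"
  shows "mat_trace (A * B) = mat_trace (B * A)"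
proof -
  have "mat_trace (A * B) = (\<Sum>i<m. \<Sum>k<n. A $$ (i, k) * B $$ (k, i))"
    unfolding mat_trace_def using A B
    by (intro sum.cong index_mult_mat_sum[OF A B]) auto
  also have "\<dots> = (\<Sum>k<n. \<Sum>i<m. B $$ (k, i) * A $$ (i, k))"
    by (subst sum.swap) (simp add: mult.commute)
  also have "\<dots> = mat_trace (B * A)"
    unfolding mat_trace_def using A B
    by (intro sum.cong index_mult_mat_sum[OF B A, symmetric]) auto
  finally show ?thesis .
qed

lemma mat_trace_one: "mat_trace (1\<^sub>m d) = of_nat d"
  by (simp add: mat_trace_def)

lemma GL_complex_iff:
  "P \<in> carrier (GL_complex d) \<longleftrightarrow>
     P \<in> carrier_mat d d \<and> (\<exists>Q\<in>carrier_mat d d. Q * P = 1\<^sub>m d \<and> P * Q = 1\<^sub>m d)"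
  by (auto simp: units_of_def Units_def ring_mat_def)

lemma subspace_iff:
  "VectorSpace.subspace class_ring W (module_vec TYPE(complex) d) \<longleftrightarrow>
     W \<subseteq> carrier_vec d \<and> 0\<^sub>v d \<in> W \<and> (\<forall>v\<in>W. \<forall>w\<in>W. v + w \<in> W) \<and> (\<forall>c. \<forall>v\<in>W. c \<cdot>\<^sub>v v \<in> W)"
proof -
  interpret vec_space "TYPE(complex)" d .
  show ?thesis
    unfolding VectorSpace.subspace_def submodule_def
    using vec_vs vec_module by (auto simp: module_vec_def)
qed

section \<open>Schur's lemma and the orthogonality of matrix coefficients\<close>

locale finite_group = group G for G :: "('g, 'm) monoid_scheme" (structure) +
  assumes finite_carrier [simp]: "finite (carrier G)"
begin

text \<open>An invertible idempotent matrix is the identity, so multiplicativity already fixes the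
  value at \<open>\<one>\<close>. Conversely \<open>\<rho> (inv g)\<close> is the inverse that
  membership in \<open>GL_complex\<close> asks for.\<close>

lemma complex_rep_iff:
  "complex_rep G d \<rho> \<longleftrightarrow>
     (\<forall>g\<in>carrier G. \<rho> g \<in> carrier_mat d d) \<and>
     (\<forall>g\<in>carrier G. \<forall>h\<in>carrier G. \<rho> (g \<otimes> h) = \<rho> g * \<rho> h) \<and> \<rho> \<one> = 1\<^sub>m d"
  (is "_ \<longleftrightarrow> ?R")
proof
  assume "complex_rep G d \<rho>"
  then have GL: "\<rho> g \<in> carrier (GL_complex d)" if "g \<in> carrier G" for g
    using that by (auto simp: complex_rep_def hom_def)
  from \<open>complex_rep G d \<rho>\<close> have mul: "\<rho> (g \<otimes> h) = \<rho> g * \<rho> h" if "g \<in> carrier G" "h \<in> carrier G" for g h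
    using that by (auto simp: complex_rep_def hom_def units_of_def ring_mat_def)
  obtain Q where Q: "Q \<in> carrier_mat d d" "Q * \<rho> \<one> = 1\<^sub>m d" and one: "\<rho> \<one> \<in> carrier_mat d d"
    using GL[of \<one>] by (auto simp: GL_complex_iff)
  have "\<rho> \<one> = (Q * \<rho> \<one>) * \<rho> \<one>" using Q one by simp
  also have "\<dots> = Q * (\<rho> \<one> * \<rho> \<one>)" using Q one by (intro assoc_mult_mat)
  also have "\<dots> = 1\<^sub>m d" using mul[of \<one> \<one>] Q by simp
  finally show ?R using GL mul by (auto simp: GL_complex_iff)
next
  assume R: ?R
  have "\<rho> g \<in> carrier (GL_complex d)" if "g \<in> carrier G" for g
    unfolding GL_complex_iff
  proof (intro conjI bexI)
    show "\<rho> (inv g) * \<rho> g = 1\<^sub>m d" "\<rho> g * \<rho> (inv g) = 1\<^sub>m d"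
      using R that by (metis l_inv r_inv inv_closed)+
  qed (use R that in auto)
  then show "complex_rep G d \<rho>"
    using R by (auto simp: complex_rep_def hom_def units_of_def ring_mat_def)
qed

lemma
  assumes "complex_rep G d \<rho>"
  shows rep_carrier: "g \<in> carrier G \<Longrightarrow> \<rho> g \<in> carrier_mat d d"
    and rep_mult: "g \<in> carrier G \<Longrightarrow> h \<in> carrier G \<Longrightarrow> \<rho> (g \<otimes> h) = \<rho> g * \<rho> h"
    and rep_one: "\<rho> \<one> = 1\<^sub>m d"
  using assms unfolding complex_rep_iff by auto

text \<open>Kernel and image of an intertwiner are invariant subspaces, so irreducibility makes a
  nonzero \<open>P\<close> both injective and surjective. Its inverse is assembled from preimages of
  the unit vectors, since \<open>d\<close> and \<open>e\<close> are not yet known to agree.\<close>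

lemma schur:
  assumes \<rho>: "irreducible_rep G d \<rho>" and \<tau>: "irreducible_rep G e \<tau>"
    and P: "P \<in> carrier_mat d e" and int: "\<And>g. g \<in> carrier G \<Longrightarrow> \<rho> g * P = P * \<tau> g"
    and nz: "P \<noteq> 0\<^sub>m d e"
  shows "\<exists>Q\<in>carrier_mat e d. P * Q = 1\<^sub>m d \<and> Q * P = 1\<^sub>m e"
proof -
  have rep: "complex_rep G d \<rho>" "complex_rep G e \<tau>"
    using \<rho> \<tau> by (auto simp: irreducible_rep_def)
  have c: "\<rho> g \<in> carrier_mat d d" "\<tau> g \<in> carrier_mat e e" if "g \<in> carrier G" for g
    using rep that by (auto intro: rep_carrier)
  have intv: "\<rho> g *\<^sub>v (P *\<^sub>v v) = P *\<^sub>v (\<tau> g *\<^sub>v v)" if "g \<in> carrier G" "v \<in> carrier_vec e" for g v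
    using int[OF that(1)] c[OF that(1)] P that(2)
    by (metis assoc_mult_mat_vec)
  have "\<exists>j<e. P *\<^sub>v unit_vec e j \<noteq> 0\<^sub>v d"
  proof (rule ccontr)
    assume "\<not> ?thesis"
    then have *: "col P j = 0\<^sub>v d" if "j < e" for j
      using that mat_mult_unit_vec[OF P] by metis
    have "P = 0\<^sub>m d e"
      by (rule mat_col_eqI) (use P * in \<open>auto\<close>)
    with nz show False by simp
  qed
  then obtain j where j: "j < e" "P *\<^sub>v unit_vec e j \<noteq> 0\<^sub>v d" by blast
  let ?K = "{v \<in> carrier_vec e. P *\<^sub>v v = 0\<^sub>v d}"
  let ?I = "{P *\<^sub>v v | v. v \<in> carrier_vec e}"
  have "invariant_subspace G e \<tau> ?K"
    unfolding invariant_subspace_def subspace_iff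
  proof (intro conjI ballI allI)
    fix g v assume g: "g \<in> carrier G" and v: "v \<in> ?K"
    then have "P *\<^sub>v (\<tau> g *\<^sub>v v) = \<rho> g *\<^sub>v 0\<^sub>v d" using intv[of g v] by simp
    then show "\<tau> g *\<^sub>v v \<in> ?K" using c[OF g] v by auto
  qed (use P in \<open>auto simp: mult_add_distrib_mat_vec mult_mat_vec\<close>)
  then have "?K = {0\<^sub>v e} \<or> ?K = carrier_vec e"
    using \<tau> by (simp add: irreducible_rep_def)
  moreover have "unit_vec e j \<in> carrier_vec e - ?K" using j by auto
  ultimately have K: "?K = {0\<^sub>v e}" by blast
  have "invariant_subspace G d \<rho> ?I"
    unfolding invariant_subspace_def subspace_iff
  proof (intro conjI ballI allI)
    show "?I \<subseteq> carrier_vec d" using P by auto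
    show "0\<^sub>v d \<in> ?I" using P by (auto intro!: exI[of _ "0\<^sub>v e"])
    fix v assume "v \<in> ?I"
    then obtain v' where v: "v = P *\<^sub>v v'" "v' \<in> carrier_vec e" by auto
    show "c \<cdot>\<^sub>v v \<in> ?I" for c using v P by (auto intro!: exI[of _ "c \<cdot>\<^sub>v v'"] simp: mult_mat_vec)
    show "v + w \<in> ?I" if "w \<in> ?I" for w
    proof -
      from that obtain w' where w: "w = P *\<^sub>v w'" "w' \<in> carrier_vec e" by auto
      then show ?thesis using v P by (auto intro!: exI[of _ "v' + w'"] simp: mult_add_distrib_mat_vec)
    qed
  next
    fix g v assume g: "g \<in> carrier G" and "v \<in> ?I"
    then obtain v' where v: "v = P *\<^sub>v v'" "v' \<in> carrier_vec e" by auto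
    show "\<rho> g *\<^sub>v v \<in> ?I"
      using c[OF g] v intv[OF g v(2)] by (auto intro!: exI[of _ "\<tau> g *\<^sub>v v'"])
  qed
  then have "?I = {0\<^sub>v d} \<or> ?I = carrier_vec d"
    using \<rho> by (simp add: irreducible_rep_def)
  moreover have "P *\<^sub>v unit_vec e j \<in> ?I - {0\<^sub>v d}" using j by auto
  ultimately have I: "?I = carrier_vec d" by blast
  have "\<exists>v\<in>carrier_vec e. P *\<^sub>v v = unit_vec d i" for i
  proof -
    have "unit_vec d i \<in> ?I" unfolding I by simp
    then show ?thesis by force
  qed
  then obtain v where v: "\<And>i. v i \<in> carrier_vec e" "\<And>i. P *\<^sub>v v i = unit_vec d i" by metis
  define Q where "Q = mat e d (\<lambda>(i, j). v j $ i)"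
  have Q: "Q \<in> carrier_mat e d" by (simp add: Q_def)
  have colQ: "col Q i = v i" if "i < d" for i
    using that v(1)[of i] by (auto simp: Q_def)
  have PQ: "P * Q = 1\<^sub>m d"
  proof (rule mat_col_eqI)
    fix i assume "i < dim_col (1\<^sub>m d :: complex mat)"
    then have i: "i < d" by simp
    show "col (P * Q) i = col (1\<^sub>m d) i"
      using i P Q v colQ by (simp add: col_mult2[OF P Q i])
  qed (use P Q in auto)
  \<comment> \<open>From \<open>P * Q = 1\<close> the matrix \<open>Q * P - 1\<close> is killed by
    \<open>P\<close>; the trivial kernel finishes column by column.\<close>
  have QP: "Q * P = 1\<^sub>m e"
  proof (rule mat_col_eqI)
    fix i assume "i < dim_col (1\<^sub>m e :: complex mat)"
    then have i: "i < e" by simp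
    have QPc: "Q * P \<in> carrier_mat e e" using P Q by simp
    let ?x = "col (Q * P) i - unit_vec e i"
    have x: "col (Q * P) i \<in> carrier_vec e" using i P Q by auto
    have "P *\<^sub>v col (Q * P) i = col (P * (Q * P)) i"
      using col_mult2[OF P QPc i] by simp
    also have "P * (Q * P) = P" using assoc_mult_mat[OF P Q P] PQ P by simp
    finally have "P *\<^sub>v ?x = 0\<^sub>v d"
      using x P i mat_mult_unit_vec[OF P i] by (simp add: mult_minus_distrib_mat_vec)
    then have "?x \<in> ?K" using x by simp
    then have x0: "?x = 0\<^sub>v e" unfolding K by simp
    have "col (Q * P) i = unit_vec e i"
    proof (rule eq_vecI)
      fix k assume k: "k < dim_vec (unit_vec e i :: complex vec)"
      then have "?x $ k = 0" using x0 by simp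
      then show "col (Q * P) i $ k = unit_vec e i $ k" using k by simp
    qed (use x Q in auto)
    then show "col (Q * P) i = col (1\<^sub>m e) i" using i by simp
  qed (use P Q in auto)
  show ?thesis using PQ QP Q by blast
qed

lemma bij_betw_mult_left: "h \<in> carrier G \<Longrightarrow> bij_betw (\<lambda>g. h \<otimes> g) (carrier G) (carrier G)"
  by (rule bij_betwI[where g = "\<lambda>g. inv h \<otimes> g"]) (auto simp: m_assoc[symmetric])

text \<open>\<open>P\<close> is the sum over \<open>g\<close> of \<open>\<rho> g\<close>, the matrix
  unit at \<open>(a, b)\<close> and \<open>\<tau> (inv g)\<close> multiplied together. Replacing
  \<open>g\<close> by \<open>h \<otimes> g\<close> in this sum moves \<open>h\<close> from the left
  side to the right.\<close>

lemma matrix_coefficient_intertwines: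
  assumes \<rho>: "complex_rep G d \<rho>" and \<tau>: "complex_rep G e \<tau>"
    and a: "a < d" and b: "b < e" and h: "h \<in> carrier G"
  defines "P \<equiv> mat d e (\<lambda>(i, j). \<Sum>g\<in>carrier G. \<rho> g $$ (i, a) * \<tau> (inv g) $$ (b, j))"
  shows "\<rho> h * P = P * \<tau> h"
proof (rule eq_matI)
  have P: "P \<in> carrier_mat d e" by (simp add: P_def)
  note c = rep_carrier[OF \<rho>] rep_carrier[OF \<tau>]
  show dim: "dim_row (\<rho> h * P) = dim_row (P * \<tau> h)" "dim_col (\<rho> h * P) = dim_col (P * \<tau> h)"
    using c h P by auto
  fix i j assume "i < dim_row (P * \<tau> h)" "j < dim_col (P * \<tau> h)"
  then have i: "i < d" and j: "j < e" using P c h by auto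
  have "(\<rho> h * P) $$ (i, j) =
      (\<Sum>k<d. \<Sum>g\<in>carrier G. \<rho> h $$ (i, k) * \<rho> g $$ (k, a) * \<tau> (inv g) $$ (b, j))"
    unfolding index_mult_mat_sum[OF c(1)[OF h] P i j]
    using j by (intro sum.cong) (auto simp: P_def sum_distrib_left mult.assoc)
  also have "\<dots> = (\<Sum>g\<in>carrier G. \<rho> (h \<otimes> g) $$ (i, a) * \<tau> (inv g) $$ (b, j))"
    by (subst sum.swap, intro sum.cong)
      (auto simp: rep_mult[OF \<rho> h] index_mult_mat_sum[OF c(1)[OF h] c(1) i a] sum_distrib_right)
  also have "\<dots> = (\<Sum>g\<in>carrier G. \<rho> (h \<otimes> g) $$ (i, a) * \<tau> (inv (h \<otimes> g) \<otimes> h) $$ (b, j))"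
    using h by (intro sum.cong refl) (simp add: inv_mult_group m_assoc)
  also have "\<dots> = (\<Sum>g\<in>carrier G. \<rho> g $$ (i, a) * \<tau> (inv g \<otimes> h) $$ (b, j))"
    by (rule sum.reindex_bij_betw[OF bij_betw_mult_left[OF h],
          of "\<lambda>g. \<rho> g $$ (i, a) * \<tau> (inv g \<otimes> h) $$ (b, j)"])
  also have "\<dots> = (\<Sum>g\<in>carrier G. \<Sum>k<e. \<rho> g $$ (i, a) * \<tau> (inv g) $$ (b, k) * \<tau> h $$ (k, j))"
    using h by (intro sum.cong)
      (auto simp: rep_mult[OF \<tau>] index_mult_mat_sum[OF c(2) c(2)[OF h] b j] sum_distrib_left mult.assoc)
  also have "\<dots> = (P * \<tau> h) $$ (i, j)"
    unfolding index_mult_mat_sum[OF P c(2)[OF h] i j]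
    by (subst sum.swap, intro sum.cong) (use i in \<open>auto simp: P_def sum_distrib_right\<close>)
  finally show "(\<rho> h * P) $$ (i, j) = (P * \<tau> h) $$ (i, j)" .
qed

lemma matrix_coefficients_orthogonal:
  assumes \<rho>: "irreducible_rep G d \<rho>" and \<tau>: "irreducible_rep G e \<tau>"
    and neq: "\<not> equivalent_reps G (d, \<rho>) (e, \<tau>)"
    and "i < d" "a < d" "b < e" "j < e"
  shows "(\<Sum>g\<in>carrier G. \<rho> g $$ (i, a) * \<tau> (inv g) $$ (b, j)) = 0"
proof -
  have rep: "complex_rep G d \<rho>" "complex_rep G e \<tau>"
    using \<rho> \<tau> by (auto simp: irreducible_rep_def)
  define P where
    "P = mat d e (\<lambda>(i, j). \<Sum>g\<in>carrier G. \<rho> g $$ (i, a) * \<tau> (inv g) $$ (b, j))"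
  have P: "P \<in> carrier_mat d e" by (simp add: P_def)
  have int: "\<rho> h * P = P * \<tau> h" if "h \<in> carrier G" for h
    unfolding P_def using rep assms(5,6) that by (rule matrix_coefficient_intertwines)
  have "P = 0\<^sub>m d e"
  proof (rule ccontr)
    assume "P \<noteq> 0\<^sub>m d e"
    from schur[OF \<rho> \<tau> P int this] obtain Q
      where Q: "Q \<in> carrier_mat e d" "P * Q = 1\<^sub>m d" "Q * P = 1\<^sub>m e" by blast
    \<comment> \<open>A matrix with a two-sided inverse is square: the traces of
      \<open>P * Q\<close> and \<open>Q * P\<close> agree, and the characteristic is 0.\<close>
    have "of_nat d = (of_nat e :: complex)"
      using mat_trace_mult_comm[OF P Q(1)] Q by (simp add: mat_trace_one)
    then have de: "d = e" by (simp only: of_nat_eq_iff)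
    have "Q * \<rho> g = \<tau> g * Q" if g: "g \<in> carrier G" for g
    proof -
      note c = rep_carrier[OF rep(1) g] rep_carrier[OF rep(2) g]
      have "Q * \<rho> g = Q * (\<rho> g * (P * Q))" using c Q by simp
      also have "\<dots> = Q * ((\<rho> g * P) * Q)" using c Q P by (simp add: assoc_mult_mat)
      also have "\<dots> = Q * (P * (\<tau> g * Q))" using int[OF g] c Q P by simp
      also have "\<dots> = (Q * P) * (\<tau> g * Q)" using c Q(1) P by (intro assoc_mult_mat[symmetric]) auto
      also have "\<dots> = \<tau> g * Q" using c Q by simp
      finally show ?thesis .
    qed
    moreover have "Q \<in> carrier (GL_complex d)"
      unfolding GL_complex_iff using Q P de by auto
    ultimately have "equivalent_reps G (d, \<rho>) (e, \<tau>)"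
      unfolding equivalent_reps_def using de by auto
    with neq show False by simp
  qed
  then have "P $$ (i, j) = 0" using assms by simp
  then show ?thesis using assms by (simp add: P_def)
qed

text \<open>Over the complex numbers \<open>P\<close> has an eigenvalue \<open>k\<close>. The
  intertwiner \<open>P - k\<close> is singular, hence zero by Schur's lemma, so \<open>P\<close> is
  scalar and its trace determines \<open>k\<close>.\<close>

lemma matrix_coefficients_self:
  assumes \<rho>: "irreducible_rep G d \<rho>" and "i < d" "a < d" "b < d" "j < d"
  shows "(\<Sum>g\<in>carrier G. \<rho> g $$ (i, a) * \<rho> (inv g) $$ (b, j)) =
    (if i = j \<and> a = b then of_nat (card (carrier G)) / of_nat d else 0)"
proof -
  have rep: "complex_rep G d \<rho>" and d: "d > 0"
    using \<rho> by (auto simp: irreducible_rep_def)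
  define P where
    "P = mat d d (\<lambda>(i, j). \<Sum>g\<in>carrier G. \<rho> g $$ (i, a) * \<rho> (inv g) $$ (b, j))"
  have P: "P \<in> carrier_mat d d" by (simp add: P_def)
  have int: "\<rho> h * P = P * \<rho> h" if "h \<in> carrier G" for h
    unfolding P_def using rep rep assms(3,4) that by (rule matrix_coefficient_intertwines)
  obtain k where "eigenvalue P k"
    using spectrum_non_empty[OF P d] by (auto simp: spectrum_def)
  then obtain v where v: "v \<in> carrier_vec d" "v \<noteq> 0\<^sub>v d" "P *\<^sub>v v = k \<cdot>\<^sub>v v"
    using P by (auto simp: eigenvalue_def eigenvector_def)
  define Q where "Q = P - k \<cdot>\<^sub>m 1\<^sub>m d"
  have Q: "Q \<in> carrier_mat d d" unfolding Q_def by (intro minus_carrier_mat) simp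
  have "Q = 0\<^sub>m d d"
  proof (rule ccontr)
    assume "Q \<noteq> 0\<^sub>m d d"
    moreover have "\<rho> g * Q = Q * \<rho> g" if g: "g \<in> carrier G" for g
    proof -
      note c = rep_carrier[OF rep g]
      have "\<rho> g * Q = \<rho> g * P - \<rho> g * (k \<cdot>\<^sub>m 1\<^sub>m d)"
        unfolding Q_def by (rule mult_minus_distrib_mat[OF c P]) simp
      also have "\<rho> g * (k \<cdot>\<^sub>m 1\<^sub>m d) = (k \<cdot>\<^sub>m 1\<^sub>m d) * \<rho> g"
        using c by (simp add: mult_smult_distrib[of _ d d _ d] mult_smult_assoc_mat[of _ d d _ d])
      also have "\<rho> g * P - (k \<cdot>\<^sub>m 1\<^sub>m d) * \<rho> g = Q * \<rho> g"
        unfolding Q_def int[OF g] by (rule minus_mult_distrib_mat[OF P _ c, symmetric]) simp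
      finally show ?thesis .
    qed
    ultimately obtain R where R: "R \<in> carrier_mat d d" "R * Q = 1\<^sub>m d"
      using schur[OF \<rho> \<rho> Q] by blast
    have "Q *\<^sub>v v = P *\<^sub>v v - (k \<cdot>\<^sub>m 1\<^sub>m d) *\<^sub>v v"
      unfolding Q_def by (rule minus_mult_distrib_mat_vec[OF P _ v(1)]) simp
    also have "(k \<cdot>\<^sub>m 1\<^sub>m d) *\<^sub>v v = k \<cdot>\<^sub>v v"
      using v(1) by (intro eq_vecI) auto
    finally have "Q *\<^sub>v v = 0\<^sub>v d" using v by simp
    then have "R *\<^sub>v (Q *\<^sub>v v) = 0\<^sub>v d" using R by (intro eq_vecI) auto
    moreover have "R *\<^sub>v (Q *\<^sub>v v) = (R * Q) *\<^sub>v v" using R(1) Q v(1) by simp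
    ultimately show False using v R by simp
  qed
  have Pij: "P $$ (x, y) = (if x = y then k else 0)" if "x < d" "y < d" for x y
  proof -
    have "Q $$ (x, y) = 0" using \<open>Q = 0\<^sub>m d d\<close> that by simp
    then show ?thesis using that P by (auto simp: Q_def)
  qed
  \<comment> \<open>After exchanging the sums, each group element contributes the
    \<open>(b, a)\<close> entry of \<open>\<rho> (inv g) * \<rho> g\<close>, that is, of the
    identity.\<close>
  have "of_nat d * k = (\<Sum>x<d. P $$ (x, x))" by (simp add: Pij)
  also have "\<dots> = (\<Sum>g\<in>carrier G. \<Sum>x<d. \<rho> (inv g) $$ (b, x) * \<rho> g $$ (x, a))"
    by (subst sum.swap) (simp add: P_def mult.commute)
  also have "\<dots> = (\<Sum>g\<in>carrier G. (1\<^sub>m d :: complex mat) $$ (b, a))"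
  proof (intro sum.cong refl)
    fix g assume g: "g \<in> carrier G"
    have "(\<Sum>x<d. \<rho> (inv g) $$ (b, x) * \<rho> g $$ (x, a)) = (\<rho> (inv g) * \<rho> g) $$ (b, a)"
      using assms(3,4) g rep_carrier[OF rep] by (intro index_mult_mat_sum[symmetric]) auto
    also have "\<rho> (inv g) * \<rho> g = 1\<^sub>m d"
      using g rep_mult[OF rep, of "inv g" g] rep_one[OF rep] by simp
    finally show "(\<Sum>x<d. \<rho> (inv g) $$ (b, x) * \<rho> g $$ (x, a)) = (1\<^sub>m d :: complex mat) $$ (b, a)" .
  qed
  also have "\<dots> = (if a = b then of_nat (card (carrier G)) else 0)"
    using assms by simp
  finally have "k = (if a = b then of_nat (card (carrier G)) / of_nat d else 0)"
    using d by (auto simp: field_simps)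
  then have "P $$ (i, j) = (if i = j \<and> a = b then of_nat (card (carrier G)) / of_nat d else 0)"
    using Pij[of i j] assms by auto
  then show ?thesis using assms by (simp add: P_def)
qed

end

section \<open>Splitting a reducible representation along an invariant subspace\<close>

lemma sum_lessThan_split:
  fixes f :: "nat \<Rightarrow> 'a :: comm_monoid_add"
  assumes "e \<le> d"
  shows "(\<Sum>k<d. f k) = (\<Sum>k<e. f k) + (\<Sum>k<d-e. f (k + e))"
proof -
  have "(\<Sum>k<e + m. f k) = (\<Sum>k<e. f k) + (\<Sum>k<m. f (k + e))" for m
    by (induction m) (auto simp: add.assoc add.commute[of e])
  from this[of "d - e"] assms show ?thesis by simp
qed

lemma mult_mat_vec_in_subspace:
  fixes T :: "complex mat"
  assumes W: "VectorSpace.subspace class_ring W (module_vec TYPE(complex) d)"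
    and T: "T \<in> carrier_mat d n" and x: "x \<in> carrier_vec n"
    and col: "\<And>j. j < n \<Longrightarrow> col T j \<in> W"
  shows "T *\<^sub>v x \<in> W"
proof -
  have "T *\<^sub>v vec n (\<lambda>i. if i < k then x $ i else 0) \<in> W" if "k \<le> n" for k
    using that
  proof (induction k)
    case 0
    have "T *\<^sub>v vec n (\<lambda>i. if i < 0 then x $ i else 0) = 0\<^sub>v d"
      by (rule eq_vecI) (use T in \<open>auto simp: scalar_prod_def\<close>)
    then show ?case using W by (simp add: subspace_iff)
  next
    case (Suc k)
    have "T *\<^sub>v vec n (\<lambda>i. if i < Suc k then x $ i else 0) =
        T *\<^sub>v vec n (\<lambda>i. if i < k then x $ i else 0) + x $ k \<cdot>\<^sub>v col T k"
    proof (rule eq_vecI)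
      fix i assume "i < dim_vec (T *\<^sub>v vec n (\<lambda>i. if i < k then x $ i else 0) + x $ k \<cdot>\<^sub>v col T k)"
      then have i: "i < d" using T by auto
      have "(\<Sum>j<n. T $$ (i, j) * (if j < Suc k then x $ j else 0)) =
          (\<Sum>j<n. T $$ (i, j) * (if j < k then x $ j else 0) + (if j = k then T $$ (i, j) * x $ j else 0))"
        by (intro sum.cong) auto
      also have "\<dots> = (\<Sum>j<n. T $$ (i, j) * (if j < k then x $ j else 0)) + T $$ (i, k) * x $ k"
        using Suc.prems by (simp add: sum.distrib)
      finally show "(T *\<^sub>v vec n (\<lambda>i. if i < Suc k then x $ i else 0)) $ i =
          (T *\<^sub>v vec n (\<lambda>i. if i < k then x $ i else 0) + x $ k \<cdot>\<^sub>v col T k) $ i"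
        using i T Suc.prems
        by (simp add: index_mult_mat_vec_sum[OF T _ i] del: index_mult_mat_vec)
    qed (use T in auto)
    then show ?case using Suc W col[of k] by (simp add: subspace_iff)
  qed
  from this[of n] have "T *\<^sub>v vec n (\<lambda>i. if i < n then x $ i else 0) \<in> W" by simp
  also have "vec n (\<lambda>i. if i < n then x $ i else 0) = x" using x by auto
  finally show ?thesis .
qed

text \<open>\<open>T\<close> is an invertible matrix with as many leading columns in
  \<open>W\<close> as possible. If some \<open>w\<close> in \<open>W\<close> had a nonzero
  coordinate beyond these columns, a Steinitz exchange would bring \<open>w\<close> in as a further
  leading column.\<close>

lemma subspace_adapted_basis:
  assumes W: "VectorSpace.subspace class_ring W (module_vec TYPE(complex) d)"
    and nz: "W \<noteq> {0\<^sub>v d}" and proper: "W \<noteq> carrier_vec d"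
  obtains e T S where "0 < e" "e < d" "T \<in> carrier_mat d d" "S \<in> carrier_mat d d"
    "T * S = 1\<^sub>m d" "S * T = 1\<^sub>m d" "\<And>j. j < e \<Longrightarrow> col T j \<in> W"
    "\<And>w i. w \<in> W \<Longrightarrow> e \<le> i \<Longrightarrow> i < d \<Longrightarrow> (S *\<^sub>v w) $ i = 0"
proof -
  define good where "good e \<longleftrightarrow> e \<le> d \<and> (\<exists>T S. T \<in> carrier_mat d d \<and> S \<in> carrier_mat d d \<and>
    T * S = 1\<^sub>m d \<and> S * T = 1\<^sub>m d \<and> (\<forall>j<e. col T j \<in> W))" for e
  have "good 0" unfolding good_def by (auto intro!: exI[of _ "1\<^sub>m d"])
  moreover have bound: "\<forall>e. good e \<longrightarrow> e \<le> d" by (simp add: good_def)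
  ultimately obtain e where e: "good e" and max: "\<And>e'. good e' \<Longrightarrow> e' \<le> e"
    using GreatestI_nat[of good] Greatest_le_nat[of good] by metis
  from e obtain T S where T: "T \<in> carrier_mat d d" and S: "S \<in> carrier_mat d d"
    and TS: "T * S = 1\<^sub>m d" and ST: "S * T = 1\<^sub>m d" and col: "\<And>j. j < e \<Longrightarrow> col T j \<in> W"
    and "e \<le> d" by (auto simp: good_def)
  have Wc: "W \<subseteq> carrier_vec d" using W by (simp add: subspace_iff)
  have TSw: "T *\<^sub>v (S *\<^sub>v w) = w" if "w \<in> carrier_vec d" for w
    using assoc_mult_mat_vec[OF T S that] TS that by simp
  have zero: "(S *\<^sub>v w) $ i = 0" if w: "w \<in> W" and i: "e \<le> i" "i < d" for w i
  proof (rule ccontr)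
    assume ci: "(S *\<^sub>v w) $ i \<noteq> 0"
    define c where "c = S *\<^sub>v w"
    have c: "c \<in> carrier_vec d" using S w Wc by (auto simp: c_def)
    define \<sigma> where "\<sigma> = Transposition.transpose i e"
    \<comment> \<open>\<open>E\<close> is the permutation matrix exchanging \<open>i\<close> and
      \<open>e\<close>, with column \<open>e\<close> replaced by the coordinates \<open>c\<close> of
      \<open>w\<close>. So \<open>T * E\<close> has \<open>w\<close> in column \<open>e\<close> and
      keeps the columns before it. Row \<open>i\<close> of \<open>E\<close> has the single nonzero
      entry \<open>c $ i\<close>, in column \<open>e\<close>, which makes \<open>E\<close>
      invertible.\<close>
    define E where "E = mat d d (\<lambda>(p, q). if q = e then c $ p else if p = \<sigma> q then 1 else 0)"
    have E: "E \<in> carrier_mat d d" by (simp add: E_def)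
    have \<sigma>: "\<sigma> q < d" if "q < d" for q using that i by (auto simp: \<sigma>_def Transposition.transpose_def)
    have \<sigma>_eq: "\<sigma> p = \<sigma> q \<longleftrightarrow> p = q" "\<sigma> e = i" for p q
      by (auto simp: \<sigma>_def Transposition.transpose_def)
    have "det E \<noteq> 0"
    proof
      assume "det E = 0"
      then obtain x where x: "x \<in> carrier_vec d" "x \<noteq> 0\<^sub>v d" "E *\<^sub>v x = 0\<^sub>v d"
        using det_0_iff_vec_prod_zero[OF E] by auto
      have Ex: "(\<Sum>q<d. E $$ (p, q) * x $ q) = 0" if "p < d" for p
        using x that index_mult_mat_vec_sum[OF E x(1) that] by simp
      have "(\<Sum>q<d. E $$ (i, q) * x $ q) = (\<Sum>q<d. if q = e then c $ i * x $ q else 0)"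
        using i by (intro sum.cong) (auto simp: E_def \<sigma>_eq(2)[symmetric] \<sigma>_eq(1))
      then have xe: "x $ e = 0" using Ex[OF i(2)] i ci by (simp add: c_def)
      have "x $ q = 0" if q: "q < d" for q
      proof (cases "q = e")
        case False
        have "(\<Sum>p<d. E $$ (\<sigma> q, p) * x $ p) = (\<Sum>p<d. if p = q then x $ p else 0)"
          using \<sigma>[OF q] False xe by (intro sum.cong) (auto simp: E_def \<sigma>_eq)
        then show ?thesis using Ex[OF \<sigma>[OF q]] q by simp
      qed (use xe in simp)
      then have "x = 0\<^sub>v d" using x(1) by auto
      with x show False by simp
    qed
    moreover have "det T * det S = 1"
      using det_mult[OF T S] TS by simp
    ultimately have "det (T * E) \<noteq> 0" using det_mult[OF T E] by auto
    then have "T * E \<in> Units (ring_mat TYPE(complex) d ())"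
      using det_non_zero_imp_unit[of "T * E" d] T E by simp
    then have "T * E \<in> carrier (GL_complex d)" by (simp add: units_of_def)
    then obtain S' where S': "S' \<in> carrier_mat d d" "S' * (T * E) = 1\<^sub>m d" "(T * E) * S' = 1\<^sub>m d"
      by (auto simp: GL_complex_iff)
    have colE: "col (T * E) j \<in> W" if "j < Suc e" for j
    proof (cases "j = e")
      case True
      have "col (T * E) e = T *\<^sub>v col E e" using i by (intro col_mult2[OF T E]) simp
      also have "col E e = c" using i c by (auto simp: E_def)
      finally show ?thesis using True TSw[of w] w Wc by (auto simp: c_def)
    next
      case False
      then have j: "j < d" "j \<noteq> i" "j < e" using that i by auto
      have "col (T * E) j = T *\<^sub>v col E j" using j by (intro col_mult2[OF T E]) simp
      also have "col E j = unit_vec d j"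
        using j False by (auto simp: E_def \<sigma>_def Transposition.transpose_def)
      finally show ?thesis using col[OF j(3)] mat_mult_unit_vec[OF T j(1)] by simp
    qed
    have "good (Suc e)"
      unfolding good_def using i S' colE T E by (intro conjI exI[of _ "T * E"] exI[of _ S']) auto
    from max[OF this] show False by simp
  qed
  have "e \<noteq> 0"
  proof
    assume "e = 0"
    have "w = 0\<^sub>v d" if w: "w \<in> W" for w
    proof -
      have "S *\<^sub>v w = 0\<^sub>v d" using zero[OF w] \<open>e = 0\<close> S by (intro eq_vecI) auto
      moreover have "T *\<^sub>v 0\<^sub>v d = 0\<^sub>v d" using T by (intro eq_vecI) auto
      ultimately show ?thesis using TSw[of w] w Wc by auto
    qed
    moreover have "0\<^sub>v d \<in> W" using W by (simp add: subspace_iff)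
    ultimately show False using nz by blast
  qed
  moreover have "e \<noteq> d"
  proof
    assume "e = d"
    have "w \<in> W" if w: "w \<in> carrier_vec d" for w
      using mult_mat_vec_in_subspace[OF W T, of "S *\<^sub>v w"] S w TSw[OF w] col \<open>e = d\<close> by auto
    then show False using Wc proper by auto
  qed
  ultimately show ?thesis using that[OF _ _ T S TS ST col zero] \<open>e \<le> d\<close> by auto
qed

context finite_group begin

text \<open>The value 0 outside the carrier turns equality of characters into equality of functions,
  although representations are arbitrary there.\<close>

definition character :: "('g \<Rightarrow> complex mat) \<Rightarrow> 'g \<Rightarrow> complex" where
  "character \<rho> x = (if x \<in> carrier G then mat_trace (\<rho> x) else 0)"

definition irr_chars :: "('g \<Rightarrow> complex) set" where
  "irr_chars = {character \<rho> | d \<rho>. irreducible_rep G d \<rho>}"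

text \<open>On characters of a finite group \<open>v (inv x)\<close> is the complex conjugate of
  \<open>v x\<close>, so this bilinear form agrees there with the usual Hermitian product.\<close>

definition cinner :: "('g \<Rightarrow> complex) \<Rightarrow> ('g \<Rightarrow> complex) \<Rightarrow> complex" where
  "cinner u v = (\<Sum>x\<in>carrier G. u x * v (inv x)) / of_nat (card (carrier G))"

text \<open>In a basis adapted to \<open>W\<close> all matrices are block upper triangular. Each
  diagonal block is multiplicative by itself, and the trace sees only the diagonal blocks.\<close>

lemma reducible_rep_split:
  assumes \<rho>: "complex_rep G d \<rho>" and W: "invariant_subspace G d \<rho> W"
    and nz: "W \<noteq> {0\<^sub>v d}" and proper: "W \<noteq> carrier_vec d"
  obtains e \<alpha> \<beta> where "0 < e" "e < d" "complex_rep G e \<alpha>" "complex_rep G (d - e) \<beta>"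
    "character \<rho> = (\<lambda>x. character \<alpha> x + character \<beta> x)"
proof -
  have sub: "VectorSpace.subspace class_ring W (module_vec TYPE(complex) d)"
    and inv: "\<And>g v. g \<in> carrier G \<Longrightarrow> v \<in> W \<Longrightarrow> \<rho> g *\<^sub>v v \<in> W"
    using W by (auto simp: invariant_subspace_def)
  obtain e T S where e: "0 < e" "e < d" and T: "T \<in> carrier_mat d d" and S: "S \<in> carrier_mat d d"
    and TS: "T * S = 1\<^sub>m d" and ST: "S * T = 1\<^sub>m d" and col: "\<And>j. j < e \<Longrightarrow> col T j \<in> W"
    and zero: "\<And>w i. w \<in> W \<Longrightarrow> e \<le> i \<Longrightarrow> i < d \<Longrightarrow> (S *\<^sub>v w) $ i = 0"
    using subspace_adapted_basis[OF sub nz proper] by metis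
  note c = rep_carrier[OF \<rho>]
  define \<rho>' where "\<rho>' g = S * (\<rho> g * T)" for g
  have c': "\<rho>' g \<in> carrier_mat d d" if "g \<in> carrier G" for g
    using c[OF that] S T by (simp add: \<rho>'_def)
  have mult: "\<rho>' (g \<otimes> h) = \<rho>' g * \<rho>' h" if g: "g \<in> carrier G" and h: "h \<in> carrier G" for g h
  proof -
    note cg = c[OF g] c[OF h]
    have "\<rho>' g * \<rho>' h = S * ((\<rho> g * T) * (S * (\<rho> h * T)))"
      unfolding \<rho>'_def using cg S T by (intro assoc_mult_mat) auto
    also have "(\<rho> g * T) * (S * (\<rho> h * T)) = \<rho> g * (T * (S * (\<rho> h * T)))"
      using cg S T by (intro assoc_mult_mat) auto
    also have "T * (S * (\<rho> h * T)) = (T * S) * (\<rho> h * T)"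
      using cg S T by (intro assoc_mult_mat[symmetric]) auto
    also have "(T * S) * (\<rho> h * T) = \<rho> h * T" using cg S T TS by simp
    also have "\<rho> g * (\<rho> h * T) = \<rho> (g \<otimes> h) * T"
      unfolding rep_mult[OF \<rho> g h] using cg T by (intro assoc_mult_mat[symmetric]) auto
    finally show ?thesis by (simp add: \<rho>'_def)
  qed
  have one: "\<rho>' \<one> = 1\<^sub>m d" using rep_one[OF \<rho>] S T ST by (simp add: \<rho>'_def)
  have block: "\<rho>' g $$ (i, j) = 0" if g: "g \<in> carrier G" and ij: "j < e" "e \<le> i" "i < d" for g i j
  proof -
    have j: "j < d" using ij by simp
    have "\<rho>' g $$ (i, j) = col (\<rho>' g) j $ i" using c'[OF g] ij by simp
    also have "col (\<rho>' g) j = S *\<^sub>v (\<rho> g *\<^sub>v col T j)"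
      unfolding \<rho>'_def using col_mult2[OF S _ j] col_mult2[OF c[OF g] T j] c[OF g] T by simp
    finally show ?thesis using zero[OF inv[OF g col[OF ij(1)]] ij(2,3)] by simp
  qed
  define \<alpha> where "\<alpha> g = mat e e (\<lambda>(i, j). \<rho>' g $$ (i, j))" for g
  define \<beta> where "\<beta> g = mat (d - e) (d - e) (\<lambda>(i, j). \<rho>' g $$ (i + e, j + e))" for g
  have "complex_rep G e \<alpha>"
    unfolding complex_rep_iff
  proof (intro conjI ballI)
    fix g h assume gh: "g \<in> carrier G" "h \<in> carrier G"
    show "\<alpha> (g \<otimes> h) = \<alpha> g * \<alpha> h"
    proof (rule eq_matI)
      fix i j assume "i < dim_row (\<alpha> g * \<alpha> h)" "j < dim_col (\<alpha> g * \<alpha> h)"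
      then have ij: "i < e" "j < e" by (auto simp: \<alpha>_def)
      have "\<alpha> (g \<otimes> h) $$ (i, j) = (\<Sum>k<d. \<rho>' g $$ (i, k) * \<rho>' h $$ (k, j))"
        using ij e index_mult_mat_sum[OF c'[OF gh(1)] c'[OF gh(2)], of i j]
        by (simp add: \<alpha>_def mult[OF gh])
      also have "\<dots> = (\<Sum>k<e. \<rho>' g $$ (i, k) * \<rho>' h $$ (k, j))"
        using e ij block[OF gh(2)] by (subst sum_lessThan_split[of e]) auto
      also have "\<dots> = (\<alpha> g * \<alpha> h) $$ (i, j)"
        using ij by (subst index_mult_mat_sum[of _ e e _ e]) (auto simp: \<alpha>_def)
      finally show "\<alpha> (g \<otimes> h) $$ (i, j) = (\<alpha> g * \<alpha> h) $$ (i, j)" .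
    qed (auto simp: \<alpha>_def)
  qed (use e one in \<open>auto simp: \<alpha>_def intro!: eq_matI\<close>)
  moreover have "complex_rep G (d - e) \<beta>"
    unfolding complex_rep_iff
  proof (intro conjI ballI)
    fix g h assume gh: "g \<in> carrier G" "h \<in> carrier G"
    show "\<beta> (g \<otimes> h) = \<beta> g * \<beta> h"
    proof (rule eq_matI)
      fix i j assume "i < dim_row (\<beta> g * \<beta> h)" "j < dim_col (\<beta> g * \<beta> h)"
      then have ij: "i < d - e" "j < d - e" by (auto simp: \<beta>_def)
      have "\<beta> (g \<otimes> h) $$ (i, j) = (\<Sum>k<d. \<rho>' g $$ (i + e, k) * \<rho>' h $$ (k, j + e))"
        using ij e index_mult_mat_sum[OF c'[OF gh(1)] c'[OF gh(2)], of "i + e" "j + e"]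
        by (simp add: \<beta>_def mult[OF gh])
      also have "\<dots> = (\<Sum>k<d - e. \<rho>' g $$ (i + e, k + e) * \<rho>' h $$ (k + e, j + e))"
        using e ij block[OF gh(1)] by (subst sum_lessThan_split[of e]) auto
      also have "\<dots> = (\<beta> g * \<beta> h) $$ (i, j)"
        using ij by (subst index_mult_mat_sum[of _ "d - e" "d - e" _ "d - e"]) (auto simp: \<beta>_def)
      finally show "\<beta> (g \<otimes> h) $$ (i, j) = (\<beta> g * \<beta> h) $$ (i, j)" .
    qed (auto simp: \<beta>_def)
  qed (use e one in \<open>auto simp: \<beta>_def intro!: eq_matI\<close>)
  moreover have "character \<rho> x = character \<alpha> x + character \<beta> x" for x
  proof (cases "x \<in> carrier G")
    case True
    have "mat_trace (\<rho> x) = mat_trace (\<rho> x * (T * S))" using c[OF True] TS by simp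
    also have "\<dots> = mat_trace ((\<rho> x * T) * S)"
      using c[OF True] T S by (simp add: assoc_mult_mat)
    also have "\<dots> = mat_trace (\<rho>' x)"
      unfolding \<rho>'_def using c[OF True] T S by (intro mat_trace_mult_comm) auto
    also have "\<dots> = (\<Sum>i<d. \<rho>' x $$ (i, i))" using c'[OF True] by (simp add: mat_trace_def)
    also have "\<dots> = mat_trace (\<alpha> x) + mat_trace (\<beta> x)"
      using e by (subst sum_lessThan_split[of e]) (auto simp: mat_trace_def \<alpha>_def \<beta>_def)
    finally show ?thesis using True by (simp add: character_def)
  qed (simp add: character_def)
  ultimately show ?thesis using that[OF e] by blast
qed

lemma character_decomposition:
  assumes "complex_rep G d \<rho>"
  shows "\<exists>fs. set fs \<subseteq> irr_chars \<and> character \<rho> = (\<lambda>x. \<Sum>f\<leftarrow>fs. f x)"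
  using assms
proof (induction d arbitrary: \<rho> rule: less_induct)
  case (less d)
  show ?case
  proof (cases "d = 0 \<or> irreducible_rep G d \<rho>")
    case True
    then consider "d = 0" | "irreducible_rep G d \<rho>" by blast
    then show ?thesis
    proof cases
      case 1
      then have "character \<rho> = (\<lambda>x. 0)"
        using carrier_matD[OF rep_carrier[OF less.prems]]
        by (auto simp: character_def mat_trace_def fun_eq_iff)
      then show ?thesis by (intro exI[of _ "[]"]) auto
    next
      case 2
      then show ?thesis by (intro exI[of _ "[character \<rho>]"]) (auto simp: irr_chars_def)
    qed
  next
    case False
    then obtain W where W: "invariant_subspace G d \<rho> W" "W \<noteq> {0\<^sub>v d}" "W \<noteq> carrier_vec d"
      using less.prems by (auto simp: irreducible_rep_def)
    obtain e \<alpha> \<beta> where e: "0 < e" "e < d" and \<alpha>: "complex_rep G e \<alpha>" and \<beta>: "complex_rep G (d - e) \<beta>"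
      and eq: "character \<rho> = (\<lambda>x. character \<alpha> x + character \<beta> x)"
      using reducible_rep_split[OF less.prems W] by metis
    obtain fs where fs: "set fs \<subseteq> irr_chars" "character \<alpha> = (\<lambda>x. \<Sum>f\<leftarrow>fs. f x)"
      using less.IH[OF e(2) \<alpha>] by auto
    obtain gs where gs: "set gs \<subseteq> irr_chars" "character \<beta> = (\<lambda>x. \<Sum>f\<leftarrow>gs. f x)"
      using less.IH[OF _ \<beta>] e by auto
    show ?thesis using fs gs eq by (intro exI[of _ "fs @ gs"]) auto
  qed
qed

end

text \<open>Turns the number of equivalence classes of representations into a number of characters,
  with \<open>f\<close> sending a representation to its character.\<close>

lemma card_quotient_kernel:
  "card (A // {(x, y). x \<in> A \<and> y \<in> A \<and> f x = f y}) = card (f ` A)"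
proof (rule bij_betw_same_card[symmetric])
  show "bij_betw (\<lambda>v. {x \<in> A. f x = v}) (f ` A) (A // {(x, y). x \<in> A \<and> y \<in> A \<and> f x = f y})"
    by (rule bij_betwI') (auto simp: quotient_def Image_def intro!: bexI)
qed

section \<open>Orthogonality of irreducible characters and the regular character\<close>

context finite_group begin

lemma card_carrier_nonzero: "(of_nat (card (carrier G)) :: complex) \<noteq> 0"
  using one_closed by (auto simp del: one_closed)

lemma equivalent_reps_character:
  assumes \<rho>: "complex_rep G d \<rho>" and \<tau>: "complex_rep G e \<tau>"
    and eq: "equivalent_reps G (d, \<rho>) (e, \<tau>)"
  shows "character \<rho> = character \<tau>"
proof
  fix x
  from eq obtain P Q where de: "d = e" and P: "P \<in> carrier_mat d d" and Q: "Q \<in> carrier_mat d d"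
    and PQ: "P * Q = 1\<^sub>m d" "Q * P = 1\<^sub>m d" and int: "\<forall>g\<in>carrier G. P * \<rho> g = \<tau> g * P"
    by (auto simp: equivalent_reps_def GL_complex_iff)
  show "character \<rho> x = character \<tau> x"
  proof (cases "x \<in> carrier G")
    case True
    note c = rep_carrier[OF \<rho> True] rep_carrier[OF \<tau> True]
    have "mat_trace (\<tau> x) = mat_trace ((\<tau> x * P) * Q)"
      using c P Q PQ de by simp
    also have "\<dots> = mat_trace ((P * \<rho> x) * Q)" using int True by simp
    also have "\<dots> = mat_trace (Q * (P * \<rho> x))"
      using c P Q by (intro mat_trace_mult_comm) auto
    also have "Q * (P * \<rho> x) = \<rho> x" using c P Q PQ by (simp flip: assoc_mult_mat)
    finally show ?thesis using True by (simp add: character_def)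
  qed (simp add: character_def)
qed

lemma cinner_character:
  assumes \<rho>: "complex_rep G d \<rho>" and \<tau>: "complex_rep G e \<tau>"
  shows "cinner (character \<rho>) (character \<tau>) =
    (\<Sum>i<d. \<Sum>j<e. \<Sum>g\<in>carrier G. \<rho> g $$ (i, i) * \<tau> (inv g) $$ (j, j)) / of_nat (card (carrier G))"
proof -
  have "(\<Sum>g\<in>carrier G. character \<rho> g * character \<tau> (inv g)) =
      (\<Sum>g\<in>carrier G. \<Sum>i<d. \<Sum>j<e. \<rho> g $$ (i, i) * \<tau> (inv g) $$ (j, j))"
    using carrier_matD[OF rep_carrier[OF \<rho>]] carrier_matD[OF rep_carrier[OF \<tau>]]
    by (intro sum.cong) (auto simp: character_def mat_trace_def sum_product)
  also have "\<dots> = (\<Sum>i<d. \<Sum>j<e. \<Sum>g\<in>carrier G. \<rho> g $$ (i, i) * \<tau> (inv g) $$ (j, j))"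
    by (subst sum.swap, intro sum.cong refl, subst sum.swap) (rule refl)
  finally show ?thesis by (simp add: cinner_def)
qed

lemma cinner_character_self:
  assumes "irreducible_rep G d \<rho>"
  shows "cinner (character \<rho>) (character \<rho>) = 1"
proof -
  have rep: "complex_rep G d \<rho>" and d: "d > 0" using assms by (auto simp: irreducible_rep_def)
  have "(\<Sum>i<d. \<Sum>j<d. \<Sum>g\<in>carrier G. \<rho> g $$ (i, i) * \<rho> (inv g) $$ (j, j)) =
      (\<Sum>i<d. \<Sum>j<d. if i = j then of_nat (card (carrier G)) / of_nat d else 0)"
    (is "?S = _") by (intro sum.cong refl, subst matrix_coefficients_self[OF assms]) auto
  also have "\<dots> = of_nat (card (carrier G))" using d by simp
  finally have S: "?S = of_nat (card (carrier G))" .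
  show ?thesis
    unfolding cinner_character[OF rep rep] by (simp only: divide_self[OF card_carrier_nonzero] S)
qed

lemma cinner_character_inequivalent:
  assumes "irreducible_rep G d \<rho>" "irreducible_rep G e \<tau>"
    and "\<not> equivalent_reps G (d, \<rho>) (e, \<tau>)"
  shows "cinner (character \<rho>) (character \<tau>) = 0"
proof -
  have rep: "complex_rep G d \<rho>" "complex_rep G e \<tau>" using assms by (auto simp: irreducible_rep_def)
  show ?thesis
    unfolding cinner_character[OF rep]
    using matrix_coefficients_orthogonal[OF assms] by (simp add: sum.neutral)
qed

lemma equivalent_iff_character:
  assumes "irreducible_rep G d \<rho>" "irreducible_rep G e \<tau>"
  shows "equivalent_reps G (d, \<rho>) (e, \<tau>) \<longleftrightarrow> character \<rho> = character \<tau>"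
proof -
  have "complex_rep G d \<rho>" "complex_rep G e \<tau>" using assms by (auto simp: irreducible_rep_def)
  then show ?thesis
    using equivalent_reps_character cinner_character_self[OF assms(1)]
      cinner_character_inequivalent[OF assms] by force
qed

lemma cinner_irr_chars:
  assumes "\<phi> \<in> irr_chars" "\<psi> \<in> irr_chars"
  shows "cinner \<phi> \<psi> = (if \<phi> = \<psi> then 1 else 0)"
  using assms cinner_character_self cinner_character_inequivalent equivalent_iff_character
  by (fastforce simp: irr_chars_def)

lemma cinner_sum_left:
  "cinner (\<lambda>x. \<Sum>a\<in>A. c a * u a x) v = (\<Sum>a\<in>A. c a * cinner (u a) v)"
  unfolding cinner_def
  by (simp add: sum_distrib_right sum_distrib_left sum_divide_distrib mult.assoc)
    (subst sum.swap, rule refl)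

lemma cinner_sum_right:
  "cinner u (\<lambda>x. \<Sum>a\<in>A. c a * v a x) = (\<Sum>a\<in>A. c a * cinner u (v a))"
  unfolding cinner_def
  by (simp add: sum_distrib_right sum_distrib_left sum_divide_distrib mult_ac)
    (subst sum.swap, rule refl)

lemma cinner_sum_list_left: "cinner (\<lambda>x. \<Sum>f\<leftarrow>fs. f x) v = (\<Sum>f\<leftarrow>fs. cinner f v)"
  unfolding cinner_def
  by (induction fs) (simp_all add: distrib_right sum.distrib add_divide_distrib)

text \<open>\<open>g\<close> sends the basis vector of \<open>f\<close> to \<open>wt g f\<close>
  times the basis vector of \<open>act g f\<close>; the last assumption is the cocycle rule that
  makes this multiplicative. It serves both the regular representation and the colourings.\<close>

lemma monomial_rep:
  fixes act :: "'g \<Rightarrow> 'x \<Rightarrow> 'x" and wt :: "'g \<Rightarrow> 'x \<Rightarrow> complex"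
  assumes X: "finite X"
    and act: "\<And>g f. g \<in> carrier G \<Longrightarrow> f \<in> X \<Longrightarrow> act g f \<in> X"
    and act_one: "\<And>f. f \<in> X \<Longrightarrow> act \<one> f = f"
    and act_mult: "\<And>g h f. g \<in> carrier G \<Longrightarrow> h \<in> carrier G \<Longrightarrow> f \<in> X \<Longrightarrow> act (g \<otimes> h) f = act g (act h f)"
    and wt_one: "\<And>f. f \<in> X \<Longrightarrow> wt \<one> f = 1"
    and wt_mult: "\<And>g h f. g \<in> carrier G \<Longrightarrow> h \<in> carrier G \<Longrightarrow> f \<in> X \<Longrightarrow>
      wt (g \<otimes> h) f = wt g (act h f) * wt h f"
  obtains \<rho> where "complex_rep G (card X) \<rho>"
    "\<And>x. x \<in> carrier G \<Longrightarrow> character \<rho> x = (\<Sum>f\<in>X. if act x f = f then wt x f else 0)"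
proof -
  let ?d = "card X"
  obtain en where en: "bij_betw en {..<?d} X"
    using ex_bij_betw_nat_finite[OF X] by (auto simp: atLeast0LessThan)
  have enX: "en i \<in> X" if "i < ?d" for i using en that by (auto simp: bij_betw_def)
  have en_eq: "en i = en j \<longleftrightarrow> i = j" if "i < ?d" "j < ?d" for i j
    using en that by (auto simp: bij_betw_def inj_on_def)
  define \<rho> where "\<rho> g = mat ?d ?d (\<lambda>(i, j). if act g (en j) = en i then wt g (en j) else 0)" for g
  have "complex_rep G ?d \<rho>"
    unfolding complex_rep_iff
  proof (intro conjI ballI)
    fix g h assume gh: "g \<in> carrier G" "h \<in> carrier G"
    show "\<rho> (g \<otimes> h) = \<rho> g * \<rho> h"
    proof (rule eq_matI)
      fix i j assume "i < dim_row (\<rho> g * \<rho> h)" "j < dim_col (\<rho> g * \<rho> h)"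
      then have ij: "i < ?d" "j < ?d" by (auto simp: \<rho>_def)
      obtain k where k: "k < ?d" "en k = act h (en j)"
        using en act[OF gh(2) enX[OF ij(2)]] by (force simp: bij_betw_def)
      have "(\<rho> g * \<rho> h) $$ (i, j) = (\<Sum>l<?d. \<rho> g $$ (i, l) * \<rho> h $$ (l, j))"
        using ij by (intro index_mult_mat_sum) (auto simp: \<rho>_def)
      also have "\<dots> = (\<Sum>l<?d. if l = k then \<rho> g $$ (i, k) * wt h (en j) else 0)"
        using ij k by (intro sum.cong) (auto simp: \<rho>_def en_eq simp flip: k(2))
      also have "\<dots> = \<rho> (g \<otimes> h) $$ (i, j)"
        using ij k gh enX by (simp add: \<rho>_def act_mult wt_mult)
      finally show "\<rho> (g \<otimes> h) $$ (i, j) = (\<rho> g * \<rho> h) $$ (i, j)" by simp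
    qed (auto simp: \<rho>_def)
  qed (auto simp: \<rho>_def act_one wt_one enX en_eq intro!: eq_matI)
  moreover have "character \<rho> x = (\<Sum>f\<in>X. if act x f = f then wt x f else 0)" if "x \<in> carrier G" for x
  proof -
    have "character \<rho> x = (\<Sum>i<?d. if act x (en i) = en i then wt x (en i) else 0)"
      using that by (auto simp: character_def mat_trace_def \<rho>_def)
    also have "\<dots> = (\<Sum>f\<in>X. if act x f = f then wt x f else 0)"
      by (rule sum.reindex_bij_betw[OF en])
    finally show ?thesis .
  qed
  ultimately show ?thesis using that by blast
qed

text \<open>Recovers the degree from the function alone, as elements of \<open>irr_chars\<close> no
  longer carry it; it is unique because \<open>of_nat\<close> is injective into the complex
  numbers.\<close>

definition degree_of :: "('g \<Rightarrow> complex) \<Rightarrow> nat" where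
  "degree_of \<phi> = (SOME d. \<phi> \<one> = of_nat d)"

lemma character_one:
  assumes "complex_rep G d \<rho>" shows "character \<rho> \<one> = of_nat d" "degree_of (character \<rho>) = d"
  using rep_one[OF assms] by (auto simp: character_def mat_trace_one degree_of_def)

lemma irr_char_one:
  assumes "\<phi> \<in> irr_chars" shows "\<phi> \<one> = of_nat (degree_of \<phi>)" "degree_of \<phi> > 0"
  using assms character_one by (auto simp: irr_chars_def irreducible_rep_def)

lemma irr_char_outside: "\<phi> \<in> irr_chars \<Longrightarrow> x \<notin> carrier G \<Longrightarrow> \<phi> x = 0"
  by (auto simp: irr_chars_def character_def)

lemma num_odd_irreps_eq_card:
  "num_odd_irreps G = card {\<phi> \<in> irr_chars. odd (degree_of \<phi>)}"
proof -
  have "odd_irreps_equiv G =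
      {(x, y). x \<in> odd_irreps G \<and> y \<in> odd_irreps G \<and> character (snd x) = character (snd y)}"
    using equivalent_iff_character by (auto simp: odd_irreps_equiv_def odd_irreps_def)
  then have "num_odd_irreps G = card ((\<lambda>x. character (snd x)) ` odd_irreps G)"
    unfolding num_odd_irreps_def by (simp only: card_quotient_kernel)
  also have "(\<lambda>x. character (snd x)) ` odd_irreps G = {\<phi> \<in> irr_chars. odd (degree_of \<phi>)}"
    using character_one(2)
    by (fastforce simp: irr_chars_def odd_irreps_def irreducible_rep_def image_iff)
  finally show ?thesis .
qed

definition regular_char :: "'g \<Rightarrow> complex" where
  "regular_char x = (if x = \<one> then of_nat (card (carrier G)) else 0)"

lemma cinner_regular_char: "cinner regular_char v = v \<one>"
proof -
  have "(\<Sum>x\<in>carrier G. regular_char x * v (inv x)) =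
      (\<Sum>x\<in>carrier G. if x = \<one> then of_nat (card (carrier G)) * v \<one> else 0)"
    by (intro sum.cong) (auto simp: regular_char_def)
  also have "\<dots> = of_nat (card (carrier G)) * v \<one>" by simp
  finally show ?thesis
    by (simp only: cinner_def nonzero_mult_div_cancel_left[OF card_carrier_nonzero])
qed

lemma regular_char_decomposition:
  "\<exists>fs. set fs \<subseteq> irr_chars \<and> regular_char = (\<lambda>x. \<Sum>f\<leftarrow>fs. f x)"
proof -
  obtain \<rho> where \<rho>: "complex_rep G (card (carrier G)) \<rho>"
    and ch: "\<And>x. x \<in> carrier G \<Longrightarrow> character \<rho> x = (\<Sum>f\<in>carrier G. if x \<otimes> f = f then 1 else 0)"
    by (rule monomial_rep[of "carrier G" "\<lambda>g f. g \<otimes> f" "\<lambda>_ _. 1"]) (auto simp: m_assoc)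
  have "character \<rho> x = regular_char x" for x
  proof (cases "x \<in> carrier G")
    case True
    then have "(\<Sum>f\<in>carrier G. if x \<otimes> f = f then 1 else 0) = (\<Sum>f\<in>carrier G. if x = \<one> then 1 else (0 :: complex))"
      by (intro sum.cong) auto
    then show ?thesis using ch[OF True] by (auto simp: regular_char_def)
  qed (auto simp: character_def regular_char_def)
  then have "character \<rho> = regular_char" by auto
  with character_decomposition[OF \<rho>] show ?thesis by simp
qed

text \<open>Pairing the regular character with \<open>\<phi>\<close> gives
  \<open>\<phi> \<one>\<close>, which is positive, so every irreducible character occurs in one
  fixed finite decomposition.\<close>

lemma finite_irr_chars: "finite irr_chars"
proof -
  obtain fs where fs: "set fs \<subseteq> irr_chars" "regular_char = (\<lambda>x. \<Sum>f\<leftarrow>fs. f x)"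
    using regular_char_decomposition by blast
  have "\<phi> \<in> set fs" if \<phi>: "\<phi> \<in> irr_chars" for \<phi>
  proof (rule ccontr)
    assume "\<phi> \<notin> set fs"
    then have "(\<Sum>f\<leftarrow>fs. cinner f \<phi>) = (\<Sum>f\<leftarrow>fs. 0)"
      using fs(1) \<phi> by (intro arg_cong[of _ _ sum_list] map_cong) (auto simp: cinner_irr_chars subset_iff)
    then have "\<phi> \<one> = 0"
      using cinner_regular_char[of \<phi>] unfolding fs(2) cinner_sum_list_left by simp
    then show False using irr_char_one[OF \<phi>] by simp
  qed
  then show ?thesis by (meson finite_set finite_subset subsetI)
qed

section \<open>Virtual characters and a counting criterion\<close>

definition virtual_chars :: "('g \<Rightarrow> complex) set" where
  "virtual_chars = range (\<lambda>c x. \<Sum>\<phi>\<in>irr_chars. of_int (c \<phi>) * \<phi> x)"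

lemma virtual_charsI: "u = (\<lambda>x. \<Sum>\<phi>\<in>irr_chars. of_int (c \<phi>) * \<phi> x) \<Longrightarrow> u \<in> virtual_chars"
  by (auto simp: virtual_chars_def)

lemma irr_char_virtual:
  assumes "\<phi> \<in> irr_chars" shows "\<phi> \<in> virtual_chars"
proof (rule virtual_charsI)
  have "\<phi> x = (\<Sum>\<psi>\<in>irr_chars. if \<psi> = \<phi> then \<psi> x else 0)" for x
    using assms finite_irr_chars by simp
  also have "\<dots> x = (\<Sum>\<psi>\<in>irr_chars. of_int (if \<psi> = \<phi> then 1 else 0) * \<psi> x)" for x
    by (intro sum.cong) auto
  finally show "\<phi> = (\<lambda>x. \<Sum>\<psi>\<in>irr_chars. of_int (if \<psi> = \<phi> then 1 else 0) * \<psi> x)" by blast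
qed

lemma virtual_chars_zero: "(\<lambda>x. 0) \<in> virtual_chars"
  by (rule virtual_charsI[where c = "\<lambda>_. 0"]) simp

lemma virtual_chars_add:
  assumes "u \<in> virtual_chars" "v \<in> virtual_chars"
  shows "(\<lambda>x. u x + v x) \<in> virtual_chars"
proof -
  obtain c c' where "u = (\<lambda>x. \<Sum>\<phi>\<in>irr_chars. of_int (c \<phi>) * \<phi> x)"
    "v = (\<lambda>x. \<Sum>\<phi>\<in>irr_chars. of_int (c' \<phi>) * \<phi> x)"
    using assms by (auto simp: virtual_chars_def)
  then show ?thesis
    by (intro virtual_charsI[where c = "\<lambda>\<phi>. c \<phi> + c' \<phi>"]) (simp add: distrib_right sum.distrib)
qed

lemma virtual_chars_smult:
  assumes "u \<in> virtual_chars" shows "(\<lambda>x. of_int k * u x) \<in> virtual_chars"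
proof -
  obtain c where "u = (\<lambda>x. \<Sum>\<phi>\<in>irr_chars. of_int (c \<phi>) * \<phi> x)"
    using assms by (auto simp: virtual_chars_def)
  then show ?thesis
    by (intro virtual_charsI[where c = "\<lambda>\<phi>. k * c \<phi>"]) (simp add: sum_distrib_left mult.assoc)
qed

lemma virtual_chars_sum:
  assumes "\<And>a. a \<in> A \<Longrightarrow> u a \<in> virtual_chars"
  shows "(\<lambda>x. \<Sum>a\<in>A. u a x) \<in> virtual_chars"
  using assms
  by (induction A rule: infinite_finite_induct) (auto intro: virtual_chars_zero virtual_chars_add)

lemma sum_list_irr_virtual: "set fs \<subseteq> irr_chars \<Longrightarrow> (\<lambda>x. \<Sum>f\<leftarrow>fs. f x) \<in> virtual_chars"
  by (induction fs) (auto intro: virtual_chars_zero virtual_chars_add irr_char_virtual)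

lemma character_virtual: "complex_rep G d \<rho> \<Longrightarrow> character \<rho> \<in> virtual_chars"
  using character_decomposition[of d \<rho>] sum_list_irr_virtual by fastforce

lemma cinner_virtual_irr:
  assumes "u = (\<lambda>x. \<Sum>\<phi>\<in>irr_chars. of_int (c \<phi>) * \<phi> x)" "\<psi> \<in> irr_chars"
  shows "cinner u \<psi> = of_int (c \<psi>)"
proof -
  have "cinner u \<psi> = (\<Sum>\<phi>\<in>irr_chars. of_int (c \<phi>) * cinner \<phi> \<psi>)"
    unfolding assms(1) by (rule cinner_sum_left)
  also have "\<dots> = (\<Sum>\<phi>\<in>irr_chars. if \<phi> = \<psi> then of_int (c \<phi>) else 0)"
    using assms(2) by (intro sum.cong) (auto simp: cinner_irr_chars)
  finally show ?thesis using assms(2) finite_irr_chars by simp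
qed

text \<open>The multiplicity of \<open>\<phi>\<close> in the regular character is
  \<open>\<phi> \<one>\<close>; evaluation at the identity gives the claim.\<close>

lemma sum_degree_squares: "(\<Sum>\<phi>\<in>irr_chars. (degree_of \<phi>)\<^sup>2) = card (carrier G)"
proof -
  have "regular_char \<in> virtual_chars"
    using regular_char_decomposition sum_list_irr_virtual by fastforce
  then obtain c where c: "regular_char = (\<lambda>x. \<Sum>\<phi>\<in>irr_chars. of_int (c \<phi>) * \<phi> x)"
    by (auto simp: virtual_chars_def)
  have c_eq: "of_int (c \<phi>) = \<phi> \<one>" if "\<phi> \<in> irr_chars" for \<phi>
    using cinner_virtual_irr[OF c that] by (simp add: cinner_regular_char)
  have "of_nat (card (carrier G)) = (\<Sum>\<phi>\<in>irr_chars. \<phi> \<one> * \<phi> \<one>)"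
    using fun_cong[OF c, of \<one>] by (simp add: regular_char_def c_eq)
  also have "\<dots> = of_nat (\<Sum>\<phi>\<in>irr_chars. (degree_of \<phi>)\<^sup>2)"
    by (simp add: irr_char_one(1) power2_eq_square)
  finally show ?thesis by (simp only: of_nat_eq_iff)
qed

text \<open>The norm is the sum of the squares of the integer multiplicities, and integers whose
  squares add up to 1 are all zero except for one that is 1 or -1.\<close>

lemma virtual_norm_one:
  assumes u: "u \<in> virtual_chars" and norm: "cinner u u = 1"
  shows "\<exists>\<phi>\<in>irr_chars. \<exists>s\<in>{1, -1 :: int}. u = (\<lambda>x. of_int s * \<phi> x)"
proof -
  obtain c where c: "u = (\<lambda>x. \<Sum>\<phi>\<in>irr_chars. of_int (c \<phi>) * \<phi> x)"
    using u by (auto simp: virtual_chars_def)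
  have "cinner u u = (\<Sum>\<phi>\<in>irr_chars. of_int (c \<phi>) * cinner u \<phi>)"
    by (subst (2) c) (rule cinner_sum_right)
  also have "\<dots> = of_int (\<Sum>\<phi>\<in>irr_chars. (c \<phi>)\<^sup>2)"
    by (simp add: cinner_virtual_irr[OF c] power2_eq_square)
  finally have sum1: "(\<Sum>\<phi>\<in>irr_chars. (c \<phi>)\<^sup>2) = 1" using norm by (metis of_int_eq_1_iff)
  then obtain \<phi> where \<phi>: "\<phi> \<in> irr_chars" "c \<phi> \<noteq> 0"
    by (metis (no_types, lifting) power_zero_numeral sum.neutral zero_neq_one)
  have split: "(\<Sum>\<psi>\<in>irr_chars. (c \<psi>)\<^sup>2) = (c \<phi>)\<^sup>2 + (\<Sum>\<psi>\<in>irr_chars - {\<phi>}. (c \<psi>)\<^sup>2)"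
    using \<phi> finite_irr_chars by (intro sum.remove)
  have ge1: "(c \<phi>)\<^sup>2 \<ge> 1" using \<phi>(2) by (simp add: int_one_le_iff_zero_less)
  have ge0: "(\<Sum>\<psi>\<in>irr_chars - {\<phi>}. (c \<psi>)\<^sup>2) \<ge> 0" by (intro sum_nonneg) simp
  have "(\<Sum>\<psi>\<in>irr_chars - {\<phi>}. (c \<psi>)\<^sup>2) = 0" and c1: "(c \<phi>)\<^sup>2 = 1"
    using split sum1 ge1 ge0 by linarith+
  then have "\<forall>\<psi>\<in>irr_chars - {\<phi>}. (c \<psi>)\<^sup>2 = 0"
    using finite_irr_chars by (subst (asm) sum_nonneg_eq_0_iff) auto
  then have other: "c \<psi> = 0" if "\<psi> \<in> irr_chars" "\<psi> \<noteq> \<phi>" for \<psi> using that by auto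
  have "u x = of_int (c \<phi>) * \<phi> x" for x
  proof -
    have "u x = (\<Sum>\<psi>\<in>irr_chars. if \<psi> = \<phi> then of_int (c \<phi>) * \<phi> x else 0)"
      unfolding c by (intro sum.cong) (auto simp: other)
    then show ?thesis using \<phi> finite_irr_chars by simp
  qed
  moreover have "c \<phi> \<in> {1, -1}" using c1 by (auto simp: power2_eq_1_iff)
  ultimately show ?thesis using \<phi>(1) by blast
qed

text \<open>\<open>B\<close> is a redundant parameter set. Each \<open>s b\<close> is an irreducible
  character up to sign, and \<open>q b b'\<close> is nonzero exactly if \<open>b\<close> and
  \<open>b'\<close> give the same one, so every irreducible character that is reached is reached
  \<open>w\<close> times. The assumption \<open>total\<close> makes the squared degrees of those
  reached add up to the group order, which leaves no room for a missing one.\<close>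

lemma num_odd_irreps_by_virtual_chars:
  fixes s :: "'b \<Rightarrow> 'g \<Rightarrow> complex" and q :: "'b \<Rightarrow> 'b \<Rightarrow> int" and f :: "'b \<Rightarrow> int"
  assumes B: "finite B"
    and virt: "\<And>b. b \<in> B \<Longrightarrow> s b \<in> virtual_chars"
    and inner: "\<And>b b'. b \<in> B \<Longrightarrow> b' \<in> B \<Longrightarrow> cinner (s b) (s b') = of_int (q b b')"
    and diag: "\<And>b. b \<in> B \<Longrightarrow> q b b = 1"
    and fibre: "\<And>b. b \<in> B \<Longrightarrow> card {b' \<in> B. q b b' \<noteq> 0} = w" and w: "w > 0"
    and deg: "\<And>b. b \<in> B \<Longrightarrow> s b \<one> = of_int (f b)"
    and total: "(\<Sum>b\<in>B. (f b)\<^sup>2) = int (w * card (carrier G))"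
  shows "w * num_odd_irreps G = card {b \<in> B. odd (f b)}"
proof -
  have "\<exists>\<phi> t. \<phi> \<in> irr_chars \<and> t \<in> {1, -1 :: int} \<and> s b = (\<lambda>x. of_int t * \<phi> x)" if "b \<in> B" for b
  proof -
    have "cinner (s b) (s b) = 1" using inner[OF that that] diag[OF that] by simp
    from virtual_norm_one[OF virt[OF that] this] show ?thesis by blast
  qed
  then obtain \<phi> t where \<phi>: "\<And>b. b \<in> B \<Longrightarrow> \<phi> b \<in> irr_chars"
    and t: "\<And>b. b \<in> B \<Longrightarrow> t b \<in> {1, -1 :: int}"
    and s: "\<And>b. b \<in> B \<Longrightarrow> s b = (\<lambda>x. of_int (t b) * \<phi> b x)" by metis
  have q: "q b b' \<noteq> 0 \<longleftrightarrow> \<phi> b' = \<phi> b" if b: "b \<in> B" "b' \<in> B" for b b'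
  proof -
    have "cinner (s b) (s b') = of_int (t b) * of_int (t b') * cinner (\<phi> b) (\<phi> b')"
      unfolding s[OF b(1)] s[OF b(2)] cinner_def by (simp add: sum_distrib_left mult_ac)
    then have "of_int (q b b') = (if \<phi> b' = \<phi> b then of_int (t b * t b') else (0 :: complex))"
      using inner[OF b] \<phi> b by (auto simp: cinner_irr_chars)
    then have "q b b' = (if \<phi> b' = \<phi> b then t b * t b' else 0)"
      by (metis of_int_0 of_int_eq_iff)
    then show ?thesis using t[OF b(1)] t[OF b(2)] by auto
  qed
  have fib: "card {b' \<in> B. \<phi> b' = \<psi>} = w" if "\<psi> \<in> \<phi> ` B" for \<psi>
  proof -
    from that obtain b where b: "b \<in> B" "\<psi> = \<phi> b" by auto
    then have "{b' \<in> B. \<phi> b' = \<psi>} = {b' \<in> B. q b b' \<noteq> 0}" using q by auto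
    then show ?thesis using fibre b by simp
  qed
  have f: "f b = t b * int (degree_of (\<phi> b))" if "b \<in> B" for b
  proof -
    have "complex_of_int (f b) = of_int (t b * int (degree_of (\<phi> b)))"
      using deg[OF that] s[OF that] irr_char_one(1)[OF \<phi>[OF that]] by simp
    then show ?thesis by (simp only: of_int_eq_iff)
  qed
  have f2: "(f b)\<^sup>2 = int ((degree_of (\<phi> b))\<^sup>2)" if "b \<in> B" for b
    using t[OF that] f[OF that] by (auto simp: power_mult_distrib)
  have "int (w * card (carrier G)) = int (\<Sum>b\<in>B. (degree_of (\<phi> b))\<^sup>2)"
    using total by (simp add: f2)
  then have "w * card (carrier G) = (\<Sum>b\<in>B. (degree_of (\<phi> b))\<^sup>2)" by (simp only: of_nat_eq_iff)
  also have "\<dots> = (\<Sum>\<psi>\<in>\<phi> ` B. \<Sum>b\<in>{b \<in> B. \<phi> b = \<psi>}. (degree_of (\<phi> b))\<^sup>2)"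
    by (rule sum.image_gen[OF B])
  also have "\<dots> = (\<Sum>\<psi>\<in>\<phi> ` B. w * (degree_of \<psi>)\<^sup>2)"
    by (intro sum.cong refl) (simp add: fib)
  finally have "(\<Sum>\<psi>\<in>\<phi> ` B. (degree_of \<psi>)\<^sup>2) = card (carrier G)"
    using w by (simp flip: sum_distrib_left)
  then have eq: "(\<Sum>\<psi>\<in>\<phi> ` B. (degree_of \<psi>)\<^sup>2) = (\<Sum>\<psi>\<in>irr_chars. (degree_of \<psi>)\<^sup>2)"
    by (simp add: sum_degree_squares)
  have "\<phi> ` B = irr_chars"
  proof (rule ccontr)
    assume "\<phi> ` B \<noteq> irr_chars"
    then obtain \<psi> where "\<psi> \<in> irr_chars - \<phi> ` B" using \<phi> by auto
    then have "(\<Sum>\<psi>\<in>\<phi> ` B. (degree_of \<psi>)\<^sup>2) < (\<Sum>\<psi>\<in>irr_chars. (degree_of \<psi>)\<^sup>2)"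
      using \<phi> irr_char_one(2) by (intro sum_strict_mono2[OF finite_irr_chars]) auto
    with eq show False by simp
  qed
  have odd_f: "odd (f b) \<longleftrightarrow> odd (degree_of (\<phi> b))" if "b \<in> B" for b
    using t[OF that] f[OF that] by auto
  have "card {b \<in> B. odd (f b)} = (\<Sum>b\<in>B. if odd (degree_of (\<phi> b)) then 1 else 0)"
  proof -
    have "{b \<in> B. odd (f b)} = {b \<in> B. odd (degree_of (\<phi> b))}" using odd_f by blast
    then show ?thesis using B by (simp add: sum.If_cases Int_def)
  qed
  also have "\<dots> = (\<Sum>\<psi>\<in>\<phi> ` B. \<Sum>b\<in>{b \<in> B. \<phi> b = \<psi>}. if odd (degree_of (\<phi> b)) then 1 else 0)"
    by (rule sum.image_gen[OF B])
  also have "\<dots> = (\<Sum>\<psi>\<in>irr_chars. if odd (degree_of \<psi>) then w else 0)"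
    unfolding \<open>\<phi> ` B = irr_chars\<close>[symmetric] by (intro sum.cong refl) (auto simp: fib)
  also have "\<dots> = w * num_odd_irreps G"
    using finite_irr_chars by (simp add: num_odd_irreps_eq_card sum.If_cases Int_def)
  finally show ?thesis by simp
qed

end

text \<open>Pulling back along \<open>\<theta>\<close> keeps invariant subspaces and degrees and is
  injective on characters. The inequality is enough because the inverse isomorphism supplies the
  other direction.\<close>

lemma num_odd_irreps_iso_le:
  assumes G: "finite_group G" and H: "finite_group H" and iso: "\<theta> \<in> iso G H"
  shows "num_odd_irreps H \<le> num_odd_irreps G"
proof -
  interpret G: finite_group G by (rule G)
  interpret H: finite_group H by (rule H)
  have hom: "\<theta> \<in> hom G H" and onto: "\<theta> ` carrier G = carrier H"
    using iso by (auto simp: iso_def bij_betw_def)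
  have \<theta>: "\<theta> x \<in> carrier H" if "x \<in> carrier G" for x using onto that by auto
  have irr: "irreducible_rep G d (\<rho> \<circ> \<theta>)" if \<rho>: "irreducible_rep H d \<rho>" for d \<rho>
  proof -
    have "complex_rep G d (\<rho> \<circ> \<theta>)"
      using \<rho> hom_compose[OF hom] by (auto simp: irreducible_rep_def complex_rep_def)
    moreover have "invariant_subspace G d (\<rho> \<circ> \<theta>) W \<longleftrightarrow> invariant_subspace H d \<rho> W" for W
      unfolding invariant_subspace_def onto[symmetric] by auto
    ultimately show ?thesis using \<rho> by (simp add: irreducible_rep_def)
  qed
  define J where "J \<phi> x = (if x \<in> carrier G then \<phi> (\<theta> x) else 0)" for \<phi> :: "_ \<Rightarrow> complex" and x
  have J: "J (H.character \<rho>) = G.character (\<rho> \<circ> \<theta>)" for \<rho>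
    using \<theta> by (auto simp: J_def G.character_def H.character_def)
  have "inj_on J H.irr_chars"
  proof (rule inj_onI, rule ext)
    fix \<phi> \<psi> y assume *: "\<phi> \<in> H.irr_chars" "\<psi> \<in> H.irr_chars" "J \<phi> = J \<psi>"
    show "\<phi> y = \<psi> y"
    proof (cases "y \<in> carrier H")
      case True
      then obtain x where "x \<in> carrier G" "y = \<theta> x" using onto by auto
      then show ?thesis using fun_cong[OF *(3), of x] by (simp add: J_def)
    qed (use * in \<open>simp add: H.irr_char_outside\<close>)
  qed
  moreover have "J ` {\<phi> \<in> H.irr_chars. odd (H.degree_of \<phi>)} \<subseteq> {\<phi> \<in> G.irr_chars. odd (G.degree_of \<phi>)}"
  proof clarify
    fix \<phi> assume \<phi>: "\<phi> \<in> H.irr_chars" and o: "odd (H.degree_of \<phi>)"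
    then obtain d \<rho> where \<rho>: "irreducible_rep H d \<rho>" "\<phi> = H.character \<rho>"
      by (auto simp: H.irr_chars_def)
    have "H.degree_of \<phi> = d" "G.degree_of (J \<phi>) = d"
      using \<rho>(1) irr[OF \<rho>(1)] unfolding \<rho>(2) J
      by (auto simp: irreducible_rep_def H.character_one G.character_one)
    then show "J \<phi> \<in> G.irr_chars \<and> odd (G.degree_of (J \<phi>))"
      using irr[OF \<rho>(1)] o unfolding \<rho>(2) J by (auto simp: G.irr_chars_def)
  qed
  ultimately show ?thesis
    unfolding G.num_odd_irreps_eq_card H.num_odd_irreps_eq_card
    using G.finite_irr_chars by (intro card_inj_on_le[of J]) (auto intro: inj_on_subset)
qed

lemma num_odd_irreps_iso:
  assumes "finite_group G" "finite_group H" "\<theta> \<in> iso G H"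
  shows "num_odd_irreps G = num_odd_irreps H"
  using num_odd_irreps_iso_le[OF assms]
    num_odd_irreps_iso_le[OF assms(2,1) group.iso_set_sym[OF _ assms(3)]] assms(1)
  by (auto simp: finite_group_def)

section \<open>The Jacobi-Trudi identity\<close>

text \<open>The coefficient of \<open>x^\<alpha>\<close> in the Vandermonde determinant in
  \<open>k\<close> variables; it is 0 unless \<open>\<alpha>\<close> lists a permutation of the
  numbers below \<open>k\<close>.\<close>

definition alternant :: "nat \<Rightarrow> (nat \<Rightarrow> int) \<Rightarrow> int" where
  "alternant k \<alpha> = (\<Sum>w | w permutes {..<k}. if \<forall>i<k. \<alpha> i = int (w i) then sign w else 0)"

text \<open>Integer exponents make the difference of exponent vectors a true subtraction, so that
  coefficients of products with the Vandermonde determinant are values of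
  \<open>alternant\<close>.\<close>

definition laurent_monom :: "(nat \<Rightarrow> int) \<Rightarrow> ((nat \<Rightarrow> int) \<Rightarrow>\<^sub>0 int)" where
  "laurent_monom \<epsilon> = Poly_Mapping.single \<epsilon> 1"

definition laurent_var :: "nat \<Rightarrow> ((nat \<Rightarrow> int) \<Rightarrow>\<^sub>0 int)" where
  "laurent_var i = laurent_monom (\<lambda>j. if j = i then 1 else 0)"

lemma laurent_monom_mult: "laurent_monom a * laurent_monom b = laurent_monom (\<lambda>i. a i + b i)"
  by (simp add: laurent_monom_def mult_single plus_fun_def)

lemma laurent_monom_zero: "laurent_monom (\<lambda>_. 0) = 1"
  by (simp add: laurent_monom_def flip: zero_fun_def)

lemma laurent_var_power: "laurent_var i ^ m = laurent_monom (\<lambda>j. if j = i then int m else 0)"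
  by (induction m)
    (auto simp: laurent_var_def laurent_monom_mult simp flip: laurent_monom_zero
      intro!: arg_cong[of _ _ laurent_monom])

lemma prod_laurent_monom:
  "(\<Prod>a\<in>A. laurent_monom (f a)) = laurent_monom (\<lambda>i. \<Sum>a\<in>A. f a i)"
  by (induction A rule: infinite_finite_induct) (simp_all add: laurent_monom_zero laurent_monom_mult)

lemma prod_laurent_var:
  "(\<Prod>i<k. laurent_var i ^ f i) = laurent_monom (\<lambda>i. if i < k then int (f i) else 0)"
  unfolding laurent_var_power prod_laurent_monom
  by (intro arg_cong[of _ _ laurent_monom]) auto

lemma lookup_of_int_mult: "Poly_Mapping.lookup (of_int c * p) v = c * Poly_Mapping.lookup p v"
  for p :: "'a :: monoid_add \<Rightarrow>\<^sub>0 int"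
  by (induction c rule: int_induct[of _ 0])
    (simp_all add: distrib_right left_diff_distrib Poly_Mapping.lookup_add Poly_Mapping.lookup_minus)

definition vandermonde :: "nat \<Rightarrow> ((nat \<Rightarrow> int) \<Rightarrow>\<^sub>0 int)" where
  "vandermonde k = (\<Sum>w | w permutes {..<k}. of_int (sign w) * (\<Prod>i<k. laurent_var i ^ w i))"

lemma lookup_laurent_monom: "Poly_Mapping.lookup (laurent_monom a) v = (if a = v then 1 else 0)"
  unfolding laurent_monom_def Poly_Mapping.lookup_single when_def by (rule refl)

lemma lookup_monom_mult_vandermonde:
  assumes "\<And>i. i \<ge> k \<Longrightarrow> a i = 0" "\<And>i. i \<ge> k \<Longrightarrow> v i = 0"
  shows "Poly_Mapping.lookup (laurent_monom a * vandermonde k) v = alternant k (\<lambda>i. v i - a i)"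
proof -
  have "laurent_monom a * vandermonde k =
      (\<Sum>w | w permutes {..<k}. of_int (sign w) * laurent_monom (\<lambda>i. a i + (if i < k then int (w i) else 0)))"
    unfolding vandermonde_def prod_laurent_var sum_distrib_left
    by (intro sum.cong refl) (simp add: laurent_monom_mult[symmetric] mult.left_commute)
  also have "Poly_Mapping.lookup \<dots> v = alternant k (\<lambda>i. v i - a i)"
    unfolding alternant_def Poly_Mapping.lookup_sum lookup_of_int_mult lookup_laurent_monom
  proof (intro sum.cong refl)
    fix w assume "w \<in> {w. w permutes {..<k}}"
    have "(\<lambda>i. a i + (if i < k then int (w i) else 0)) = v \<longleftrightarrow> (\<forall>i<k. v i - a i = int (w i))"
      unfolding fun_eq_iff
    proof (intro iffI allI impI)
      fix i assume "\<forall>i. a i + (if i < k then int (w i) else 0) = v i" "i < k"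
      then show "v i - a i = int (w i)" by (auto dest: spec[of _ i])
    next
      fix i assume "\<forall>i<k. v i - a i = int (w i)"
      then show "a i + (if i < k then int (w i) else 0) = v i" using assms[of i] by (cases "i < k") auto
    qed
    then show "sign w * (if (\<lambda>i. a i + (if i < k then int (w i) else 0)) = v then 1 else 0) =
        (if \<forall>i<k. v i - a i = int (w i) then sign w else 0)" by simp
  qed
  finally show ?thesis .
qed

text \<open>The generating function of the complete homogeneous symmetric polynomials, the product
  of the series \<open>1 / (1 - x_i t)\<close>.\<close>

definition h_fps :: "nat \<Rightarrow> ((nat \<Rightarrow> int) \<Rightarrow>\<^sub>0 int) fps" where
  "h_fps k = (\<Prod>i<k. Abs_fps (\<lambda>n. laurent_var i ^ n))"

text \<open>An integer index with value 0 on negative indices is the convention of the Jacobi-Trudi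
  determinant.\<close>

definition h_poly :: "nat \<Rightarrow> int \<Rightarrow> ((nat \<Rightarrow> int) \<Rightarrow>\<^sub>0 int)" where
  "h_poly k z = (if z < 0 then 0 else fps_nth (h_fps k) (nat z))"

text \<open>The cut-off \<open>M\<close> keeps the index set finite and the same for all
  coefficients up to \<open>M\<close>, so the induction can pass to smaller \<open>m\<close> without
  changing it.\<close>

lemma fps_nth_prod_geometric:
  fixes y :: "nat \<Rightarrow> 'a :: comm_ring_1"
  assumes "finite A" "m \<le> M"
  shows "fps_nth (\<Prod>i\<in>A. Abs_fps (\<lambda>n. y i ^ n)) m =
    (\<Sum>\<epsilon>\<in>A \<rightarrow>\<^sub>E {..M}. if sum \<epsilon> A = m then \<Prod>i\<in>A. y i ^ \<epsilon> i else 0)"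
  using assms
proof (induction A arbitrary: m rule: finite_induct)
  case empty
  then show ?case by auto
next
  case (insert a A)
  have "(\<Sum>\<epsilon>\<in>insert a A \<rightarrow>\<^sub>E {..M}. if sum \<epsilon> (insert a A) = m then \<Prod>i\<in>insert a A. y i ^ \<epsilon> i else 0) =
      (\<Sum>(j, \<epsilon>)\<in>{..M} \<times> (A \<rightarrow>\<^sub>E {..M}). if j + sum \<epsilon> A = m then y a ^ j * (\<Prod>i\<in>A. y i ^ \<epsilon> i) else 0)"
    unfolding PiE_insert_eq
  proof (subst sum.reindex)
    show "inj_on (\<lambda>(y, g). g(a := y)) ({..M} \<times> (A \<rightarrow>\<^sub>E {..M}))"
      using insert.hyps(2) by (rule inj_combinator)
    have *: "sum (\<epsilon>(a := j)) A = sum \<epsilon> A" "(\<Prod>i\<in>A. y i ^ (\<epsilon>(a := j)) i) = (\<Prod>i\<in>A. y i ^ \<epsilon> i)" for \<epsilon> j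
      using insert.hyps(2) by (auto intro!: sum.cong prod.cong)
    show "sum ((\<lambda>\<epsilon>. if sum \<epsilon> (insert a A) = m then \<Prod>i\<in>insert a A. y i ^ \<epsilon> i else 0) \<circ> (\<lambda>(y, g). g(a := y)))
        ({..M} \<times> (A \<rightarrow>\<^sub>E {..M})) =
      (\<Sum>(j, \<epsilon>)\<in>{..M} \<times> (A \<rightarrow>\<^sub>E {..M}). if j + sum \<epsilon> A = m then y a ^ j * (\<Prod>i\<in>A. y i ^ \<epsilon> i) else 0)"
      using insert.hyps by (intro sum.cong refl) (auto simp: * simp del: fun_upd_apply simp: fun_upd_same)
  qed
  also have "\<dots> = (\<Sum>j\<le>M. \<Sum>\<epsilon>\<in>A \<rightarrow>\<^sub>E {..M}. if j + sum \<epsilon> A = m then y a ^ j * (\<Prod>i\<in>A. y i ^ \<epsilon> i) else 0)"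
    by (rule sum.cartesian_product[symmetric])
  also have "\<dots> = (\<Sum>j\<in>{0..m}. \<Sum>\<epsilon>\<in>A \<rightarrow>\<^sub>E {..M}. if j + sum \<epsilon> A = m then y a ^ j * (\<Prod>i\<in>A. y i ^ \<epsilon> i) else 0)"
    using insert.prems by (intro sum.mono_neutral_right) auto
  also have "\<dots> = (\<Sum>j\<in>{0..m}. y a ^ j * fps_nth (\<Prod>i\<in>A. Abs_fps (\<lambda>n. y i ^ n)) (m - j))"
  proof (intro sum.cong refl)
    fix j assume j: "j \<in> {0..m}"
    then have "fps_nth (\<Prod>i\<in>A. Abs_fps (\<lambda>n. y i ^ n)) (m - j) =
        (\<Sum>\<epsilon>\<in>A \<rightarrow>\<^sub>E {..M}. if sum \<epsilon> A = m - j then \<Prod>i\<in>A. y i ^ \<epsilon> i else 0)"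
      using insert.prems by (intro insert.IH) auto
    then show "(\<Sum>\<epsilon>\<in>A \<rightarrow>\<^sub>E {..M}. if j + sum \<epsilon> A = m then y a ^ j * (\<Prod>i\<in>A. y i ^ \<epsilon> i) else 0) =
        y a ^ j * fps_nth (\<Prod>i\<in>A. Abs_fps (\<lambda>n. y i ^ n)) (m - j)"
      unfolding sum_distrib_left using j by (auto simp: sum_distrib_left intro!: sum.cong)
  qed
  also have "\<dots> = fps_nth (\<Prod>i\<in>insert a A. Abs_fps (\<lambda>n. y i ^ n)) m"
    using insert.hyps by (simp add: fps_mult_nth)
  finally show ?case by simp
qed

lemma h_poly_expand:
  assumes "z \<le> int M"
  shows "h_poly k z =
    (\<Sum>\<epsilon>\<in>{..<k} \<rightarrow>\<^sub>E {..M}. if int (sum \<epsilon> {..<k}) = z then \<Prod>i<k. laurent_var i ^ \<epsilon> i else 0)"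
proof (cases "z < 0")
  case True
  then have "int s \<noteq> z" for s by simp
  with True show ?thesis by (simp add: h_poly_def del: of_nat_sum)
next
  case False
  then have "int s = z \<longleftrightarrow> s = nat z" for s by auto
  then show ?thesis
    using False assms unfolding h_poly_def h_fps_def
    by (subst fps_nth_prod_geometric[of _ _ M]) (auto simp: nat_le_iff simp del: of_nat_sum)
qed

lemma geometric_fps_inverse:
  fixes y :: "'a :: comm_ring_1"
  shows "(1 - fps_const y * fps_X) * Abs_fps (\<lambda>n. y ^ n) = 1"
proof (rule fps_ext)
  fix n show "fps_nth ((1 - fps_const y * fps_X) * Abs_fps (\<lambda>n. y ^ n)) n = fps_nth 1 n"
    by (cases n) (auto simp: left_diff_distrib mult.assoc)
qed

text \<open>The power \<open>y\<^sub>l ^ b\<close> in terms of complete homogeneous polynomials comes from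
  \<open>(\<Prod>i\<noteq>l. 1 - y\<^sub>i t) \<cdot> (\<Prod>i. 1 / (1 - y\<^sub>i t)) = 1 / (1 - y\<^sub>l t)\<close>.\<close>

lemma laurent_var_power_as_h:
  obtains m where "\<And>l b. l < k \<Longrightarrow>
    laurent_var l ^ b = (\<Sum>j<k. m l j * h_poly k (int b - int j))"
proof -
  define E where "E l = (\<Prod>i\<in>{..<k} - {l}. 1 - fps_const (laurent_var i) * fps_X)" for l
  \<comment> \<open>A product of \<open>card A\<close> factors linear in \<open>t\<close> has degree
    at most \<open>card A\<close>; for \<open>E l\<close> this is \<open>k - 1\<close>.\<close>
  have E_high: "fps_nth (\<Prod>i\<in>A. 1 - fps_const (laurent_var i) * fps_X) j = 0"
    if "finite A" "card A < j" for A j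
    using that
  proof (induction A arbitrary: j rule: finite_induct)
    case (insert a A)
    then show ?case by (cases j) (auto simp: left_diff_distrib mult.assoc)
  qed auto
  have "laurent_var l ^ b = (\<Sum>j<k. fps_nth (E l) j * h_poly k (int b - int j))" if l: "l < k" for l b
  proof -
    have "E l * h_fps k = (\<Prod>i\<in>{..<k} - {l}. (1 - fps_const (laurent_var i) * fps_X) *
        Abs_fps (\<lambda>n. laurent_var i ^ n)) * Abs_fps (\<lambda>n. laurent_var l ^ n)"
      using l by (simp add: E_def h_fps_def prod.distrib prod.remove[of "{..<k}" l] mult_ac)
    then have eq: "E l * h_fps k = Abs_fps (\<lambda>n. laurent_var l ^ n)"
      by (simp add: geometric_fps_inverse)
    have "laurent_var l ^ b = fps_nth (E l * h_fps k) b" by (simp add: eq)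
    also have "\<dots> = (\<Sum>j=0..b. fps_nth (E l) j * h_poly k (int b - int j))"
      unfolding fps_mult_nth by (intro sum.cong refl) (auto simp: h_poly_def nat_diff_distrib)
    \<comment> \<open>The range of \<open>j\<close> is changed to \<open>{..<k}\<close> by way of
      the union. Indices above \<open>b\<close> add nothing because \<open>h_poly\<close> vanishes
      there, and indices from \<open>k\<close> on because \<open>E l\<close> does. The coefficients
      thus do not depend on \<open>b\<close>.\<close>
    also have "\<dots> = (\<Sum>j\<in>{0..b} \<union> {..<k}. fps_nth (E l) j * h_poly k (int b - int j))"
      by (rule sum.mono_neutral_left) (auto simp: h_poly_def)
    also have "\<dots> = (\<Sum>j<k. fps_nth (E l) j * h_poly k (int b - int j))"
    proof (rule sum.mono_neutral_right)
      show "\<forall>j\<in>{0..b} \<union> {..<k} - {..<k}. fps_nth (E l) j * h_poly k (int b - int j) = 0"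
      proof
        fix j assume "j \<in> {0..b} \<union> {..<k} - {..<k}"
        then have "j \<ge> k" by auto
        then have "card ({..<k} - {l}) < j" using l by simp
        from E_high[OF _ this] show "fps_nth (E l) j * h_poly k (int b - int j) = 0"
          by (simp add: E_def)
      qed
    qed auto
    finally show ?thesis .
  qed
  then show ?thesis by (rule that)
qed

text \<open>By \<open>laurent_var_power_as_h\<close> the matrix of powers factors as
  \<open>H u * N\<close> with \<open>N\<close> independent of \<open>u\<close>. Taking
  \<open>u = int\<close> makes \<open>H\<close> unitriangular and identifies \<open>det N\<close> as
  the Vandermonde determinant.\<close>

lemma jacobi_trudi:
  assumes "\<And>i. i < k \<Longrightarrow> 0 \<le> u i"
  shows "det (mat k k (\<lambda>(i, j). h_poly k (u i - int j))) * vandermonde k =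
    (\<Sum>w | w permutes {..<k}. of_int (sign w) * (\<Prod>i<k. laurent_var i ^ nat (u (w i))))"
proof -
  obtain m where m: "\<And>l b. l < k \<Longrightarrow>
      laurent_var l ^ b = (\<Sum>j<k. m l j * h_poly k (int b - int j))"
    by (rule laurent_var_power_as_h[of k]) (rule that)
  define N where "N = mat k k (\<lambda>(j, l). m l j)"
  define H where "H u = mat k k (\<lambda>(i, j). h_poly k (u i - int j))" for u :: "nat \<Rightarrow> int"
  define Y where "Y u = mat k k (\<lambda>(i, l). laurent_var l ^ nat (u i))" for u :: "nat \<Rightarrow> int"
  have HN: "H u * N = Y u" if "\<And>i. i < k \<Longrightarrow> 0 \<le> u i" for u
  proof (rule eq_matI)
    fix i l assume "i < dim_row (Y u)" "l < dim_col (Y u)"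
    then have il: "i < k" "l < k" by (auto simp: Y_def)
    have "(H u * N) $$ (i, l) = (\<Sum>j<k. m l j * h_poly k (int (nat (u i)) - int j))"
      using il that[OF il(1)] by (simp add: H_def N_def scalar_prod_def atLeast0LessThan mult.commute)
    then show "(H u * N) $$ (i, l) = Y u $$ (i, l)"
      using il m[OF il(2)] by (simp add: Y_def)
  qed (auto simp: H_def N_def Y_def)
  have detY: "det (Y u) = (\<Sum>w | w permutes {..<k}. of_int (sign w) * (\<Prod>i<k. laurent_var i ^ nat (u (w i))))" for u
  proof -
    have "det (Y u) = det (transpose_mat (Y u))" by (rule det_transpose[symmetric, of _ k]) (simp add: Y_def)
    also have "\<dots> = (\<Sum>w | w permutes {..<k}. of_int (sign w) * (\<Prod>i<k. transpose_mat (Y u) $$ (i, w i)))"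
      by (subst det_def'[of _ k]) (simp_all add: Y_def atLeast0LessThan)
    also have "\<dots> = (\<Sum>w | w permutes {..<k}. of_int (sign w) * (\<Prod>i<k. laurent_var i ^ nat (u (w i))))"
    proof (intro sum.cong refl arg_cong2[of _ _ _ _ "(*)"] prod.cong)
      fix w i assume "w \<in> {w. w permutes {..<k}}" "i \<in> {..<k}"
      then have "i < k" "w i < k" using permutes_in_image[of w "{..<k}" i] by auto
      then show "transpose_mat (Y u) $$ (i, w i) = laurent_var i ^ nat (u (w i))" by (simp add: Y_def)
    qed
    finally show ?thesis .
  qed
  have h0: "h_poly k 0 = 1" by (simp add: h_poly_def h_fps_def fps_nth_prod_geometric[of _ 0 0])
  have "det (H int) = 1"
  proof -
    have "det (H int) = prod_list (diag_mat (H int))"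
      by (rule det_lower_triangular[of k]) (auto simp: H_def h_poly_def)
    also have "diag_mat (H int) = map (\<lambda>_. 1) [0..<k]"
      by (auto simp: diag_mat_def H_def h0)
    finally show ?thesis by (simp add: map_replicate_const)
  qed
  moreover have "det (H int) * det N = vandermonde k"
    using det_mult[of "H int" k N] HN[of int] detY[of int]
    by (simp add: H_def N_def vandermonde_def)
  ultimately have "det N = vandermonde k" by simp
  then show ?thesis
    using det_mult[of "H u" k N] HN[of u, OF assms] detY[of u] by (simp add: H_def N_def)
qed

lemma prod_if_all:
  fixes f :: "'a \<Rightarrow> 'b :: comm_semiring_1"
  assumes "finite A"
  shows "(\<Prod>i\<in>A. if P i then f i else 0) = (if \<forall>i\<in>A. P i then \<Prod>i\<in>A. f i else 0)"
  using assms by induction auto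

lemma of_int_if_mult:
  "of_int s * (if b then X else 0) = of_int (if b then s else 0) * (X :: 'a :: comm_ring_1)"
  by simp

text \<open>Compares coefficients of \<open>x^v\<close> in \<open>jacobi_trudi\<close>. Each
  complete homogeneous polynomial is a sum of monomials, and row \<open>i\<close> of
  \<open>\<kappa>\<close> is the exponent vector picked from the factor in row \<open>i\<close> of
  the determinant. Row sums then give the indices and column sums the exponent of the product. The
  identity is later the orthonormality relation.\<close>

lemma sum_alternant_margins:
  fixes u v :: "nat \<Rightarrow> int"
  assumes u: "\<And>i. i < k \<Longrightarrow> 0 \<le> u i \<and> u i \<le> int M"
  shows "(\<Sum>\<kappa>\<in>{..<k} \<rightarrow>\<^sub>E ({..<k} \<rightarrow>\<^sub>E {..M}).
      alternant k (\<lambda>i. u i - int (\<Sum>j<k. \<kappa> i j)) * alternant k (\<lambda>j. v j - int (\<Sum>i<k. \<kappa> i j))) =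
    (\<Sum>w | w permutes {..<k}. if \<forall>i<k. v i = u (w i) then sign w else 0)"
proof -
  let ?K = "{..<k} \<rightarrow>\<^sub>E ({..<k} \<rightarrow>\<^sub>E {..M})"
  \<comment> \<open>Exponent vectors are functions on all naturals, so \<open>v\<close> has to be
    set to 0 outside the \<open>k\<close> variables before a coefficient is read off.\<close>
  define v' where "v' i = (if i < k then v i else 0)" for i
  define col where "col \<kappa> j = (if j < k then \<Sum>i<k. int (\<kappa> i j) else 0)" for \<kappa> :: "nat \<Rightarrow> nat \<Rightarrow> nat" and j
  have finE: "finite ({..<k} \<rightarrow>\<^sub>E {..M})" by (intro finite_PiE) auto
  have finP: "finite {w. w permutes {..<k}}" by (simp add: finite_permutations)
  have "det (mat k k (\<lambda>(i, j). h_poly k (u i - int j))) =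
      (\<Sum>w | w permutes {..<k}. of_int (sign w) * (\<Prod>i<k. h_poly k (u i - int (w i))))"
  proof (subst det_def'[of _ k])
    show "(\<Sum>p\<in>{p. p permutes {0..<k}}. signof p * (\<Prod>i=0..<k. mat k k (\<lambda>(i, j). h_poly k (u i - int j)) $$ (i, p i))) =
      (\<Sum>w | w permutes {..<k}. of_int (sign w) * (\<Prod>i<k. h_poly k (u i - int (w i))))"
      unfolding atLeast0LessThan
    proof (intro sum.cong refl arg_cong2[of _ _ _ _ "(*)"] prod.cong)
      fix w i assume "w \<in> {w. w permutes {..<k}}" "i \<in> {..<k}"
      then have "i < k" "w i < k" using permutes_in_image[of w "{..<k}" i] by auto
      then show "mat k k (\<lambda>(i, j). h_poly k (u i - int j)) $$ (i, w i) = h_poly k (u i - int (w i))" by simp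
    qed
  qed simp
  also have "\<dots> = (\<Sum>w | w permutes {..<k}. \<Sum>\<kappa>\<in>?K.
      of_int (if \<forall>i<k. u i - int (\<Sum>j<k. \<kappa> i j) = int (w i) then sign w else 0) * laurent_monom (col \<kappa>))"
  proof (intro sum.cong refl)
    fix w assume "w \<in> {w. w permutes {..<k}}"
    have "(\<Prod>i<k. h_poly k (u i - int (w i))) =
        (\<Prod>i<k. \<Sum>\<epsilon>\<in>{..<k} \<rightarrow>\<^sub>E {..M}.
          if int (sum \<epsilon> {..<k}) = u i - int (w i) then \<Prod>j<k. laurent_var j ^ \<epsilon> j else 0)"
      by (intro prod.cong refl h_poly_expand) (use u in force)
    also have "\<dots> = (\<Sum>\<kappa>\<in>?K. \<Prod>i<k.
        if int (sum (\<kappa> i) {..<k}) = u i - int (w i) then \<Prod>j<k. laurent_var j ^ \<kappa> i j else 0)"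
      using finE by (intro prod_sum_PiE) auto
    also have "\<dots> = (\<Sum>\<kappa>\<in>?K. if \<forall>i<k. u i - int (\<Sum>j<k. \<kappa> i j) = int (w i) then laurent_monom (col \<kappa>) else 0)"
    proof (intro sum.cong refl)
      fix \<kappa> assume "\<kappa> \<in> ?K"
      have "(\<Prod>i<k. \<Prod>j<k. laurent_var j ^ \<kappa> i j) = laurent_monom (col \<kappa>)"
        unfolding prod_laurent_var prod_laurent_monom
        by (intro arg_cong[of _ _ laurent_monom]) (auto simp: col_def)
      moreover have "(\<forall>i<k. u i - int (\<Sum>j<k. \<kappa> i j) = int (w i)) \<longleftrightarrow>
          (\<forall>i\<in>{..<k}. int (sum (\<kappa> i) {..<k}) = u i - int (w i))"
        by (metis diff_eq_eq add.commute lessThan_iff)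
      ultimately show "(\<Prod>i<k. if int (sum (\<kappa> i) {..<k}) = u i - int (w i) then \<Prod>j<k. laurent_var j ^ \<kappa> i j else 0) =
          (if \<forall>i<k. u i - int (\<Sum>j<k. \<kappa> i j) = int (w i) then laurent_monom (col \<kappa>) else 0)"
        by (simp only: prod_if_all[OF finite_lessThan])
    qed
    finally show "of_int (sign w) * (\<Prod>i<k. h_poly k (u i - int (w i))) = (\<Sum>\<kappa>\<in>?K.
      of_int (if \<forall>i<k. u i - int (\<Sum>j<k. \<kappa> i j) = int (w i) then sign w else 0) * laurent_monom (col \<kappa>))"
      by (simp only: sum_distrib_left of_int_if_mult)
  qed
  also have "\<dots> = (\<Sum>\<kappa>\<in>?K. of_int (alternant k (\<lambda>i. u i - int (\<Sum>j<k. \<kappa> i j))) * laurent_monom (col \<kappa>))"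
    unfolding alternant_def of_int_sum sum_distrib_right by (rule sum.swap)
  finally have det: "det (mat k k (\<lambda>(i, j). h_poly k (u i - int j))) = \<dots>" .
  have "Poly_Mapping.lookup (det (mat k k (\<lambda>(i, j). h_poly k (u i - int j))) * vandermonde k) v' =
      (\<Sum>\<kappa>\<in>?K. alternant k (\<lambda>i. u i - int (\<Sum>j<k. \<kappa> i j)) * alternant k (\<lambda>j. v' j - col \<kappa> j))"
    unfolding det sum_distrib_right Poly_Mapping.lookup_sum mult.assoc lookup_of_int_mult
    by (intro sum.cong refl arg_cong2[of _ _ _ _ "(*)"] lookup_monom_mult_vandermonde)
      (auto simp: col_def v'_def)
  also have "\<dots> = (\<Sum>\<kappa>\<in>?K. alternant k (\<lambda>i. u i - int (\<Sum>j<k. \<kappa> i j)) *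
      alternant k (\<lambda>j. v j - int (\<Sum>i<k. \<kappa> i j)))"
    by (intro sum.cong refl arg_cong2[of _ _ _ _ "(*)"]) (auto simp: alternant_def v'_def col_def intro!: sum.cong)
  finally have lhs: "Poly_Mapping.lookup (det (mat k k (\<lambda>(i, j). h_poly k (u i - int j))) * vandermonde k) v' = \<dots>" .
  have "Poly_Mapping.lookup (\<Sum>w | w permutes {..<k}. of_int (sign w) * (\<Prod>i<k. laurent_var i ^ nat (u (w i)))) v' =
      (\<Sum>w | w permutes {..<k}. if \<forall>i<k. v i = u (w i) then sign w else 0)"
    unfolding Poly_Mapping.lookup_sum lookup_of_int_mult prod_laurent_var lookup_laurent_monom
  proof (intro sum.cong refl)
    fix w assume "w \<in> {w. w permutes {..<k}}"
    then have "w i < k" if "i < k" for i using that permutes_in_image[of w "{..<k}" i] by auto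
    then have "(\<lambda>i. if i < k then int (nat (u (w i))) else 0) = v' \<longleftrightarrow> (\<forall>i<k. v i = u (w i))"
      using u by (auto simp: fun_eq_iff v'_def)
    then show "sign w * (if (\<lambda>i. if i < k then int (nat (u (w i))) else 0) = v' then 1 else 0) =
        (if \<forall>i<k. v i = u (w i) then sign w else 0)" by simp
  qed
  then show ?thesis using jacobi_trudi[of k u] u lhs by simp
qed

section \<open>Power sums acting on alternating functions\<close>

text \<open>The coefficient of \<open>x^v\<close> in the alternating polynomial with exponents
  \<open>u\<close>. For injective \<open>u\<close> at most one \<open>w\<close> contributes, so the
  values are 0, 1 and -1.\<close>

definition perm_sign :: "nat \<Rightarrow> (nat \<Rightarrow> int) \<Rightarrow> (nat \<Rightarrow> int) \<Rightarrow> int" where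
  "perm_sign k u v = (\<Sum>w | w permutes {..<k}. if \<forall>i<k. v i = u (w i) then sign w else 0)"

lemma alternant_perm_sign: "alternant k \<alpha> = perm_sign k int \<alpha>"
  by (simp add: alternant_def perm_sign_def)

lemma permutes_lessThan_eqI:
  assumes "w permutes {..<k}" "w' permutes {..<k}" "\<And>i. i < k \<Longrightarrow> w i = w' i"
  shows "w = w'"
  using assms by (metis lessThan_iff permutes_not_in ext)

lemma perm_sign_eq:
  assumes u: "inj_on u {..<k}" and w: "w permutes {..<k}" and v: "\<And>i. i < k \<Longrightarrow> v i = u (w i)"
  shows "perm_sign k u v = sign w"
proof -
  have "(\<forall>i<k. v i = u (w' i)) \<longleftrightarrow> w' = w" if w': "w' permutes {..<k}" for w'
  proof
    assume *: "\<forall>i<k. v i = u (w' i)"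
    show "w' = w"
    proof (rule permutes_lessThan_eqI[OF w' w])
      fix i assume i: "i < k"
      then have "u (w' i) = u (w i)" using * v by simp
      then show "w' i = w i"
        using u i permutes_in_image[OF w, of i] permutes_in_image[OF w', of i] by (auto dest: inj_onD)
    qed
  qed (use v in simp)
  then have "perm_sign k u v = (\<Sum>w' | w' permutes {..<k}. if w' = w then sign w' else 0)"
    unfolding perm_sign_def by (intro sum.cong) auto
  also have "\<dots> = sign w" using w by (simp add: finite_permutations)
  finally show ?thesis .
qed

lemma perm_sign_nonzeroD:
  assumes "perm_sign k u v \<noteq> 0"
  shows "\<exists>w. w permutes {..<k} \<and> (\<forall>i<k. v i = u (w i))"
proof (rule ccontr)
  assume "\<not> ?thesis"
  then have "perm_sign k u v = 0" unfolding perm_sign_def by (intro sum.neutral) auto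
  with assms show False by simp
qed

lemma perm_sign_self: "inj_on u {..<k} \<Longrightarrow> perm_sign k u u = 1"
  using perm_sign_eq[of u k id u] by simp

lemma abs_perm_sign_le:
  assumes "inj_on u {..<k}" shows "\<bar>perm_sign k u v\<bar> \<le> 1"
  using perm_sign_nonzeroD[of k u v] perm_sign_eq[OF assms] by (cases "perm_sign k u v = 0") (auto simp: sign_def)

lemma perm_sign_nonzero_iff:
  assumes "inj_on u {..<k}"
  shows "perm_sign k u v \<noteq> 0 \<longleftrightarrow> (\<exists>w. w permutes {..<k} \<and> (\<forall>i<k. v i = u (w i)))"
  using perm_sign_nonzeroD[of k u v] perm_sign_eq[OF assms] by (auto simp: sign_def split: if_splits)

lemma perm_sign_transpose:
  assumes ij: "i < k" "j < k" "i \<noteq> j"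
  shows "perm_sign k u (v \<circ> Transposition.transpose i j) = - perm_sign k u v"
proof -
  let ?t = "Transposition.transpose i j"
  have t: "?t permutes {..<k}" using ij by (intro permutes_swap_id) auto
  have tk: "?t x < k \<longleftrightarrow> x < k" for x using permutes_in_image[OF t, of x] by simp
  have "perm_sign k u (v \<circ> ?t) = (\<Sum>w | w permutes {..<k}. if \<forall>i<k. (v \<circ> ?t) i = u ((w \<circ> ?t) i) then sign (w \<circ> ?t) else 0)"
    unfolding perm_sign_def
    by (rule sum.reindex_bij_witness[where i = "\<lambda>w. w \<circ> ?t" and j = "\<lambda>w. w \<circ> ?t"])
      (auto simp: comp_assoc intro: permutes_compose t)
  also have "\<dots> = (\<Sum>w | w permutes {..<k}. if \<forall>i<k. v i = u (w i) then - sign w else 0)"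
  proof (intro sum.cong refl)
    fix w assume "w \<in> {w. w permutes {..<k}}"
    then have "permutation w" using permutation_permutes by blast
    then have "sign (w \<circ> ?t) = - sign w"
      using ij by (simp add: sign_compose permutation_swap_id sign_swap_id)
    moreover have "(\<forall>i<k. (v \<circ> ?t) i = u ((w \<circ> ?t) i)) \<longleftrightarrow> (\<forall>i<k. v i = u (w i))"
      using tk by (metis comp_apply transpose_involutory)
    ultimately show "(if \<forall>i<k. (v \<circ> ?t) i = u ((w \<circ> ?t) i) then sign (w \<circ> ?t) else 0) =
        (if \<forall>i<k. v i = u (w i) then - sign w else 0)" by simp
  qed
  also have "\<dots> = - perm_sign k u v"
    unfolding perm_sign_def sum_negf[symmetric] by (intro sum.cong) auto
  finally show ?thesis .
qed

lemma sum_lessThan_card_le: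
  fixes S :: "nat set" assumes "finite S" shows "\<Sum>{..<card S} \<le> \<Sum>S"
  using assms
proof (induction "card S" arbitrary: S)
  case (Suc k)
  define M where "M = Max S"
  have M: "M \<in> S" unfolding M_def using Suc by (intro Max_in) auto
  have card: "card (S - {M}) = k" using Suc M by simp
  have "S \<subseteq> {..M}" using Suc.prems by (auto simp: M_def)
  then have "card S \<le> card {..M}" by (intro card_mono) auto
  then have "k \<le> M" using Suc by simp
  moreover have "\<Sum>{..<k} \<le> \<Sum>(S - {M})" using Suc.hyps(1)[of "S - {M}"] card Suc.prems by simp
  moreover have "\<Sum>S = M + \<Sum>(S - {M})" using Suc.prems M by (intro sum.remove)
  ultimately show ?case by (simp flip: Suc.hyps(2))
qed auto

text \<open>Adding the missing \<open>v\<close> to \<open>S\<close> gives one more distinct natural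
  number. For beads this says that an empty low position forces a large total.\<close>

lemma sum_missing_ge:
  fixes S :: "nat set" assumes "finite S" "v \<notin> S"
  shows "\<Sum>{..<card S} + card S \<le> \<Sum>S + v"
  using sum_lessThan_card_le[of "insert v S"] assms by simp

section \<open>Shift operators on coloured exponent vectors\<close>

definition shift :: "('p \<Rightarrow> int) \<Rightarrow> 'p \<Rightarrow> int \<Rightarrow> 'p \<Rightarrow> int" where
  "shift \<beta> p z = \<beta>(p := \<beta> p + z)"

lemma shift_apply: "shift \<beta> p z q = (if q = p then \<beta> p + z else \<beta> q)"
  by (simp add: shift_def)

lemma shift_commute: "shift (shift \<beta> p a) q b = shift (shift \<beta> q b) p a"
  by (auto simp: shift_def fun_eq_iff)

lemma shift_shift_same: "shift (shift \<beta> p a) p b = shift \<beta> p (a + b)"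
  by (auto simp: shift_def fun_eq_iff)

lemma shift_zero [simp]: "shift \<beta> p 0 = \<beta>" by (simp add: shift_def)

lemma sum_shift: "finite I \<Longrightarrow> p \<in> I \<Longrightarrow> sum (shift \<beta> p z) I = sum \<beta> I + z"
  by (simp add: shift_def sum.remove[of I p])

text \<open>There are \<open>r\<close> colours with \<open>k\<close> labelled beads each, and
  \<open>\<beta> (c, i)\<close> is the place of bead \<open>i\<close> of colour \<open>c\<close>.
  For distinct places, each colour is the beta-set of a partition, and removing a hook of length
  \<open>l\<close> means moving a bead down by \<open>l\<close>.\<close>

locale coloured_beads =
  fixes r k :: nat
begin

abbreviation positions :: "(nat \<times> nat) set" where
  "positions \<equiv> {..<r} \<times> {..<k}"

text \<open>The total of the empty multipartition, whose beads fill the places below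
  \<open>k\<close> in every colour.\<close>

definition base_total :: int where
  "base_total = int r * int (\<Sum>{..<k})"

definition coloured_alternant :: "(nat \<times> nat \<Rightarrow> int) \<Rightarrow> int" where
  "coloured_alternant \<beta> = (\<Prod>c<r. alternant k (\<lambda>i. \<beta> (c, i)))"

text \<open>A function on exponents is regarded as a family of coefficients. Under this reading
  \<open>shift_sum (- l)\<close> is multiplication by the power sum \<open>p\<^sub>l\<close>, and \<open>shift_sum l\<close> is its adjoint.\<close>

definition shift_sum :: "int \<Rightarrow> ((nat \<times> nat \<Rightarrow> int) \<Rightarrow> int) \<Rightarrow> (nat \<times> nat \<Rightarrow> int) \<Rightarrow> int" where
  "shift_sum z F \<beta> = (\<Sum>p\<in>positions. F (shift \<beta> p z))"

definition nonneg :: "(nat \<times> nat \<Rightarrow> int) \<Rightarrow> bool" where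
  "nonneg \<beta> \<longleftrightarrow> (\<forall>p\<in>positions. 0 \<le> \<beta> p)"

lemma nonnegD: "nonneg \<beta> \<Longrightarrow> p \<in> positions \<Longrightarrow> 0 \<le> \<beta> p"
  unfolding nonneg_def by (rule bspec)

lemma nonneg_shift: "nonneg \<beta> \<Longrightarrow> p \<in> positions \<Longrightarrow> nonneg (shift \<beta> p z) \<longleftrightarrow> 0 \<le> \<beta> p + z"
  unfolding nonneg_def by (metis shift_apply)

text \<open>Coefficient families of homogeneous polynomials that alternate in the variables of each
  colour; \<open>m\<close> is the degree beyond that of \<open>a\<close>.\<close>

definition skew :: "nat \<Rightarrow> ((nat \<times> nat \<Rightarrow> int) \<Rightarrow> int) \<Rightarrow> bool" where
  "skew m F \<longleftrightarrow>
     (\<forall>\<beta>. F \<beta> \<noteq> 0 \<longrightarrow> nonneg \<beta> \<and> sum \<beta> positions = base_total + int m) \<and>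
     (\<forall>\<beta> c i j. c < r \<longrightarrow> i < k \<longrightarrow> j < k \<longrightarrow> i \<noteq> j \<longrightarrow>
       F (\<beta> \<circ> Transposition.transpose (c, i) (c, j)) = - F \<beta>)"

lemma skew_supp: "skew m F \<Longrightarrow> F \<beta> \<noteq> 0 \<Longrightarrow> nonneg \<beta> \<and> sum \<beta> positions = base_total + int m"
  by (simp add: skew_def)

lemma skew_swap:
  "skew m F \<Longrightarrow> c < r \<Longrightarrow> i < k \<Longrightarrow> j < k \<Longrightarrow> i \<noteq> j \<Longrightarrow>
    F (\<beta> \<circ> Transposition.transpose (c, i) (c, j)) = - F \<beta>"
  by (simp add: skew_def)

lemma comp_transpose_eq: "\<beta> p = \<beta> q \<Longrightarrow> \<beta> \<circ> Transposition.transpose p q = \<beta>"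
  by (auto simp: fun_eq_iff Transposition.transpose_def)

lemma skew_inj:
  assumes "skew m F" "F \<beta> \<noteq> 0" "c < r" "i < k" "j < k" "\<beta> (c, i) = \<beta> (c, j)"
  shows "i = j"
proof (rule ccontr)
  assume "i \<noteq> j"
  then have "F \<beta> = - F \<beta>" using skew_swap[OF assms(1,3,4,5), of \<beta>] comp_transpose_eq[of \<beta>, OF assms(6)] by simp
  with assms show False by simp
qed

lemma shift_sum_swap:
  assumes F: "skew m F" and c: "c < r" "i < k" "j < k" "i \<noteq> j"
  shows "shift_sum z F (\<beta> \<circ> Transposition.transpose (c, i) (c, j)) = - shift_sum z F \<beta>"
proof -
  let ?t = "Transposition.transpose (c, i) (c, j)"
  have t: "bij_betw ?t positions positions"
    using permutes_imp_bij[OF permutes_swap_id[of "(c, i)" positions "(c, j)"]] c by auto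
  have "shift_sum z F (\<beta> \<circ> ?t) = (\<Sum>p\<in>positions. F (shift \<beta> (?t p) z \<circ> ?t))"
    unfolding shift_sum_def
  proof (intro sum.cong refl arg_cong[of _ _ F] ext)
    fix p q show "shift (\<beta> \<circ> ?t) p z q = (shift \<beta> (?t p) z \<circ> ?t) q"
      using transpose_eq_imp_eq[of "(c, i)" "(c, j)" p q] by (auto simp: shift_apply)
  qed
  also have "\<dots> = - (\<Sum>p\<in>positions. F (shift \<beta> (?t p) z))"
    by (simp add: skew_swap[OF F c] sum_negf)
  also have "(\<Sum>p\<in>positions. F (shift \<beta> (?t p) z)) = shift_sum z F \<beta>"
    unfolding shift_sum_def by (rule sum.reindex_bij_betw[OF t])
  finally show ?thesis .
qed

text \<open>There is no counterpart for the adjoint: \<open>shift_sum (int l) F\<close> can be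
  nonzero at a vector with a negative entry, because adding \<open>l\<close> may lift that entry to
  0 or more. Hence statements about the adjoint below assume \<open>nonneg\<close>.\<close>

lemma skew_shift_sum:
  assumes F: "skew m F" shows "skew (m + l) (shift_sum (- int l) F)"
  unfolding skew_def
proof (intro conjI allI impI)
  fix \<beta> assume "shift_sum (- int l) F \<beta> \<noteq> 0"
  then obtain p where p: "p \<in> positions" "F (shift \<beta> p (- int l)) \<noteq> 0"
    unfolding shift_sum_def by (meson sum.not_neutral_contains_not_neutral)
  note supp = skew_supp[OF F p(2)]
  then show "sum \<beta> positions = base_total + int (m + l)" using p(1) by (simp add: sum_shift)
  show "nonneg \<beta>"
    unfolding nonneg_def
  proof
    fix q assume "q \<in> positions"
    from nonnegD[OF conjunct1[OF supp] this] show "0 \<le> \<beta> q" by (auto simp: shift_apply split: if_splits)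
  qed
qed (rule shift_sum_swap[OF F])

lemma nat_beads:
  assumes "nonneg \<beta>" "c < r" "inj_on (\<lambda>i. \<beta> (c, i)) {..<k}"
  defines "S \<equiv> (\<lambda>i. nat (\<beta> (c, i))) ` {..<k}"
  shows "finite S" "card S = k" "int (\<Sum>S) = (\<Sum>i<k. \<beta> (c, i))"
proof -
  have nn: "0 \<le> \<beta> (c, i)" if "i < k" for i using assms that by (auto simp: nonneg_def)
  have inj: "inj_on (\<lambda>i. nat (\<beta> (c, i))) {..<k}"
    using assms(3) nn by (auto simp: inj_on_def eq_nat_nat_iff)
  show "finite S" by (simp add: S_def)
  show "card S = k" using inj by (simp add: S_def card_image)
  have "int (\<Sum>S) = (\<Sum>i<k. int (nat (\<beta> (c, i))))"
    using inj by (simp add: S_def sum.reindex)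
  also have "\<dots> = (\<Sum>i<k. \<beta> (c, i))" using nn by (intro sum.cong) auto
  finally show "int (\<Sum>S) = (\<Sum>i<k. \<beta> (c, i))" .
qed

lemma colour_total_ge:
  assumes "nonneg \<beta>" "c < r" "inj_on (\<lambda>i. \<beta> (c, i)) {..<k}"
  shows "int (\<Sum>{..<k}) \<le> (\<Sum>i<k. \<beta> (c, i))"
  using sum_lessThan_card_le[OF nat_beads(1)[OF assms]]
  unfolding nat_beads(2)[OF assms] nat_beads(3)[OF assms, symmetric] by (simp only: of_nat_le_iff)

lemma sum_positions: "sum \<beta> positions = (\<Sum>c<r. \<Sum>i<k. \<beta> (c, i))"
  by (simp add: sum.cartesian_product)

lemma low_total_collision:
  assumes nn: "nonneg \<beta>" and low: "sum \<beta> positions < base_total"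
  shows "\<exists>c i j. c < r \<and> i < k \<and> j < k \<and> i \<noteq> j \<and> \<beta> (c, i) = \<beta> (c, j)"
proof (rule ccontr)
  assume "\<not> ?thesis"
  then have inj: "inj_on (\<lambda>i. \<beta> (c, i)) {..<k}" if "c < r" for c
    using that by (auto simp: inj_on_def)
  have "base_total = (\<Sum>c<r. int (\<Sum>{..<k}))" by (simp add: base_total_def)
  also have "\<dots> \<le> sum \<beta> positions"
    unfolding sum_positions using colour_total_ge[OF nn _ inj] by (intro sum_mono) auto
  finally show False using low by simp
qed

lemma shift_sum_collision:
  assumes F: "skew m F" and "c < r" "i < k" "j < k" "i \<noteq> j" "\<beta> (c, i) = \<beta> (c, j)"
  shows "shift_sum z F \<beta> = 0"
proof -
  have "shift_sum z F \<beta> = - shift_sum z F \<beta>"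
    using shift_sum_swap[OF assms(1-5), of z \<beta>] comp_transpose_eq[of \<beta>, OF assms(6)] by simp
  then show ?thesis by simp
qed

text \<open>\<open>shift_sum z F\<close> alternates for every \<open>z\<close>, so it vanishes
  wherever two beads of one colour coincide. Nonnegative beads with a total below
  \<open>base_total\<close> always contain such a pair.\<close>

lemma shift_sum_low:
  assumes "skew m F" "nonneg \<beta>" "sum \<beta> positions < base_total"
  shows "shift_sum z F \<beta> = 0"
  using low_total_collision[OF assms(2,3)] shift_sum_collision[OF assms(1)] by blast

text \<open>Every colour has at least its minimal total, so no colour exceeds its minimum by more
  than \<open>m\<close>. An empty place below \<open>l\<close> would cost a colour more than
  \<open>k - l\<close>, which is at least \<open>m\<close>. Hence all places below \<open>l\<close>
  are taken, once in each colour.\<close>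

lemma card_low_beads:
  assumes F: "skew m F" and nz: "F \<beta> \<noteq> 0" and k: "m + l \<le> k"
  shows "card {q \<in> positions. \<beta> q < int l} = l * r"
proof -
  note supp = skew_supp[OF F nz]
  have inj: "inj_on (\<lambda>i. \<beta> (c, i)) {..<k}" if "c < r" for c
    using skew_inj[OF F nz that] by (auto simp: inj_on_def)
  have card: "card {i \<in> {..<k}. \<beta> (c, i) < int l} = l" if c: "c < r" for c
  proof -
    define S where "S = (\<lambda>i. nat (\<beta> (c, i))) ` {..<k}"
    note S = nat_beads[OF conjunct1[OF supp] c inj[OF c], folded S_def]
    have "base_total + int m = (\<Sum>i<k. \<beta> (c, i)) + (\<Sum>c'\<in>{..<r} - {c}. \<Sum>i<k. \<beta> (c', i))"
      using supp c unfolding sum_positions by (simp add: sum.remove[of "{..<r}" c])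
    moreover have "(\<Sum>c'\<in>{..<r} - {c}. int (\<Sum>{..<k})) \<le> (\<Sum>c'\<in>{..<r} - {c}. \<Sum>i<k. \<beta> (c', i))"
      using colour_total_ge[OF conjunct1[OF supp] _ inj] by (intro sum_mono) auto
    moreover have "base_total = int (\<Sum>{..<k}) + (\<Sum>c'\<in>{..<r} - {c}. int (\<Sum>{..<k}))"
      using c by (simp add: base_total_def sum.remove[of "{..<r}" c, symmetric] flip: distrib_right)
        (simp add: of_nat_diff left_diff_distrib)
    ultimately have "int (\<Sum>S) \<le> int (\<Sum>{..<k}) + int m" using S(3) by linarith
    then have "\<Sum>S \<le> \<Sum>{..<k} + m" by linarith
    then have sub: "{..<l} \<subseteq> S"
      using sum_missing_ge[OF S(1)] S(2) k by (force simp: not_less[symmetric])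
    have "bij_betw (\<lambda>i. nat (\<beta> (c, i))) {i \<in> {..<k}. \<beta> (c, i) < int l} {..<l}"
      unfolding bij_betw_def
    proof
      have nn: "0 \<le> \<beta> (c, i)" if "i < k" for i using supp c that by (auto simp: nonneg_def)
      show "inj_on (\<lambda>i. nat (\<beta> (c, i))) {i \<in> {..<k}. \<beta> (c, i) < int l}"
        using inj[OF c] nn by (auto simp: inj_on_def eq_nat_nat_iff)
      show "(\<lambda>i. nat (\<beta> (c, i))) ` {i \<in> {..<k}. \<beta> (c, i) < int l} = {..<l}"
        using sub nn by (fastforce simp: S_def image_iff subset_iff)
    qed
    then show ?thesis by (simp add: bij_betw_same_card)
  qed
  have eq: "{q \<in> positions. \<beta> q < int l} = (SIGMA c:{..<r}. {i \<in> {..<k}. \<beta> (c, i) < int l})"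
    by auto
  have "card {q \<in> positions. \<beta> q < int l} = (\<Sum>c<r. card {i \<in> {..<k}. \<beta> (c, i) < int l})"
    unfolding eq by (rule card_SigmaI) auto
  also have "\<dots> = (\<Sum>c<r. l)" using card by (intro sum.cong) auto
  finally show ?thesis by (simp add: mult.commute)
qed

text \<open>The commutation rule for a power sum and its adjoint. Sort the double sum by the bead
  \<open>q\<close> that moves down. A bead at or above \<open>l\<close> yields a term of the
  opposite order of the operators. A bead below \<open>l\<close> would become negative unless the
  same bead moves back up, so it yields one copy of \<open>F \<alpha>\<close>, and there are
  \<open>l * r\<close> such beads.\<close>

lemma shift_sum_up_down:
  assumes F: "skew m F" and nn: "nonneg \<alpha>" and k: "m + l \<le> k"
  shows "shift_sum (int l) (shift_sum (- int l) F) \<alpha> =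
    int (l * r) * F \<alpha> + (\<Sum>q | q \<in> positions \<and> int l \<le> \<alpha> q. shift_sum (int l) F (shift \<alpha> q (- int l)))"
proof -
  have "shift_sum (int l) (shift_sum (- int l) F) \<alpha> =
      (\<Sum>q\<in>positions. \<Sum>p\<in>positions. F (shift (shift \<alpha> q (- int l)) p (int l)))"
    unfolding shift_sum_def by (subst sum.swap) (simp only: shift_commute)
  also have "\<dots> = (\<Sum>q\<in>positions. if int l \<le> \<alpha> q then shift_sum (int l) F (shift \<alpha> q (- int l)) else F \<alpha>)"
  proof (intro sum.cong refl)
    fix q assume q: "q \<in> positions"
    show "(\<Sum>p\<in>positions. F (shift (shift \<alpha> q (- int l)) p (int l))) =
        (if int l \<le> \<alpha> q then shift_sum (int l) F (shift \<alpha> q (- int l)) else F \<alpha>)"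
    proof (cases "int l \<le> \<alpha> q")
      case False
      have "F (shift (shift \<alpha> q (- int l)) p (int l)) = 0" if "p \<noteq> q" for p
      proof (rule ccontr)
        assume "F (shift (shift \<alpha> q (- int l)) p (int l)) \<noteq> 0"
        from nonnegD[OF conjunct1[OF skew_supp[OF F this]] q] that False show False
          by (simp add: shift_apply)
      qed
      then have "(\<Sum>p\<in>positions. F (shift (shift \<alpha> q (- int l)) p (int l))) =
          (\<Sum>p\<in>positions. if p = q then F \<alpha> else 0)"
        by (intro sum.cong) (auto simp: shift_shift_same)
      then show ?thesis using False q by simp
    qed (simp add: shift_sum_def)
  qed
  also have "\<dots> = (\<Sum>q | q \<in> positions \<and> int l \<le> \<alpha> q. shift_sum (int l) F (shift \<alpha> q (- int l))) +
      int (card {q \<in> positions. \<alpha> q < int l}) * F \<alpha>"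
    by (subst sum.If_cases) (auto simp: Int_def not_le)
  also have "int (card {q \<in> positions. \<alpha> q < int l}) * F \<alpha> = int (l * r) * F \<alpha>"
    using card_low_beads[OF F _ k, of \<alpha>] by (cases "F \<alpha> = 0") auto
  finally show ?thesis by simp
qed

text \<open>Fixing the value 0 off \<open>positions\<close> gives each placement of beads one
  representative and makes the set finite.\<close>

definition configs :: "nat \<Rightarrow> (nat \<times> nat \<Rightarrow> int) set" where
  "configs m = {\<beta>. (\<forall>p. p \<notin> positions \<longrightarrow> \<beta> p = 0) \<and> nonneg \<beta> \<and> sum \<beta> positions = base_total + int m}"

lemma finite_configs: "finite (configs m)"
proof -
  define X where "X = {0..base_total + int m}"
  have "configs m \<subseteq> {\<beta>. (\<forall>p. (p \<in> positions \<longrightarrow> \<beta> p \<in> X) \<and> (p \<notin> positions \<longrightarrow> \<beta> p = 0))}"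
  proof clarsimp
    fix \<beta> c i assume b: "\<beta> \<in> configs m"
    show "(c < r \<and> i < k \<longrightarrow> \<beta> (c, i) \<in> X) \<and> ((c < r \<longrightarrow> \<not> i < k) \<longrightarrow> \<beta> (c, i) = 0)"
      using b member_le_sum[of "(c, i)" positions \<beta>] by (auto simp: configs_def nonneg_def X_def)
  qed
  moreover have "finite \<dots>" by (rule finite_set_of_finite_funs) (auto simp: X_def)
  ultimately show ?thesis by (rule finite_subset)
qed

lemma configs_nonneg: "\<beta> \<in> configs m \<Longrightarrow> nonneg \<beta>"
  by (simp add: configs_def)

lemma configs_shift_up:
  assumes "p \<in> positions" "\<alpha> \<in> configs m" shows "shift \<alpha> p (int l) \<in> configs (m + l)"
proof -
  have "nonneg (shift \<alpha> p (int l))"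
    using assms nonneg_shift[of \<alpha> p] nonnegD[of \<alpha> p] by (simp add: configs_def)
  then show ?thesis using assms by (auto simp: configs_def sum_shift) (auto simp: shift_apply)
qed

lemma configs_shift_down:
  assumes "p \<in> positions" "\<beta> \<in> configs (m + l)" "nonneg (shift \<beta> p (- int l))"
  shows "shift \<beta> p (- int l) \<in> configs m"
  using assms by (auto simp: configs_def sum_shift) (auto simp: shift_apply)

definition norm_sq :: "nat \<Rightarrow> ((nat \<times> nat \<Rightarrow> int) \<Rightarrow> int) \<Rightarrow> int" where
  "norm_sq m F = (\<Sum>\<beta>\<in>configs m. (F \<beta>)\<^sup>2)"

text \<open>Moving a fixed bead is a reindexing; the vectors it would take out of
  \<open>configs\<close> have a negative entry after the move, where \<open>F\<close>
  vanishes.\<close>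

lemma shift_sum_adjoint:
  assumes F: "skew m F"
  shows "(\<Sum>\<beta>\<in>configs (m + l). shift_sum (- int l) F \<beta> * G \<beta>) =
    (\<Sum>\<alpha>\<in>configs m. F \<alpha> * shift_sum (int l) G \<alpha>)"
proof -
  have "(\<Sum>\<beta>\<in>configs (m + l). shift_sum (- int l) F \<beta> * G \<beta>) =
      (\<Sum>p\<in>positions. \<Sum>\<beta>\<in>configs (m + l). F (shift \<beta> p (- int l)) * G \<beta>)"
    unfolding shift_sum_def sum_distrib_right by (rule sum.swap)
  also have "\<dots> = (\<Sum>p\<in>positions. \<Sum>\<alpha>\<in>configs m. F \<alpha> * G (shift \<alpha> p (int l)))"
  proof (rule sum.cong[OF refl])
    fix p assume p: "p \<in> positions"
    show "(\<Sum>\<beta>\<in>configs (m + l). F (shift \<beta> p (- int l)) * G \<beta>) =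
        (\<Sum>\<alpha>\<in>configs m. F \<alpha> * G (shift \<alpha> p (int l)))"
    proof (rule sum.reindex_bij_witness_not_neutral[where
          j = "\<lambda>\<beta>. shift \<beta> p (- int l)" and i = "\<lambda>\<alpha>. shift \<alpha> p (int l)" and T' = "{}" and
          S' = "{\<beta> \<in> configs (m + l). \<not> nonneg (shift \<beta> p (- int l))}"])
      show "F (shift \<beta> p (- int l)) * G \<beta> = 0"
        if "\<beta> \<in> {\<beta> \<in> configs (m + l). \<not> nonneg (shift \<beta> p (- int l))}" for \<beta>
        using that skew_supp[OF F] by force
      show "finite {\<beta> \<in> configs (m + l). \<not> nonneg (shift \<beta> p (- int l))}"
        using finite_configs by simp
    qed (use p in \<open>auto simp: shift_shift_same configs_shift_up configs_shift_down configs_nonneg\<close>)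
  qed
  also have "\<dots> = (\<Sum>\<alpha>\<in>configs m. F \<alpha> * shift_sum (int l) G \<alpha>)"
    unfolding shift_sum_def sum_distrib_left by (rule sum.swap)
  finally show ?thesis .
qed

text \<open>The norm is the pairing of \<open>F\<close> with the adjoint applied to the product. In
  the commutation rule the leftover terms are evaluated at total \<open>base_total + m - l\<close>,
  below the minimum since \<open>m < l\<close>, so only the factor \<open>l * r\<close>
  remains.\<close>

lemma norm_sq_shift_sum:
  assumes F: "skew m F" and "m < l" "m + l \<le> k"
  shows "norm_sq (m + l) (shift_sum (- int l) F) = int (l * r) * norm_sq m F"
proof -
  have "norm_sq (m + l) (shift_sum (- int l) F) =
      (\<Sum>\<alpha>\<in>configs m. F \<alpha> * shift_sum (int l) (shift_sum (- int l) F) \<alpha>)"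
    unfolding norm_sq_def power2_eq_square by (rule shift_sum_adjoint[OF F])
  also have "\<dots> = (\<Sum>\<alpha>\<in>configs m. int (l * r) * (F \<alpha>)\<^sup>2)"
  proof (intro sum.cong refl)
    fix \<alpha> assume "\<alpha> \<in> configs m"
    then have nn: "nonneg \<alpha>" and tot: "sum \<alpha> positions = base_total + int m"
      by (auto simp: configs_def)
    have "shift_sum (int l) F (shift \<alpha> q (- int l)) = 0" if "q \<in> positions" "int l \<le> \<alpha> q" for q
    proof (rule shift_sum_low[OF F])
      show "nonneg (shift \<alpha> q (- int l))" using nn that by (auto simp: nonneg_def shift_apply)
      show "sum (shift \<alpha> q (- int l)) positions < base_total"
        using that tot assms(2) by (simp add: sum_shift)
    qed
    then have "shift_sum (int l) (shift_sum (- int l) F) \<alpha> = int (l * r) * F \<alpha>"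
      using shift_sum_up_down[OF F nn assms(3)] by simp
    then show "F \<alpha> * shift_sum (int l) (shift_sum (- int l) F) \<alpha> = int (l * r) * (F \<alpha>)\<^sup>2"
      by (simp add: power2_eq_square)
  qed
  finally show ?thesis by (simp add: norm_sq_def sum_distrib_left)
qed

lemma skew_coloured_alternant: "skew 0 coloured_alternant"
  unfolding skew_def
proof (intro conjI allI impI)
  fix \<beta> assume "coloured_alternant \<beta> \<noteq> 0"
  then have "perm_sign k int (\<lambda>i. \<beta> (c, i)) \<noteq> 0" if "c < r" for c
    using that by (auto simp: coloured_alternant_def alternant_perm_sign)
  then have "\<exists>w. w permutes {..<k} \<and> (\<forall>i<k. \<beta> (c, i) = int (w i))" if "c < r" for c
    using perm_sign_nonzeroD that by blast
  then obtain w where w: "\<And>c. c < r \<Longrightarrow> w c permutes {..<k}"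
    "\<And>c i. c < r \<Longrightarrow> i < k \<Longrightarrow> \<beta> (c, i) = int (w c i)" by metis
  show "nonneg \<beta>" using w(2) by (auto simp: nonneg_def)
  have "(\<Sum>i<k. \<beta> (c, i)) = int (\<Sum>{..<k})" if c: "c < r" for c
  proof -
    have "(\<Sum>i<k. \<beta> (c, i)) = (\<Sum>i<k. int (w c i))" using w(2)[OF c] by simp
    also have "\<dots> = (\<Sum>i<k. int i)"
      by (rule sum.reindex_bij_betw[OF permutes_imp_bij[OF w(1)[OF c]]])
    finally show ?thesis by simp
  qed
  then show "sum \<beta> positions = base_total + int 0"
    by (simp add: sum_positions base_total_def)
next
  fix \<beta> :: "nat \<times> nat \<Rightarrow> int" and c i j assume c: "c < r" "i < k" "j < k" "i \<noteq> j"
  let ?t = "Transposition.transpose (c, i) (c, j)"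
  have row: "(\<lambda>x. (\<beta> \<circ> ?t) (c', x)) =
      (if c' = c then (\<lambda>x. \<beta> (c, x)) \<circ> Transposition.transpose i j else (\<lambda>x. \<beta> (c', x)))" for c'
    by (auto simp: fun_eq_iff Transposition.transpose_def)
  have "alternant k (\<lambda>x. (\<beta> \<circ> ?t) (c', x)) =
      (if c' = c then -1 else 1) * alternant k (\<lambda>x. \<beta> (c', x))" for c'
    unfolding row using perm_sign_transpose[OF c(2-4)] by (simp add: alternant_perm_sign)
  then show "coloured_alternant (\<beta> \<circ> ?t) = - coloured_alternant \<beta>"
    using c(1) by (simp add: coloured_alternant_def prod.distrib)
qed

definition degree_fun :: "nat \<Rightarrow> (nat \<times> nat \<Rightarrow> int) \<Rightarrow> int" where
  "degree_fun m = (shift_sum (- 1) ^^ m) coloured_alternant"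

lemma degree_fun_Suc: "degree_fun (Suc m) = shift_sum (- 1) (degree_fun m)"
  by (simp add: degree_fun_def)

lemma skew_degree_fun: "skew m (degree_fun m)"
proof (induction m)
  case (Suc m)
  then show ?case using skew_shift_sum[of m "degree_fun m" 1] by (simp add: degree_fun_Suc)
qed (simp add: degree_fun_def skew_coloured_alternant)

text \<open>Reassembles the full operator after an induction hypothesis has been applied to those
  terms whose shifted vector stays nonnegative.\<close>

lemma shift_sum_restrict:
  assumes F: "skew m F"
  shows "(\<Sum>q | q \<in> positions \<and> int l \<le> \<alpha> q. F (shift \<alpha> q (- int l))) = shift_sum (- int l) F \<alpha>"
  unfolding shift_sum_def
proof (rule sum.mono_neutral_left)
  show "\<forall>q\<in>positions - {q. q \<in> positions \<and> int l \<le> \<alpha> q}. F (shift \<alpha> q (- int l)) = 0"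
  proof (rule ballI, rule ccontr)
    fix q assume q: "q \<in> positions - {q. q \<in> positions \<and> int l \<le> \<alpha> q}" "F (shift \<alpha> q (- int l)) \<noteq> 0"
    from nonnegD[OF conjunct1[OF skew_supp[OF F q(2)]], of q] q(1) show False
      by (auto simp: shift_apply)
  qed
qed auto

text \<open>The adjoint acts on \<open>p_1^m a\<close> as \<open>r\<close> times the derivative in
  \<open>p_1\<close>: each of the \<open>m\<close> factors contributes \<open>r\<close> through the
  commutation rule, and \<open>a\<close> itself is annihilated because the result would lie below
  the minimal total.\<close>

lemma degree_fun_down:
  assumes "nonneg \<alpha>" "m \<le> k"
  shows "shift_sum 1 (degree_fun m) \<alpha> = (if m = 0 then 0 else int (r * m) * degree_fun (m - 1) \<alpha>)"
  using assms
proof (induction m arbitrary: \<alpha>)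
  case 0
  show ?case
  proof (rule ccontr)
    assume "\<not> ?case"
    then have nz: "shift_sum 1 (degree_fun 0) \<alpha> \<noteq> 0" by simp
    then obtain p where p: "p \<in> positions" "degree_fun 0 (shift \<alpha> p 1) \<noteq> 0"
      unfolding shift_sum_def by (meson sum.not_neutral_contains_not_neutral)
    from skew_supp[OF skew_degree_fun p(2)] p(1) have "sum \<alpha> positions < base_total"
      by (simp add: sum_shift)
    with shift_sum_low[OF skew_degree_fun 0(1) this] nz show False by simp
  qed
next
  case (Suc m)
  have "shift_sum 1 (degree_fun (Suc m)) \<alpha> = int r * degree_fun m \<alpha> +
      (\<Sum>q | q \<in> positions \<and> int 1 \<le> \<alpha> q. shift_sum 1 (degree_fun m) (shift \<alpha> q (- 1)))"
    using shift_sum_up_down[OF skew_degree_fun Suc.prems(1), of m 1] Suc.prems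
    by (simp add: degree_fun_Suc)
  also have "(\<Sum>q | q \<in> positions \<and> int 1 \<le> \<alpha> q. shift_sum 1 (degree_fun m) (shift \<alpha> q (- 1))) =
      (\<Sum>q | q \<in> positions \<and> int 1 \<le> \<alpha> q. if m = 0 then 0 else
        int (r * m) * degree_fun (m - 1) (shift \<alpha> q (- 1)))"
  proof (intro sum.cong refl Suc.IH)
    fix q assume "q \<in> {q. q \<in> positions \<and> int 1 \<le> \<alpha> q}"
    then show "nonneg (shift \<alpha> q (- 1))" using Suc.prems by (auto simp: nonneg_def shift_apply)
  qed (use Suc.prems in simp)
  also have "\<dots> = int (r * m) * degree_fun m \<alpha>"
  proof (cases m)
    case (Suc m')
    then show ?thesis
      using shift_sum_restrict[OF skew_degree_fun[of m'], where l = 1 and \<alpha> = \<alpha>]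
      by (simp add: degree_fun_Suc flip: sum_distrib_left)
  qed simp
  finally show ?case by (simp add: algebra_simps)
qed

text \<open>With \<open>m = n\<close> the factor is the order of the generalized symmetric group,
  which supplies \<open>total\<close> in the counting criterion.\<close>

lemma norm_sq_degree_fun:
  "m \<le> k \<Longrightarrow> norm_sq m (degree_fun m) = int (r ^ m * fact m) * norm_sq 0 coloured_alternant"
proof (induction m)
  case (Suc m)
  have "norm_sq (Suc m) (degree_fun (Suc m)) =
      (\<Sum>\<alpha>\<in>configs m. degree_fun m \<alpha> * shift_sum 1 (degree_fun (Suc m)) \<alpha>)"
    using shift_sum_adjoint[OF skew_degree_fun[of m], where l = 1 and G = "degree_fun (Suc m)"]
    by (simp add: norm_sq_def power2_eq_square degree_fun_Suc)
  also have "\<dots> = (\<Sum>\<alpha>\<in>configs m. int (r * Suc m) * (degree_fun m \<alpha>)\<^sup>2)"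
    using Suc.prems by (intro sum.cong refl) (simp add: degree_fun_down configs_def power2_eq_square)
  also have "\<dots> = int (r * Suc m) * norm_sq m (degree_fun m)"
    by (simp add: norm_sq_def sum_distrib_left)
  finally show ?case using Suc by (simp add: algebra_simps)
qed (simp add: degree_fun_def)

text \<open>If two different beads could both be moved down by \<open>l\<close>, then moving both would give distinct
  nonnegative positions in each colour with a total below the least possible one.\<close>

lemma abs_shift_sum_le:
  assumes F: "skew m F" and le: "\<And>\<beta>. \<bar>F \<beta>\<bar> \<le> 1" and "m < l"
  shows "\<bar>shift_sum (- int l) F \<beta>\<bar> \<le> 1"
proof (cases "\<exists>c i j. c < r \<and> i < k \<and> j < k \<and> i \<noteq> j \<and> \<beta> (c, i) = \<beta> (c, j)")
  case True
  then show ?thesis using shift_sum_collision[OF F] by auto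
next
  case False
  have uniq: "p = q" if p: "p \<in> positions" "F (shift \<beta> p (- int l)) \<noteq> 0"
    and q: "q \<in> positions" "F (shift \<beta> q (- int l)) \<noteq> 0" for p q
  proof (rule ccontr)
    assume "p \<noteq> q"
    define \<gamma> where "\<gamma> = shift (shift \<beta> p (- int l)) q (- int l)"
    note sp = skew_supp[OF F p(2)] and sq = skew_supp[OF F q(2)]
    have \<gamma>: "\<gamma> x = (if x = q then shift \<beta> q (- int l) x else shift \<beta> p (- int l) x)" for x
      using \<open>p \<noteq> q\<close> by (auto simp: \<gamma>_def shift_apply)
    have "nonneg \<gamma>" using sp sq by (auto simp: nonneg_def \<gamma>)
    moreover have "sum \<gamma> positions < base_total"
      using sp q(1) \<open>m < l\<close> by (simp add: \<gamma>_def sum_shift)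
    ultimately obtain c i j where c: "c < r" "i < k" "j < k" "i \<noteq> j" "\<gamma> (c, i) = \<gamma> (c, j)"
      using low_total_collision by blast
    \<comment> \<open>A collision in \<open>\<gamma>\<close> is impossible. If neither or both of
      the two colliding beads were moved, they already coincide in \<open>\<beta>\<close>; if
      exactly one was moved, they coincide after the move of \<open>p\<close> alone or of
      \<open>q\<close> alone.\<close>
    have ip: "shift \<beta> p (- int l) (c, i) \<noteq> shift \<beta> p (- int l) (c, j)"
      using skew_inj[OF F p(2) c(1-3)] c(4) by blast
    have iq: "shift \<beta> q (- int l) (c, i) \<noteq> shift \<beta> q (- int l) (c, j)"
      using skew_inj[OF F q(2) c(1-3)] c(4) by blast
    have "\<beta> (c, i) \<noteq> \<beta> (c, j)" using False c by blast
    then show False using ip iq c(4,5) \<open>p \<noteq> q\<close> by (auto simp: \<gamma>_def shift_apply split: if_splits)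
  qed
  show ?thesis
  proof (cases "\<exists>p\<in>positions. F (shift \<beta> p (- int l)) \<noteq> 0")
    case True
    then obtain p where p: "p \<in> positions" "F (shift \<beta> p (- int l)) \<noteq> 0" by blast
    have "shift_sum (- int l) F \<beta> = (\<Sum>q\<in>positions. if q = p then F (shift \<beta> p (- int l)) else 0)"
      unfolding shift_sum_def using uniq[OF p] by (intro sum.cong) auto
    then show ?thesis using p(1) le by simp
  next
    case False
    then have "shift_sum (- int l) F \<beta> = 0" unfolding shift_sum_def by (intro sum.neutral) auto
    then show ?thesis by simp
  qed
qed

lemma shift_sum_parity:
  assumes "\<And>\<beta>. even (F \<beta> - G \<beta>)" shows "even (shift_sum z F \<beta> - shift_sum z G \<beta>)"
  unfolding shift_sum_def sum_subtractf[symmetric] using assms by (intro dvd_sum) auto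

text \<open>Squaring a power sum modulo 2: the diagonal terms form \<open>shift_sum (2 * z)\<close>,
  and the others cancel in pairs \<open>(p, q)\<close> and \<open>(q, p)\<close>.\<close>

lemma shift_sum_double_parity: "even (shift_sum (2 * z) F \<beta> - shift_sum z (shift_sum z F) \<beta>)"
proof -
  let ?f = "\<lambda>p q. F (shift (shift \<beta> p z) q z)"
  have sym: "?f p q = ?f q p" for p q by (simp add: shift_commute)
  have even_off: "even (\<Sum>p\<in>A. \<Sum>q\<in>A - {p}. ?f p q)" if "finite A" for A
    using that
  proof (induction A rule: finite_induct)
    case (insert a A)
    have "(\<Sum>p\<in>insert a A. \<Sum>q\<in>insert a A - {p}. ?f p q) =
        (\<Sum>q\<in>A. ?f a q) + (\<Sum>p\<in>A. ?f p a + (\<Sum>q\<in>A - {p}. ?f p q))"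
    proof -
      have "insert a A - {a} = A" using insert.hyps by auto
      moreover have "(\<Sum>q\<in>insert a A - {p}. ?f p q) = ?f p a + (\<Sum>q\<in>A - {p}. ?f p q)" if "p \<in> A" for p
      proof -
        have "insert a A - {p} = insert a (A - {p})" using that insert.hyps by auto
        then show ?thesis using insert.hyps by simp
      qed
      ultimately show ?thesis using insert.hyps by simp
    qed
    also have "\<dots> = 2 * (\<Sum>q\<in>A. ?f a q) + (\<Sum>p\<in>A. \<Sum>q\<in>A - {p}. ?f p q)"
      using sym by (simp add: sum.distrib)
    finally show ?case using insert.IH by simp
  qed simp
  have "shift_sum z (shift_sum z F) \<beta> = (\<Sum>p\<in>positions. ?f p p + (\<Sum>q\<in>positions - {p}. ?f p q))"
    unfolding shift_sum_def by (intro sum.cong refl sum.remove) auto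
  also have "\<dots> = shift_sum (2 * z) F \<beta> + (\<Sum>p\<in>positions. \<Sum>q\<in>positions - {p}. ?f p q)"
    by (simp add: sum.distrib shift_sum_def shift_shift_same)
  finally show ?thesis using even_off[of positions] by simp
qed

lemma shift_sum_power_parity:
  "even (shift_sum (- (2 ^ j)) F \<beta> - (shift_sum (- 1) ^^ (2 ^ j)) F \<beta>)"
proof (induction j arbitrary: F \<beta>)
  case (Suc j)
  let ?S = "shift_sum (- (2 ^ j))" and ?T = "shift_sum (- 1) ^^ (2 ^ j)"
  have "even (shift_sum (- (2 ^ Suc j)) F \<beta> - ?S (?S F) \<beta>)"
    using shift_sum_double_parity[of "- (2 ^ j)" F \<beta>] by simp
  moreover have "even (?S (?S F) \<beta> - ?S (?T F) \<beta>)"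
    using Suc.IH by (intro shift_sum_parity)
  moreover have "even (?S (?T F) \<beta> - ?T (?T F) \<beta>)" by (rule Suc.IH)
  moreover have "(shift_sum (- 1) ^^ (2 ^ Suc j)) F = ?T (?T F)"
    by (simp add: funpow_add mult_2)
  ultimately show ?case by simp
qed simp

section \<open>Binary digits and the parity of the degrees\<close>

lemma binary_powers_top:
  assumes "m < 2 ^ j"
  shows "binary_powers (m + 2 ^ j) = insert (2 ^ j) (binary_powers m)" "2 ^ j \<notin> binary_powers m"
proof -
  have nb: "\<not> bit m i" if "j \<le> i" for i
  proof -
    have "(2::nat) ^ j \<le> 2 ^ i" using that by simp
    then have "m < 2 ^ i" using assms by linarith
    then show ?thesis by (simp add: bit_iff_odd)
  qed
  have "bit (m + 2 ^ j) i \<longleftrightarrow> bit m i \<or> i = j" for i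
  proof -
    have "m + 2 ^ j = or m (2 ^ j)"
      by (rule disjunctive_add) (use nb in \<open>auto simp: bit_simps\<close>)
    then show ?thesis by (auto simp: bit_simps)
  qed
  then show "binary_powers (m + 2 ^ j) = insert (2 ^ j) (binary_powers m)"
    by (auto simp: binary_powers_def)
  show "2 ^ j \<notin> binary_powers m" using nb by (auto simp: binary_powers_def)
qed

lemma finite_binary_powers: "finite (binary_powers n)"
proof -
  have "binary_powers n \<subseteq> {..n}"
  proof
    fix x assume "x \<in> binary_powers n"
    then obtain i where "x = 2 ^ i" "bit n i" by (auto simp: binary_powers_def)
    then show "x \<in> {..n}" by (auto simp: bit_iff_odd intro!: leI)
  qed
  then show ?thesis by (rule finite_subset) simp
qed

lemma binary_degree_fun:
  assumes "n \<le> k"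
  shows "\<exists>V. skew n V \<and> (\<forall>\<beta>. \<bar>V \<beta>\<bar> \<le> 1) \<and> (\<forall>\<beta>. even (V \<beta> - degree_fun n \<beta>)) \<and>
    norm_sq n V = int (r ^ card (binary_powers n) * \<Prod>(binary_powers n)) * norm_sq 0 coloured_alternant"
  using assms
proof (induction n rule: less_induct)
  case (less n)
  show ?case
  proof (cases "n = 0")
    case True
    have "\<bar>coloured_alternant \<beta>\<bar> \<le> 1" for \<beta>
      unfolding coloured_alternant_def abs_prod alternant_perm_sign
      by (intro prod_le_1) (auto intro!: abs_perm_sign_le)
    moreover have "binary_powers 0 = {}" by (simp add: binary_powers_def)
    ultimately show ?thesis
      using True skew_coloured_alternant by (auto simp: degree_fun_def intro!: exI[of _ coloured_alternant])
  next
    case False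
    then obtain j where j: "2 ^ j \<le> n" "n < 2 ^ Suc j" using ex_power_ivl1[of 2 n] by auto
    \<comment> \<open>The top digit is split off, so it is the last factor to be multiplied in. Then
      \<open>m < 2 ^ j\<close>, the condition required both for the norm and for the bound on the
      coefficients.\<close>
    define m where "m = n - 2 ^ j"
    have n: "n = m + 2 ^ j" and m: "m < 2 ^ j" using j by (auto simp: m_def)
    then have "m < n" "m \<le> k" using less.prems by auto
    then obtain V where V: "skew m V" "\<And>\<beta>. \<bar>V \<beta>\<bar> \<le> 1" "\<And>\<beta>. even (V \<beta> - degree_fun m \<beta>)"
      and norm: "norm_sq m V = int (r ^ card (binary_powers m) * \<Prod>(binary_powers m)) * norm_sq 0 coloured_alternant"
      using less.IH by blast
    let ?V = "shift_sum (- int (2 ^ j)) V"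
    have "even (?V \<beta> - degree_fun n \<beta>)" for \<beta>
    proof -
      have "even (?V \<beta> - shift_sum (- int (2 ^ j)) (degree_fun m) \<beta>)"
        using V(3) by (rule shift_sum_parity)
      moreover have "even (shift_sum (- int (2 ^ j)) (degree_fun m) \<beta> - degree_fun n \<beta>)"
        using shift_sum_power_parity[of j "degree_fun m" \<beta>]
        by (simp add: n degree_fun_def funpow_add add.commute[of m])
      ultimately show ?thesis by simp
    qed
    moreover have "skew n ?V" unfolding n by (rule skew_shift_sum[OF V(1)])
    moreover have "\<bar>?V \<beta>\<bar> \<le> 1" for \<beta> using abs_shift_sum_le[OF V(1,2) m] .
    moreover have "norm_sq n ?V = int (r ^ card (binary_powers n) * \<Prod>(binary_powers n)) * norm_sq 0 coloured_alternant"
      using norm_sq_shift_sum[OF V(1) m] norm n less.prems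
      by (simp add: binary_powers_top[OF m] finite_binary_powers algebra_simps)
    ultimately show ?thesis by blast
  qed
qed

lemma card_odd_degree_fun:
  assumes "n \<le> k"
  shows "int (card {\<beta> \<in> configs n. odd (degree_fun n \<beta>)}) =
    int (r ^ card (binary_powers n) * \<Prod>(binary_powers n)) * norm_sq 0 coloured_alternant"
proof -
  obtain V where V: "\<And>\<beta>. \<bar>V \<beta>\<bar> \<le> 1" "\<And>\<beta>. even (V \<beta> - degree_fun n \<beta>)"
    "norm_sq n V = int (r ^ card (binary_powers n) * \<Prod>(binary_powers n)) * norm_sq 0 coloured_alternant"
    using binary_degree_fun[OF assms] by blast
  have "(V \<beta>)\<^sup>2 = (if odd (degree_fun n \<beta>) then 1 else 0)" for \<beta>
  proof -
    have "V \<beta> = 0 \<or> V \<beta> = 1 \<or> V \<beta> = -1" using V(1)[of \<beta>] by linarith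
    then show ?thesis using V(2)[of \<beta>] by auto
  qed
  then have "norm_sq n V = int (card {\<beta> \<in> configs n. odd (degree_fun n \<beta>)})"
    by (simp add: norm_sq_def sum.If_cases finite_configs Int_def)
  with V(3) show ?thesis by simp
qed

end

section \<open>Colourings\<close>

definition colour_count :: "'i set \<Rightarrow> ('i \<Rightarrow> 't) \<Rightarrow> 't \<Rightarrow> nat" where
  "colour_count A h t = card {i \<in> A. h i = t}"

lemma colour_count_eq_count: "finite A \<Longrightarrow> colour_count A h t = count (image_mset h (mset_set A)) t"
  by (simp add: colour_count_def count_image_mset vimage_def Int_def conj_commute)

lemma colour_count_permute:
  assumes "\<sigma> permutes A" shows "colour_count A (h \<circ> \<sigma>) = colour_count A h"
proof
  fix t
  have "bij_betw \<sigma> {i \<in> A. (h \<circ> \<sigma>) i = t} {i \<in> A. h i = t}"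
    using permutes_imp_bij[OF assms] by (auto simp: bij_betw_def inj_on_def image_iff)
  then show "colour_count A (h \<circ> \<sigma>) t = colour_count A h t" by (simp add: colour_count_def bij_betw_same_card)
qed

lemma colour_count_cong: "(\<And>i. i \<in> A \<Longrightarrow> h i = h' i) \<Longrightarrow> colour_count A h = colour_count A h'"
  unfolding colour_count_def by (rule ext, rule arg_cong[of _ _ card]) auto

lemma sum_colour_count:
  assumes "finite A" "finite T" "\<And>i. i \<in> A \<Longrightarrow> h i \<in> T"
  shows "sum (colour_count A h) T = card A"
proof -
  have "card A = (\<Sum>t\<in>T. \<Sum>i\<in>{i \<in> A. h i = t}. 1)"
    using sum.group[OF assms(1,2), of h "\<lambda>_. 1::nat"] assms(3) by (simp add: image_subset_iff)
  then show ?thesis by (simp add: colour_count_def)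
qed

lemma colour_count_surj:
  assumes A: "finite A" and T: "finite T" and \<kappa>: "\<And>t. t \<notin> T \<Longrightarrow> \<kappa> t = 0" "sum \<kappa> T = card A"
  shows "\<exists>h\<in>A \<rightarrow>\<^sub>E T. colour_count A h = \<kappa>"
proof -
  define M where "M = (\<Sum>t\<in>T. replicate_mset (\<kappa> t) t)"
  have cM: "count M t = \<kappa> t" for t
    using T \<kappa>(1) by (auto simp: M_def count_sum)
  have "size (\<Sum>t\<in>S. replicate_mset (\<kappa> t) t) = sum \<kappa> S" if "finite S" for S
    using that by induction auto
  then have "size M = card A" using \<kappa>(2) T by (simp add: M_def)
  obtain xs where xs: "mset xs = M" using ex_mset by blast
  have len: "length xs = card A" using \<open>size M = card A\<close> xs by (metis size_mset)
  obtain en where en: "bij_betw en A {..<card A}"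
    using ex_bij_betw_finite_nat[OF A] by (auto simp: atLeast0LessThan)
  have setT: "set xs \<subseteq> T"
  proof
    fix t assume "t \<in> set xs"
    then have "count M t \<noteq> 0" using xs by (metis count_eq_zero_iff set_mset_mset)
    then show "t \<in> T" using cM \<kappa>(1) by force
  qed
  define h where "h = (\<lambda>i\<in>A. xs ! en i)"
  have enA: "en i < card A" if "i \<in> A" for i using en that by (auto simp: bij_betw_def)
  have "h \<in> A \<rightarrow>\<^sub>E T" using setT len enA by (auto simp: h_def)
  moreover have "colour_count A h t = \<kappa> t" for t
  proof -
    have "bij_betw en {i \<in> A. h i = t} {m. m < length xs \<and> xs ! m = t}"
      using en by (auto simp: bij_betw_def inj_on_def h_def len image_iff) 
    then have "colour_count A h t = card {m. m < length xs \<and> xs ! m = t}"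
      by (simp add: colour_count_def bij_betw_same_card)
    also have "\<dots> = count (mset xs) t"
      by (simp add: count_mset count_list_eq_length_filter length_filter_conv_card eq_commute)
    finally show ?thesis using xs cM by simp
  qed
  ultimately show ?thesis by blast
qed

text \<open>Colourings with the same content form one orbit of the symmetric group. By
  orbit-stabilizer, the stabilizer orders over an orbit add up to the order of the group, so each
  content is counted \<open>fact (card A)\<close> times.\<close>

lemma sum_fixed_colourings:
  fixes \<Theta> :: "('t \<Rightarrow> nat) \<Rightarrow> 'b :: comm_ring_1"
  assumes A: "finite A" and T: "finite T"
  shows "(\<Sum>\<sigma> | \<sigma> permutes A. \<Sum>h\<in>{h \<in> A \<rightarrow>\<^sub>E T. \<forall>i\<in>A. h (\<sigma> i) = h i}. \<Theta> (colour_count A h)) =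
    of_nat (fact (card A)) * (\<Sum>\<kappa> | (\<forall>t. t \<notin> T \<longrightarrow> \<kappa> t = 0) \<and> sum \<kappa> T = card A. \<Theta> \<kappa>)"
proof -
  let ?P = "{\<sigma>. \<sigma> permutes A}" and ?H = "A \<rightarrow>\<^sub>E T"
  let ?K = "{\<kappa>. (\<forall>t. t \<notin> T \<longrightarrow> \<kappa> t = 0) \<and> sum \<kappa> T = card A}"
  let ?S = "\<lambda>h. {\<sigma> \<in> ?P. \<forall>i\<in>A. h (\<sigma> i) = h i}"
  have finP: "finite ?P" using A by (rule finite_permutations)
  have finH: "finite ?H" using A T by (intro finite_PiE) auto
  have cont: "colour_count A h \<in> ?K" if "h \<in> ?H" for h
  proof -
    have "colour_count A h t = 0" if "t \<notin> T" for t
      using that \<open>h \<in> ?H\<close> by (auto simp: colour_count_def card_eq_0_iff PiE_iff)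
    then show ?thesis using sum_colour_count[OF A T, of h] that by auto
  qed
  have "?K \<subseteq> colour_count A ` ?H" using colour_count_surj[OF A T] by blast
  then have finK: "finite ?K" by (rule finite_subset) (use finH in simp)
  have stab: "(\<Sum>h\<in>{h \<in> ?H. colour_count A h = \<kappa>}. card (?S h)) = fact (card A)" if \<kappa>: "\<kappa> \<in> ?K" for \<kappa>
  proof -
    obtain h0 where h0: "h0 \<in> ?H" "colour_count A h0 = \<kappa>" using colour_count_surj[OF A T, of \<kappa>] \<kappa> by auto
    define g where "g \<sigma> = restrict (h0 \<circ> \<sigma>) A" for \<sigma>
    have "g \<sigma> \<in> {h \<in> ?H. colour_count A h = \<kappa>}" if \<sigma>: "\<sigma> permutes A" for \<sigma>
    proof -
      have "colour_count A (g \<sigma>) = colour_count A (h0 \<circ> \<sigma>)" by (rule colour_count_cong) (simp add: g_def)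
      then show ?thesis
        using h0 colour_count_permute[OF \<sigma>, of h0] permutes_in_image[OF \<sigma>] by (auto simp: g_def)
    qed
    then have "(\<Sum>h\<in>{h \<in> ?H. colour_count A h = \<kappa>}. \<Sum>\<sigma>\<in>{\<sigma> \<in> ?P. g \<sigma> = h}. 1) = (\<Sum>\<sigma>\<in>?P. 1 :: nat)"
      using finP finH by (intro sum.group) auto
    moreover have "card (?S h) = card {\<sigma> \<in> ?P. g \<sigma> = h}" if h: "h \<in> ?H" "colour_count A h = \<kappa>" for h
    proof -
      have "image_mset h (mset_set A) = image_mset h0 (mset_set A)"
        by (rule multiset_eqI) (use h h0 colour_count_eq_count[OF A] in metis)
      then obtain \<tau> where \<tau>: "\<tau> permutes A" "\<forall>x\<in>A. h x = h0 (\<tau> x)"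
        using image_mset_eq_implies_permutes[OF A] by metis
      have "g (\<tau> \<circ> \<sigma>) = h \<longleftrightarrow> (\<forall>i\<in>A. h (\<sigma> i) = h i)" if \<sigma>: "\<sigma> permutes A" for \<sigma>
      proof -
        have "g (\<tau> \<circ> \<sigma>) = h \<longleftrightarrow> (\<forall>i\<in>A. h0 (\<tau> (\<sigma> i)) = h i)"
          using h(1) by (auto simp: g_def fun_eq_iff PiE_iff extensional_def)
        then show ?thesis using \<tau>(2) permutes_in_image[OF \<sigma>] by auto
      qed
      note g = this
      \<comment> \<open>The permutations taking \<open>h0\<close> to \<open>h\<close> form the coset
        of the stabilizer of \<open>h\<close> by \<open>\<tau>\<close>, because \<open>h\<close> is
        \<open>h0 \<circ> \<tau>\<close> on \<open>A\<close>.\<close>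
      have "bij_betw (\<lambda>\<sigma>. \<tau> \<circ> \<sigma>) (?S h) {\<sigma> \<in> ?P. g \<sigma> = h}"
      proof (rule bij_betwI[where g = "\<lambda>\<sigma>. Hilbert_Choice.inv \<tau> \<circ> \<sigma>"])
        show "(\<lambda>\<sigma>. \<tau> \<circ> \<sigma>) \<in> ?S h \<rightarrow> {\<sigma> \<in> ?P. g \<sigma> = h}"
          using g \<tau>(1) by (auto intro: permutes_compose)
        show "(\<lambda>\<sigma>. Hilbert_Choice.inv \<tau> \<circ> \<sigma>) \<in> {\<sigma> \<in> ?P. g \<sigma> = h} \<rightarrow> ?S h"
        proof
          fix \<sigma> assume "\<sigma> \<in> {\<sigma> \<in> ?P. g \<sigma> = h}"
          then have \<sigma>: "\<sigma> permutes A" "g \<sigma> = h" by auto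
          have "\<tau> \<circ> (Hilbert_Choice.inv \<tau> \<circ> \<sigma>) = \<sigma>"
            using permutes_inverses(1)[OF \<tau>(1)] by (simp add: fun_eq_iff)
          then show "Hilbert_Choice.inv \<tau> \<circ> \<sigma> \<in> ?S h"
            using g[of "Hilbert_Choice.inv \<tau> \<circ> \<sigma>"] \<sigma> permutes_compose[OF \<sigma>(1) permutes_inv[OF \<tau>(1)]]
            by simp
        qed
      qed (use permutes_inverses[OF \<tau>(1)] in \<open>auto simp: fun_eq_iff\<close>)
      then show ?thesis by (rule bij_betw_same_card)
    qed
    ultimately have "(\<Sum>h\<in>{h \<in> ?H. colour_count A h = \<kappa>}. card (?S h)) = card ?P" by simp
    then show ?thesis using card_permutations[OF refl A] by simp
  qed
  have "(\<Sum>\<sigma>\<in>?P. \<Sum>h\<in>{h \<in> ?H. \<forall>i\<in>A. h (\<sigma> i) = h i}. \<Theta> (colour_count A h)) =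
      (\<Sum>h\<in>?H. \<Sum>\<sigma>\<in>?S h. \<Theta> (colour_count A h))"
    using finP finH by (intro sum.swap_restrict)
  also have "\<dots> = (\<Sum>\<kappa>\<in>?K. \<Sum>h\<in>{h \<in> ?H. colour_count A h = \<kappa>}. \<Sum>\<sigma>\<in>?S h. \<Theta> (colour_count A h))"
    using finH finK cont by (intro sum.group[symmetric]) auto
  also have "\<dots> = (\<Sum>\<kappa>\<in>?K. of_nat (\<Sum>h\<in>{h \<in> ?H. colour_count A h = \<kappa>}. card (?S h)) * \<Theta> \<kappa>)"
    by (intro sum.cong refl) (simp add: sum_distrib_right)
  also have "\<dots> = of_nat (fact (card A)) * (\<Sum>\<kappa>\<in>?K. \<Theta> \<kappa>)"
    using stab by (simp add: sum_distrib_left)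
  finally show ?thesis .
qed

section \<open>Rearrangements within colours and the orthogonality relation for several
  colours\<close>

context coloured_beads begin

definition row_sign :: "(nat \<times> nat \<Rightarrow> int) \<Rightarrow> (nat \<times> nat \<Rightarrow> int) \<Rightarrow> int" where
  "row_sign b b' = (\<Prod>c<r. perm_sign k (\<lambda>i. b (c, i)) (\<lambda>i. b' (c, i)))"

definition inj_rows :: "(nat \<times> nat \<Rightarrow> int) \<Rightarrow> bool" where
  "inj_rows b \<longleftrightarrow> (\<forall>c<r. inj_on (\<lambda>i. b (c, i)) {..<k})"

text \<open>Distinct beads may be permuted independently in each colour, and different permutations
  give different vectors. This number is the redundancy \<open>w\<close> of the counting
  criterion.\<close>

lemma card_row_sign_nonzero:
  assumes b: "inj_rows b"
  shows "card {b'. (\<forall>p. p \<notin> positions \<longrightarrow> b' p = 0) \<and> row_sign b b' \<noteq> 0} = fact k ^ r"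
proof -
  let ?W = "{..<r} \<rightarrow>\<^sub>E {w. w permutes {..<k}}"
  define J where "J \<omega> = (\<lambda>(c, i). if c < r \<and> i < k then b (c, \<omega> c i) else 0)" for \<omega> :: "nat \<Rightarrow> nat \<Rightarrow> nat"
  have inj: "inj_on (\<lambda>i. b (c, i)) {..<k}" if "c < r" for c using b that by (simp add: inj_rows_def)
  have nz: "row_sign b b' \<noteq> 0 \<longleftrightarrow> (\<forall>c<r. \<exists>w. w permutes {..<k} \<and> (\<forall>i<k. b' (c, i) = b (c, w i)))" for b'
    unfolding row_sign_def using perm_sign_nonzero_iff[OF inj] by (auto simp: prod_zero_iff)
  have "bij_betw J ?W {b'. (\<forall>p. p \<notin> positions \<longrightarrow> b' p = 0) \<and> row_sign b b' \<noteq> 0}"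
    unfolding bij_betw_def
  proof
    show "inj_on J ?W"
    proof (rule inj_onI)
      fix \<omega> \<omega>' assume w: "\<omega> \<in> ?W" "\<omega>' \<in> ?W" and eq: "J \<omega> = J \<omega>'"
      show "\<omega> = \<omega>'"
      proof (rule PiE_ext[OF w])
        fix c assume "c \<in> {..<r}"
        then have c: "c < r" "\<omega> c permutes {..<k}" "\<omega>' c permutes {..<k}" using w by auto
        show "\<omega> c = \<omega>' c"
        proof (rule permutes_lessThan_eqI[OF c(2,3)])
          fix i assume i: "i < k"
          have "b (c, \<omega> c i) = b (c, \<omega>' c i)" using fun_cong[OF eq, of "(c, i)"] c(1) i by (simp add: J_def)
          then show "\<omega> c i = \<omega>' c i"
            using inj[OF c(1)] i permutes_in_image[OF c(2), of i] permutes_in_image[OF c(3), of i]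
            by (auto dest: inj_onD)
        qed
      qed
    qed
    show "J ` ?W = {b'. (\<forall>p. p \<notin> positions \<longrightarrow> b' p = 0) \<and> row_sign b b' \<noteq> 0}"
    proof (intro equalityI subsetI)
      fix b' assume "b' \<in> J ` ?W"
      then obtain \<omega> where \<omega>: "\<omega> \<in> ?W" "b' = J \<omega>" by blast
      have "\<exists>w. w permutes {..<k} \<and> (\<forall>i<k. b' (c, i) = b (c, w i))" if "c < r" for c
        using \<omega> that by (intro exI[of _ "\<omega> c"]) (auto simp: J_def)
      moreover have "\<forall>p. p \<notin> positions \<longrightarrow> b' p = 0" using \<omega>(2) by (auto simp: J_def)
      ultimately show "b' \<in> {b'. (\<forall>p. p \<notin> positions \<longrightarrow> b' p = 0) \<and> row_sign b b' \<noteq> 0}"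
        unfolding mem_Collect_eq nz by blast
    next
      fix b' assume "b' \<in> {b'. (\<forall>p. p \<notin> positions \<longrightarrow> b' p = 0) \<and> row_sign b b' \<noteq> 0}"
      then have z: "\<forall>p. p \<notin> positions \<longrightarrow> b' p = 0"
        and "\<forall>c<r. \<exists>w. w permutes {..<k} \<and> (\<forall>i<k. b' (c, i) = b (c, w i))" using nz by auto
      then obtain w where w: "\<And>c. c < r \<Longrightarrow> w c permutes {..<k} \<and> (\<forall>i<k. b' (c, i) = b (c, w c i))" by metis
      have "b' = J (restrict w {..<r})" using w z by (auto simp: fun_eq_iff J_def)
      moreover have "restrict w {..<r} \<in> ?W" using w by auto
      ultimately show "b' \<in> J ` ?W" by blast
    qed
  qed
  then have "card {b'. (\<forall>p. p \<notin> positions \<longrightarrow> b' p = 0) \<and> row_sign b b' \<noteq> 0} = card ?W"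
    by (rule bij_betw_same_card[symmetric])
  also have "\<dots> = fact k ^ r" by (simp add: card_PiE card_permutations)
  finally show ?thesis .
qed

lemma row_sign_config:
  assumes b: "b \<in> configs m" and inj: "inj_rows b" and b': "\<And>p. p \<notin> positions \<Longrightarrow> b' p = 0"
    and nz: "row_sign b b' \<noteq> 0"
  shows "b' \<in> configs m" "inj_rows b'"
proof -
  have "\<forall>c<r. \<exists>w. w permutes {..<k} \<and> (\<forall>i<k. b' (c, i) = b (c, w i))"
    using nz perm_sign_nonzeroD[of k] by (auto simp: row_sign_def prod_zero_iff)
  then obtain w where w: "\<And>c. c < r \<Longrightarrow> w c permutes {..<k}"
    and eq: "\<And>c i. c < r \<Longrightarrow> i < k \<Longrightarrow> b' (c, i) = b (c, w c i)" by metis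
  have wk: "w c i < k" if "c < r" "i < k" for c i using permutes_in_image[OF w[OF that(1)], of i] that by simp
  have "(\<Sum>i<k. b' (c, i)) = (\<Sum>i<k. b (c, i))" if c: "c < r" for c
  proof -
    have "(\<Sum>i<k. b' (c, i)) = (\<Sum>i<k. b (c, w c i))" using eq[OF c] by simp
    also have "\<dots> = (\<Sum>i<k. b (c, i))"
      by (rule sum.reindex_bij_betw[OF permutes_imp_bij[OF w[OF c]]])
    finally show ?thesis .
  qed
  then have "sum b' positions = sum b positions" unfolding sum_positions by simp
  moreover have "nonneg b'" using b eq wk by (auto simp: configs_def nonneg_def)
  ultimately show "b' \<in> configs m" using b b' by (simp add: configs_def)
  show "inj_rows b'"
    unfolding inj_rows_def
  proof (intro allI impI inj_onI)
    fix c i j assume c: "c < r" and ij: "i \<in> {..<k}" "j \<in> {..<k}" "b' (c, i) = b' (c, j)"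
    then have "w c i = w c j" using inj eq wk by (auto simp: inj_rows_def dest!: inj_onD)
    then show "i = j" using permutes_inj[OF w[OF c]] by (auto dest: injD)
  qed
qed

text \<open>The product of the alternants is itself a \<open>row_sign\<close>, taken from the vector
  whose beads fill the lowest places, so its square is the indicator of the rearrangements of that
  vector.\<close>

lemma norm_sq_coloured_alternant: "norm_sq 0 coloured_alternant = int (fact k ^ r)"
proof -
  let ?b = "\<lambda>(c, i). if c < r \<and> i < k then int i else 0"
  have alt: "coloured_alternant b' = row_sign ?b b'" for b'
    by (auto simp: coloured_alternant_def row_sign_def alternant_perm_sign perm_sign_def
        intro!: prod.cong sum.cong)
      (metis (no_types, lifting) lessThan_iff permutes_in_image)+
  have inj: "inj_rows ?b" by (auto simp: inj_rows_def inj_on_def)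
  have "(\<Sum>i<k. ?b (c, i)) = int (\<Sum>{..<k})" if "c < r" for c using that by simp
  then have b0: "?b \<in> configs 0"
    by (auto simp: configs_def nonneg_def sum_positions base_total_def)
  have abs: "\<bar>row_sign ?b b'\<bar> \<le> 1" for b'
    unfolding row_sign_def abs_prod
    using inj by (intro prod_le_1) (auto intro!: abs_perm_sign_le simp: inj_rows_def)
  have "(coloured_alternant b')\<^sup>2 = (if row_sign ?b b' \<noteq> 0 then 1 else 0)" for b'
  proof -
    have "row_sign ?b b' = 0 \<or> row_sign ?b b' = 1 \<or> row_sign ?b b' = -1" using abs[of b'] by linarith
    then show ?thesis unfolding alt by auto
  qed
  then have "norm_sq 0 coloured_alternant = int (card {b' \<in> configs 0. row_sign ?b b' \<noteq> 0})"
    by (simp add: norm_sq_def sum.If_cases finite_configs Int_def)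
  also have "{b' \<in> configs 0. row_sign ?b b' \<noteq> 0} =
      {b'. (\<forall>p. p \<notin> positions \<longrightarrow> b' p = 0) \<and> row_sign ?b b' \<noteq> 0}"
    using row_sign_config(1)[OF b0 inj] by (auto simp: configs_def)
  finally show ?thesis using card_row_sign_nonzero[OF inj] by simp
qed

text \<open>Expanding \<open>p_1^m\<close> means choosing one variable for each of the
  \<open>m\<close> factors, which is a colouring of the factors.\<close>

lemma degree_fun_colourings:
  "degree_fun m \<beta> = (\<Sum>f\<in>{1..m} \<rightarrow>\<^sub>E positions. coloured_alternant (\<lambda>p. \<beta> p - int (colour_count {1..m} f p)))"
proof (induction m arbitrary: \<beta>)
  case 0
  then show ?case by (simp add: degree_fun_def colour_count_def)
next
  case (Suc m)
  let ?F = "{1..m} \<rightarrow>\<^sub>E positions"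
  have ins: "{1..Suc m} = insert (Suc m) {1..m}" by auto
  have "(\<Sum>f\<in>{1..Suc m} \<rightarrow>\<^sub>E positions. coloured_alternant (\<lambda>p. \<beta> p - int (colour_count {1..Suc m} f p))) =
      (\<Sum>(p, f)\<in>positions \<times> ?F. coloured_alternant (\<lambda>q. \<beta> q - int (colour_count {1..Suc m} (f(Suc m := p)) q)))"
    unfolding ins PiE_insert_eq
    by (subst sum.reindex) (auto simp: case_prod_beta intro!: inj_combinator)
  also have "\<dots> = (\<Sum>p\<in>positions. \<Sum>f\<in>?F. coloured_alternant (\<lambda>q. shift \<beta> p (- 1) q - int (colour_count {1..m} f q)))"
    unfolding sum.cartesian_product[symmetric]
  proof (rule sum.cong[OF refl], rule sum.cong[OF refl])
    fix p :: "nat \<times> nat" and f :: "nat \<Rightarrow> nat \<times> nat"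
    have "colour_count {1..Suc m} (f(Suc m := p)) q = colour_count {1..m} f q + (if q = p then 1 else 0)" for q
    proof -
      have "{i \<in> {1..Suc m}. (f(Suc m := p)) i = q} =
          {i \<in> {1..m}. f i = q} \<union> (if q = p then {Suc m} else {})" by auto
      then show ?thesis by (auto simp: colour_count_def)
    qed
    then show "coloured_alternant (\<lambda>q. \<beta> q - int (colour_count {1..Suc m} (f(Suc m := p)) q)) =
        coloured_alternant (\<lambda>q. shift \<beta> p (- 1) q - int (colour_count {1..m} f q))"
      by (intro arg_cong[of _ _ coloured_alternant]) (auto simp: shift_apply)
  qed
  also have "\<dots> = degree_fun (Suc m) \<beta>"
    by (simp add: degree_fun_Suc shift_sum_def Suc.IH)
  finally show ?case by simp
qed

text \<open>Multiplies \<open>sum_alternant_margins\<close> over the colours. The constraint on the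
  total of \<open>\<kappa>\<close> does not obstruct this: a nonzero alternant already fixes the row
  sums up to permutation and thereby forces the total \<open>n\<close>.\<close>

lemma sum_margins_coloured:
  assumes b: "b \<in> configs n" and b': "b' \<in> configs n"
  defines "T \<equiv> {..<r} \<times> ({..<k} \<times> {..<k})"
  shows "(\<Sum>\<kappa> | (\<forall>t. t \<notin> T \<longrightarrow> \<kappa> t = 0) \<and> sum \<kappa> T = n.
      coloured_alternant (\<lambda>(c, i). b (c, i) - int (\<Sum>j<k. \<kappa> (c, (i, j)))) *
      coloured_alternant (\<lambda>(c, j). b' (c, j) - int (\<Sum>i<k. \<kappa> (c, (i, j))))) = row_sign b b'"
proof -
  \<comment> \<open>A single cut-off that bounds each bead of \<open>b\<close> by the total of
    \<open>b\<close>, and each entry of \<open>\<kappa>\<close> by \<open>n\<close>.\<close>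
  define M where "M = nat (base_total + int n)"
  have bM: "0 \<le> b (c, i) \<and> b (c, i) \<le> int M" if "c < r" "i < k" for c i
    using b that member_le_sum[of "(c, i)" positions b] by (auto simp: configs_def nonneg_def M_def)
  let ?g = "\<lambda>c \<kappa>. alternant k (\<lambda>i. b (c, i) - int (\<Sum>j<k. \<kappa> i j)) *
      alternant k (\<lambda>j. b' (c, j) - int (\<Sum>i<k. \<kappa> i j))"
  let ?E = "{..<k} \<rightarrow>\<^sub>E ({..<k} \<rightarrow>\<^sub>E {..M})"
  let ?K = "{\<kappa>. (\<forall>t. t \<notin> T \<longrightarrow> \<kappa> t = 0) \<and> sum \<kappa> T = n}"
  let ?\<Theta> = "\<lambda>\<kappa>. coloured_alternant (\<lambda>(c, i). b (c, i) - int (\<Sum>j<k. \<kappa> (c, (i, j)))) *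
      coloured_alternant (\<lambda>(c, j). b' (c, j) - int (\<Sum>i<k. \<kappa> (c, (i, j))))"
  have finT: "finite T" by (simp add: T_def)
  have \<Theta>: "?\<Theta> \<kappa> = (\<Prod>c<r. ?g c (\<lambda>i j. \<kappa> (c, (i, j))))" for \<kappa>
    by (simp add: coloured_alternant_def prod.distrib)
  have total: "sum \<kappa> T = n" if "?\<Theta> \<kappa> \<noteq> 0" for \<kappa>
  proof -
    have "coloured_alternant (\<lambda>(c, i). b (c, i) - int (\<Sum>j<k. \<kappa> (c, (i, j)))) \<noteq> 0" using that by auto
    from skew_supp[OF skew_coloured_alternant this]
    have "(\<Sum>(c, i)\<in>positions. b (c, i) - int (\<Sum>j<k. \<kappa> (c, (i, j)))) = base_total" by simp
    moreover have "(\<Sum>(c, i)\<in>positions. b (c, i) - int (\<Sum>j<k. \<kappa> (c, (i, j)))) = sum b positions - int (sum \<kappa> T)"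
      by (simp add: case_prod_unfold sum_subtractf T_def sum.cartesian_product')
    ultimately have "int (sum \<kappa> T) = int n" using b by (simp add: configs_def)
    then show ?thesis by (simp only: of_nat_eq_iff)
  qed
  have bound: "\<kappa> t \<le> M" if k: "\<And>t. t \<notin> T \<Longrightarrow> \<kappa> t = 0" and s: "sum \<kappa> T = n" for \<kappa> t
  proof -
    have "0 \<le> base_total" by (simp add: base_total_def sum_nonneg)
    then have "n \<le> M" by (simp add: M_def)
    moreover have "\<kappa> t \<le> n"
      using k[of t] s member_le_sum[of t T \<kappa>] finT by (cases "t \<in> T") auto
    ultimately show ?thesis by simp
  qed
  let ?C = "\<lambda>\<kappa>. \<lambda>c\<in>{..<r}. \<lambda>i\<in>{..<k}. \<lambda>j\<in>{..<k}. \<kappa> (c, (i, j))"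
  let ?U = "\<lambda>g t. if t \<in> T then g (fst t) (fst (snd t)) (snd (snd t)) else 0"
  have finE: "finite ({..<r} \<rightarrow>\<^sub>E ?E)" by (intro finite_PiE) auto
  have \<Theta>U: "?\<Theta> (?U g) = (\<Prod>c<r. ?g c (g c))" for g :: "nat \<Rightarrow> nat \<Rightarrow> nat \<Rightarrow> nat"
  proof -
    have "?\<Theta> (?U g) = (\<Prod>c<r. ?g c (\<lambda>i j. ?U g (c, (i, j))))" by (rule \<Theta>)
    also have "\<dots> = (\<Prod>c<r. ?g c (g c))"
      by (intro prod.cong refl arg_cong2[of _ _ _ _ "(*)"])
        (auto simp: alternant_def T_def intro!: sum.cong)
    finally show ?thesis .
  qed
  have UC: "?U (?C \<kappa>) = \<kappa>" if "\<And>t. t \<notin> T \<Longrightarrow> \<kappa> t = 0" for \<kappa> :: "nat \<times> nat \<times> nat \<Rightarrow> nat"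
    using that by (force simp: fun_eq_iff T_def)
  \<comment> \<open>\<open>?C\<close> curries an array into a family of square matrices, one for
    each colour, and \<open>?U\<close> goes back. Families with a wrong total have no partner; they
    are collected in \<open>T'\<close> and contribute 0 by \<open>total\<close>.\<close>
  have "(\<Sum>\<kappa>\<in>?K. ?\<Theta> \<kappa>) = (\<Sum>g\<in>{..<r} \<rightarrow>\<^sub>E ?E. \<Prod>c<r. ?g c (g c))"
  proof (rule sum.reindex_bij_witness_not_neutral[where j = ?C and i = ?U and S' = "{}" and
        T' = "{g \<in> {..<r} \<rightarrow>\<^sub>E ?E. sum (?U g) T \<noteq> n}"])
    fix \<kappa> assume "\<kappa> \<in> ?K - {}"
    then have \<kappa>: "\<And>t. t \<notin> T \<Longrightarrow> \<kappa> t = 0" "sum \<kappa> T = n" by auto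
    show U: "?U (?C \<kappa>) = \<kappa>" by (rule UC[OF \<kappa>(1)])
    have "?C \<kappa> \<in> {..<r} \<rightarrow>\<^sub>E ?E" using bound[OF \<kappa>] by auto
    moreover have "sum (?U (?C \<kappa>)) T = n" unfolding U by (rule \<kappa>(2))
    ultimately show "?C \<kappa> \<in> ({..<r} \<rightarrow>\<^sub>E ?E) - {g \<in> {..<r} \<rightarrow>\<^sub>E ?E. sum (?U g) T \<noteq> n}"
      by blast
  next
    fix \<kappa> assume "\<kappa> \<in> ?K"
    then have "\<And>t. t \<notin> T \<Longrightarrow> \<kappa> t = 0" by auto
    note U = UC[OF this]
    show "(\<Prod>c<r. ?g c (?C \<kappa> c)) = ?\<Theta> \<kappa>" by (rule trans[OF \<Theta>U[symmetric] arg_cong[OF U, where f = ?\<Theta>]])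
  next
    fix g assume g: "g \<in> ({..<r} \<rightarrow>\<^sub>E ?E) - {g \<in> {..<r} \<rightarrow>\<^sub>E ?E. sum (?U g) T \<noteq> n}"
    show "?C (?U g) = g"
    proof (rule ext)
      fix c
      show "?C (?U g) c = g c"
      proof (cases "c < r")
        case True
        have "g \<in> {..<r} \<rightarrow>\<^sub>E ?E" using g by blast
        from PiE_mem[OF this, of c] True have gc: "g c \<in> ?E" by simp
        have "(\<lambda>i\<in>{..<k}. \<lambda>j\<in>{..<k}. ?U g (c, (i, j))) = g c"
        proof (rule ext)
          fix i
          show "(\<lambda>i\<in>{..<k}. \<lambda>j\<in>{..<k}. ?U g (c, (i, j))) i = g c i"
          proof (cases "i < k")
            case i: True
            from PiE_mem[OF gc, of i] i have "g c i \<in> {..<k} \<rightarrow>\<^sub>E {..M}" by simp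
            from PiE_arb[OF this] have "g c i j = undefined" if "\<not> j < k" for j using that by simp
            then show ?thesis using i True by (simp add: fun_eq_iff T_def)
          next
            case False
            then have "g c i = undefined" by (intro PiE_arb[OF gc]) simp
            then show ?thesis using False by simp
          qed
        qed
        then show ?thesis using True by simp
      next
        case False
        have "g \<in> {..<r} \<rightarrow>\<^sub>E ?E" using g by blast
        then have "g c = undefined" using False by (intro PiE_arb[of g "{..<r}" "\<lambda>_. ?E"]) auto
        then show ?thesis using False by simp
      qed
    qed
    show "?U g \<in> ?K - {}" using g by auto
  next
    fix g assume "g \<in> {g \<in> {..<r} \<rightarrow>\<^sub>E ?E. sum (?U g) T \<noteq> n}"
    then have "sum (?U g) T \<noteq> n" by blast
    have "?\<Theta> (?U g) = 0"
    proof (rule ccontr)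
      assume "?\<Theta> (?U g) \<noteq> 0"
      then have "sum (?U g) T = n" by (rule total)
      with \<open>sum (?U g) T \<noteq> n\<close> show False by contradiction
    qed
    then show "(\<Prod>c<r. ?g c (g c)) = 0" by (rule trans[OF \<Theta>U[symmetric]])
  qed (use finE in auto)
  also have "\<dots> = (\<Prod>c<r. \<Sum>\<kappa>\<in>?E. ?g c \<kappa>)"
    by (rule prod_sum_PiE[symmetric]) (auto intro!: finite_PiE)
  also have "\<dots> = row_sign b b'"
    unfolding row_sign_def perm_sign_def
    by (intro prod.cong refl sum_alternant_margins) (use bM in auto)
  finally show ?thesis .
qed

end

section \<open>Characters of the generalized symmetric group\<close>

definition root_char :: "nat \<Rightarrow> nat \<Rightarrow> int \<Rightarrow> complex" where
  "root_char r c z = cis (2 * pi * real c * real_of_int z / real r)"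

lemma root_char_zero [simp]: "root_char r c 0 = 1"
  by (simp add: root_char_def)

lemma root_char_nonzero [simp]: "root_char r c z \<noteq> 0"
  by (simp add: root_char_def)

lemma root_char_add: "root_char r c (x + y) = root_char r c x * root_char r c y"
  by (simp add: root_char_def cis_mult ring_distribs add_divide_distrib)

lemma root_char_mult_period:
  assumes "r > 0" shows "root_char r c (int r * z) = 1"
proof -
  have "2 * pi * real c * real_of_int (int r * z) / real r = 2 * pi * real_of_int (int c * z)"
    using assms by simp
  then show ?thesis unfolding root_char_def by (metis cis_multiple_2pi Ints_of_int)
qed

lemma root_char_mod:
  assumes "r > 0" shows "root_char r c (z mod int r) = root_char r c z"
proof -
  have "root_char r c z = root_char r c (int r * (z div int r) + z mod int r)" by simp
  also have "\<dots> = root_char r c (z mod int r)"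
    unfolding root_char_add root_char_mult_period[OF assms] by simp
  finally show ?thesis by simp
qed

lemma root_char_power: "root_char r c (int m) = root_char r c 1 ^ m"
  by (induction m) (simp_all add: root_char_add)

lemma root_char_one_eq_iff:
  assumes "c < r" "c' < r" "root_char r c 1 = root_char r c' 1"
  shows "c = c'"
proof -
  have r: "r > 0" using assms by simp
  have "cis (2 * pi * real c / real r) = cis (2 * pi * real c' / real r)"
    using assms(3) by (simp add: root_char_def)
  then have "sin (2 * pi * real c / real r) = sin (2 * pi * real c' / real r) \<and>
      cos (2 * pi * real c / real r) = cos (2 * pi * real c' / real r)"
    by (simp add: complex_eq_iff)
  then obtain m :: int where m: "2 * pi * real c / real r = 2 * pi * real c' / real r + 2 * pi * real_of_int m"
    using sin_cos_eq_iff by auto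
  then have "pi * (real c - real c' - real_of_int m * real r) = 0" using r by (simp add: field_simps)
  then have "real c - real c' = real_of_int m * real r" by simp
  then have "real_of_int (int c - int c') = real_of_int (m * int r)" by simp
  then have eq: "int c - int c' = m * int r" by (simp only: of_int_eq_iff)
  have "\<bar>m * int r\<bar> < 1 * int r" unfolding eq[symmetric] using assms(1,2) by auto
  then have "\<bar>m\<bar> * int r < 1 * int r" by (simp add: abs_mult)
  then have "\<bar>m\<bar> < 1" by (rule mult_right_less_imp_less) simp
  then show ?thesis using eq by simp
qed

text \<open>A geometric sum in an \<open>r\<close>-th root of unity, which differs from 1 exactly if
  the two characters differ.\<close>

lemma root_char_orthogonal:
  assumes c: "c < r" "c' < r"
  shows "(\<Sum>z\<in>{0..<int r}. root_char r c z / root_char r c' z) = (if c = c' then of_nat r else 0)"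
proof -
  define \<zeta> where "\<zeta> = root_char r c 1 / root_char r c' 1"
  have "(\<Sum>z\<in>{0..<int r}. root_char r c z / root_char r c' z) = (\<Sum>m<r. \<zeta> ^ m)"
    by (rule sum.reindex_bij_witness[where i = int and j = nat])
      (auto simp: \<zeta>_def power_divide simp flip: root_char_power)
  also have "\<dots> = (if c = c' then of_nat r else 0)"
  proof (cases "c = c'")
    case False
    then have "\<zeta> \<noteq> 1" using root_char_one_eq_iff[OF c] by (auto simp: \<zeta>_def)
    moreover have "\<zeta> ^ r = 1"
      using c root_char_mult_period[of r _ 1] by (simp add: \<zeta>_def power_divide flip: root_char_power)
    ultimately show ?thesis using False by (simp add: geometric_sum)
  qed (simp add: \<zeta>_def)
  finally show ?thesis .
qed

declare One_nat_def [simp del]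

text \<open>The number \<open>k\<close> of beads per colour is set to \<open>n\<close>, the largest
  degree that occurs, so the bounds by \<open>k\<close> in the bead lemmas hold. Positivity of
  \<open>r\<close> excludes \<open>integer_mod_group 0\<close>, which is the infinite cyclic
  group.\<close>

locale wreath = coloured_beads r n for r n +
  assumes r_pos: "r > 0"
begin

abbreviation G where "G \<equiv> generalized_sym_group n r"

lemma carrier_G: "carrier G = ({1..n} \<rightarrow>\<^sub>E {0..<int r}) \<times> {\<sigma>. \<sigma> permutes {1..n}}"
  using r_pos by (simp add: generalized_sym_group_def semidirect_product_def carrier_integer_mod_group
      sym_group_def)

lemma mult_G: "(a, \<sigma>) \<otimes>\<^bsub>G\<^esub> (b, \<tau>) = (\<lambda>i\<in>{1..n}. (a i + b (Hilbert_Choice.inv \<sigma> i)) mod int r, \<sigma> \<circ> \<tau>)"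
  by (auto simp: generalized_sym_group_def semidirect_product_def sym_group_def coord_perm_def fun_eq_iff)

lemma one_G: "\<one>\<^bsub>G\<^esub> = (\<lambda>i\<in>{1..n}. 0, id)"
  by (simp add: generalized_sym_group_def semidirect_product_def sym_group_def)

lemma card_G: "card (carrier G) = r ^ n * fact n"
  unfolding carrier_G card_cartesian_product by (simp add: card_PiE card_permutations)

end

sublocale wreath \<subseteq> finite_group "generalized_sym_group n r"
  by (intro finite_group.intro group_generalized_sym_group finite_group_axioms.intro)
    (auto simp: carrier_G finite_permutations intro!: finite_PiE)

section \<open>The monomial action on colourings and its virtual characters\<close>

context wreath begin

definition colourings :: "(nat \<Rightarrow> nat \<times> nat) set" where
  "colourings = {1..n} \<rightarrow>\<^sub>E positions"

definition act :: "(nat \<Rightarrow> int) \<times> (nat \<Rightarrow> nat) \<Rightarrow> (nat \<Rightarrow> nat \<times> nat) \<Rightarrow> nat \<Rightarrow> nat \<times> nat" where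
  "act x f = (\<lambda>i\<in>{1..n}. f (Hilbert_Choice.inv (snd x) i))"

text \<open>The element \<open>(a, \<sigma>)\<close> permutes by \<open>\<sigma>\<close> before
  scaling by \<open>a\<close>, so the characters are chosen by the colours of the permuted
  colouring. This order makes \<open>weight_mult\<close> the cocycle rule.\<close>

definition weight :: "(nat \<Rightarrow> int) \<times> (nat \<Rightarrow> nat) \<Rightarrow> (nat \<Rightarrow> nat \<times> nat) \<Rightarrow> complex" where
  "weight x f = (\<Prod>i\<in>{1..n}. root_char r (fst (f (Hilbert_Choice.inv (snd x) i))) (fst x i))"

lemma finite_colourings: "finite colourings"
  by (auto simp: colourings_def intro!: finite_PiE)

lemma inv_in: "\<sigma> permutes {1..n} \<Longrightarrow> i \<in> {1..n} \<Longrightarrow> Hilbert_Choice.inv \<sigma> i \<in> {1..n}"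
  by (simp only: permutes_in_image[OF permutes_inv])

lemma act_colourings: "x \<in> carrier G \<Longrightarrow> f \<in> colourings \<Longrightarrow> act x f \<in> colourings"
  unfolding act_def colourings_def
  by (rule iffD2[OF restrict_PiE_iff], rule ballI, rule PiE_mem, assumption, rule inv_in)
    (auto simp: carrier_G)

lemma act_one: "f \<in> colourings \<Longrightarrow> act \<one>\<^bsub>G\<^esub> f = f"
  by (auto simp: act_def one_G colourings_def fun_eq_iff PiE_iff extensional_def)

lemma act_mult:
  assumes "x \<in> carrier G" "y \<in> carrier G"
  shows "act (x \<otimes>\<^bsub>G\<^esub> y) f = act x (act y f)"
proof -
  obtain a \<sigma> b \<tau> where xy: "x = (a, \<sigma>)" "y = (b, \<tau>)" by fastforce
  have p: "\<sigma> permutes {1..n}" "\<tau> permutes {1..n}" using assms by (auto simp: xy carrier_G)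
  have "Hilbert_Choice.inv (\<sigma> \<circ> \<tau>) = Hilbert_Choice.inv \<tau> \<circ> Hilbert_Choice.inv \<sigma>"
    using p by (intro o_inv_distrib permutes_bij)
  then show ?thesis using inv_in[OF p(1)] by (auto simp: act_def xy mult_G fun_eq_iff)
qed

lemma weight_one: "weight \<one>\<^bsub>G\<^esub> f = 1"
  by (simp add: weight_def one_G)

lemma weight_mult:
  assumes "x \<in> carrier G" "y \<in> carrier G"
  shows "weight (x \<otimes>\<^bsub>G\<^esub> y) f = weight x (act y f) * weight y f"
proof -
  obtain a \<sigma> b \<tau> where xy: "x = (a, \<sigma>)" "y = (b, \<tau>)" by fastforce
  have p: "\<sigma> permutes {1..n}" "\<tau> permutes {1..n}" using assms by (auto simp: xy carrier_G)
  let ?s = "Hilbert_Choice.inv \<sigma>" and ?t = "Hilbert_Choice.inv \<tau>"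
  have inv: "Hilbert_Choice.inv (\<sigma> \<circ> \<tau>) = ?t \<circ> ?s"
    using p by (intro o_inv_distrib permutes_bij)
  have "weight (x \<otimes>\<^bsub>G\<^esub> y) f = (\<Prod>i\<in>{1..n}. root_char r (fst (f (?t (?s i)))) (a i + b (?s i)))"
    by (auto simp: weight_def xy mult_G inv root_char_mod[OF r_pos] intro!: prod.cong)
  also have "\<dots> = (\<Prod>i\<in>{1..n}. root_char r (fst (f (?t (?s i)))) (a i)) *
      (\<Prod>i\<in>{1..n}. root_char r (fst (f (?t (?s i)))) (b (?s i)))"
    by (simp add: root_char_add prod.distrib)
  also have "(\<Prod>i\<in>{1..n}. root_char r (fst (f (?t (?s i)))) (b (?s i))) = weight y f"
    unfolding weight_def xy snd_conv fst_conv
    by (rule prod.reindex_bij_betw[OF permutes_imp_bij[OF permutes_inv[OF p(1)]]])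
  also have "(\<Prod>i\<in>{1..n}. root_char r (fst (f (?t (?s i)))) (a i)) = weight x (act y f)"
    using inv_in[OF p(1)] by (auto simp: weight_def xy act_def intro!: prod.cong)
  finally show ?thesis .
qed

lemma colour_count_act:
  assumes "x \<in> carrier G" shows "colour_count {1..n} (act x f) = colour_count {1..n} f"
proof -
  have p: "Hilbert_Choice.inv (snd x) permutes {1..n}" using assms by (auto simp: carrier_G permutes_inv)
  have "colour_count {1..n} (act x f) = colour_count {1..n} (f \<circ> Hilbert_Choice.inv (snd x))"
    by (rule colour_count_cong) (simp add: act_def)
  then show ?thesis using colour_count_permute[OF p] by simp
qed

definition coeff :: "(nat \<times> nat \<Rightarrow> int) \<Rightarrow> (nat \<Rightarrow> nat \<times> nat) \<Rightarrow> int" where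
  "coeff b f = coloured_alternant (\<lambda>p. b p - int (colour_count {1..n} f p))"

text \<open>Frobenius' formula: the value at \<open>x\<close> is the coefficient of \<open>b\<close> in the product of the alternants
  of the \<open>r\<close> colours with the generating function of the traces of \<open>x\<close> on colourings of fixed
  content.\<close>

definition frobenius_char :: "(nat \<times> nat \<Rightarrow> int) \<Rightarrow> (nat \<Rightarrow> int) \<times> (nat \<Rightarrow> nat) \<Rightarrow> complex" where
  "frobenius_char b x = (if x \<in> carrier G then
     \<Sum>f\<in>colourings. if act x f = f then of_int (coeff b f) * weight x f else 0 else 0)"

text \<open>The action preserves content and \<open>coeff b\<close> depends only on content.
  Grouping the colourings by content therefore gives an integer combination of characters of
  monomial representations.\<close>

lemma frobenius_char_virtual: "frobenius_char b \<in> virtual_chars"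
proof -
  let ?\<Gamma> = "colour_count {1..n} ` colourings"
  let ?X = "\<lambda>\<gamma>. {f \<in> colourings. colour_count {1..n} f = \<gamma>}"
  let ?\<pi> = "\<lambda>\<gamma> x. if x \<in> carrier G then \<Sum>f\<in>?X \<gamma>. if act x f = f then weight x f else 0 else 0"
  have "?\<pi> \<gamma> \<in> virtual_chars" for \<gamma>
  proof -
    obtain \<rho> where \<rho>: "complex_rep G (card (?X \<gamma>)) \<rho>"
      "\<And>x. x \<in> carrier G \<Longrightarrow> character \<rho> x = (\<Sum>f\<in>?X \<gamma>. if act x f = f then weight x f else 0)"
      by (rule monomial_rep[of "?X \<gamma>" act weight])
        (auto simp: finite_colourings act_colourings act_one act_mult weight_one weight_mult colour_count_act)
    have "character \<rho> = ?\<pi> \<gamma>" using \<rho>(2) by (auto simp: character_def fun_eq_iff)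
    then show ?thesis using character_virtual[OF \<rho>(1)] by simp
  qed
  then have "(\<lambda>x. \<Sum>\<gamma>\<in>?\<Gamma>. of_int (coloured_alternant (\<lambda>p. b p - int (\<gamma> p))) * ?\<pi> \<gamma> x) \<in> virtual_chars"
    by (intro virtual_chars_sum virtual_chars_smult)
  also have "(\<lambda>x. \<Sum>\<gamma>\<in>?\<Gamma>. of_int (coloured_alternant (\<lambda>p. b p - int (\<gamma> p))) * ?\<pi> \<gamma> x) = frobenius_char b"
  proof
    fix x
    show "(\<Sum>\<gamma>\<in>?\<Gamma>. of_int (coloured_alternant (\<lambda>p. b p - int (\<gamma> p))) * ?\<pi> \<gamma> x) = frobenius_char b x"
    proof (cases "x \<in> carrier G")
      case True
      have "frobenius_char b x = (\<Sum>\<gamma>\<in>?\<Gamma>. \<Sum>f\<in>?X \<gamma>. if act x f = f then of_int (coeff b f) * weight x f else 0)"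
        unfolding frobenius_char_def using True by (simp add: sum.image_gen[OF finite_colourings, symmetric])
      also have "\<dots> = (\<Sum>\<gamma>\<in>?\<Gamma>. of_int (coloured_alternant (\<lambda>p. b p - int (\<gamma> p))) * ?\<pi> \<gamma> x)"
        using True by (auto simp: coeff_def sum_distrib_left intro!: sum.cong)
      finally show ?thesis by simp
    qed (simp add: frobenius_char_def)
  qed
  finally show ?thesis .
qed

lemma frobenius_char_one: "frobenius_char b \<one>\<^bsub>G\<^esub> = of_int (degree_fun n b)"
  by (simp add: frobenius_char_def act_one weight_one degree_fun_colourings coeff_def colourings_def
      cong: sum.cong)

lemma weight_nonzero: "weight x f \<noteq> 0"
  by (simp add: weight_def)

lemma fixed_inv:
  assumes x: "x \<in> carrier G" and f: "f \<in> colourings"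
  shows "act (inv\<^bsub>G\<^esub> x) f = f \<longleftrightarrow> act x f = f"
proof -
  have *: "act y f = f" if "act (inv\<^bsub>G\<^esub> y) f = f" "y \<in> carrier G" for y
    using act_mult[of y "inv\<^bsub>G\<^esub> y" f] act_one[OF f] that by simp
  show ?thesis using *[of x] *[of "inv\<^bsub>G\<^esub> x"] x by auto
qed

lemma weight_inv:
  assumes x: "x \<in> carrier G" and f: "f \<in> colourings" "act x f = f"
  shows "weight (inv\<^bsub>G\<^esub> x) f = 1 / weight x f"
proof -
  have "weight (inv\<^bsub>G\<^esub> x) f * weight x f = 1"
    using weight_mult[of "inv\<^bsub>G\<^esub> x" x f] x f by (simp add: weight_one)
  then show ?thesis using weight_nonzero by (simp add: field_simps)
qed

lemma act_fixed_iff: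
  assumes "\<sigma> permutes {1..n}" "f \<in> colourings"
  shows "act (a, \<sigma>) f = f \<longleftrightarrow> (\<forall>i\<in>{1..n}. f (\<sigma> i) = f i)"
proof -
  have "act (a, \<sigma>) f = f \<longleftrightarrow> (\<forall>i\<in>{1..n}. f (Hilbert_Choice.inv \<sigma> i) = f i)"
    using assms(2) by (auto simp: act_def colourings_def fun_eq_iff PiE_iff extensional_def)
  also have "\<dots> \<longleftrightarrow> (\<forall>i\<in>{1..n}. f (\<sigma> i) = f i)"
    using permutes_inverses[OF assms(1)] inv_in[OF assms(1)] permutes_in_image[OF assms(1)]
    by metis
  finally show ?thesis .
qed

lemma weight_fixed:
  assumes "act (a, \<sigma>) f = f"
  shows "weight (a, \<sigma>) f = (\<Prod>i\<in>{1..n}. root_char r (fst (f i)) (a i))"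
  unfolding weight_def using assms by (intro prod.cong) (auto simp: act_def fun_eq_iff split: if_splits)

lemma sum_weight_ratio:
  assumes f: "f \<in> colourings" "f' \<in> colourings"
  shows "(\<Sum>a\<in>{1..n} \<rightarrow>\<^sub>E {0..<int r}. (\<Prod>i\<in>{1..n}. root_char r (fst (f i)) (a i)) /
      (\<Prod>i\<in>{1..n}. root_char r (fst (f' i)) (a i))) =
    (if \<forall>i\<in>{1..n}. fst (f i) = fst (f' i) then of_nat (r ^ n) else 0)"
proof -
  have "(\<Sum>a\<in>{1..n} \<rightarrow>\<^sub>E {0..<int r}. (\<Prod>i\<in>{1..n}. root_char r (fst (f i)) (a i)) /
      (\<Prod>i\<in>{1..n}. root_char r (fst (f' i)) (a i))) =
    (\<Prod>i\<in>{1..n}. \<Sum>z\<in>{0..<int r}. root_char r (fst (f i)) z / root_char r (fst (f' i)) z)"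
    by (subst prod_sum_PiE) (auto simp: prod_dividef)
  also have "\<dots> = (\<Prod>i\<in>{1..n}. if fst (f i) = fst (f' i) then of_nat r else 0)"
    using f by (intro prod.cong root_char_orthogonal refl)
      (auto simp: colourings_def mem_Times_iff dest!: PiE_mem)
  also have "\<dots> = (if \<forall>i\<in>{1..n}. fst (f i) = fst (f' i) then of_nat (r ^ n) else 0)"
    by (subst prod_if_all) auto
  finally show ?thesis .
qed

text \<open>Summing over the cyclic coordinates retains only pairs of colourings that use the same
  colour at every coordinate. Such a pair is a single colouring by triples, so the sum over
  permutations becomes a sum over contents \<open>\<kappa>\<close> whose two margins are the
  contents of the pair; \<open>sum_margins_coloured\<close> evaluates it.\<close>

lemma cinner_frobenius_char:
  assumes b: "b \<in> configs n" and b': "b' \<in> configs n"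
  shows "cinner (frobenius_char b) (frobenius_char b') = of_int (row_sign b b')"
proof -
  define T where "T = {..<r} \<times> ({..<n} \<times> {..<n})"
  let ?A = "{1..n} \<rightarrow>\<^sub>E {0..<int r}" and ?P = "{\<sigma>. \<sigma> permutes {1..n}}"
  let ?Fix = "\<lambda>\<sigma>. {f \<in> colourings. \<forall>i\<in>{1..n}. f (\<sigma> i) = f i}"
  let ?pw = "\<lambda>f a. \<Prod>i\<in>{1..n}. root_char r (fst (f i)) (a i)"
  let ?C = "\<lambda>f f'. (of_int (coeff b f * coeff b' f') :: complex)"
  let ?same = "\<lambda>ff :: (nat \<Rightarrow> nat \<times> nat) \<times> (nat \<Rightarrow> nat \<times> nat).
    \<forall>i\<in>{1..n}. fst (fst ff i) = fst (snd ff i)"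
  have finFix: "finite (?Fix \<sigma>)" for \<sigma> using finite_colourings by simp
  have finP: "finite ?P" by (simp add: finite_permutations)
  have summand: "frobenius_char b (a, \<sigma>) * frobenius_char b' (inv\<^bsub>G\<^esub> (a, \<sigma>)) =
      (\<Sum>f\<in>?Fix \<sigma>. \<Sum>f'\<in>?Fix \<sigma>. ?C f f' * (?pw f a / ?pw f' a))"
    if a: "a \<in> ?A" and \<sigma>: "\<sigma> permutes {1..n}" for a \<sigma>
  proof -
    have x: "(a, \<sigma>) \<in> carrier G" using a \<sigma> by (simp add: carrier_G)
    have F1: "frobenius_char b (a, \<sigma>) = (\<Sum>f\<in>?Fix \<sigma>. of_int (coeff b f) * ?pw f a)"
    proof -
      have "frobenius_char b (a, \<sigma>) = (\<Sum>f\<in>colourings. if \<forall>i\<in>{1..n}. f (\<sigma> i) = f i then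
          of_int (coeff b f) * ?pw f a else 0)"
        using x act_fixed_iff[OF \<sigma>] weight_fixed[of a \<sigma>]
        by (auto simp: frobenius_char_def intro!: sum.cong)
      then show ?thesis by (simp add: sum.inter_filter[OF finite_colourings])
    qed
    have F2: "frobenius_char b' (inv\<^bsub>G\<^esub> (a, \<sigma>)) = (\<Sum>f\<in>?Fix \<sigma>. of_int (coeff b' f) / ?pw f a)"
    proof -
      have "frobenius_char b' (inv\<^bsub>G\<^esub> (a, \<sigma>)) = (\<Sum>f\<in>colourings. if \<forall>i\<in>{1..n}. f (\<sigma> i) = f i then
          of_int (coeff b' f) / ?pw f a else 0)"
        using x act_fixed_iff[OF \<sigma>, of _ a] weight_fixed[of a \<sigma>] weight_inv[OF x] fixed_inv[OF x]
        by (auto simp: frobenius_char_def intro!: sum.cong)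
      then show ?thesis by (simp add: sum.inter_filter[OF finite_colourings])
    qed
    show ?thesis unfolding F1 F2 sum_product by (intro sum.cong refl) simp
  qed
  have "(\<Sum>x\<in>carrier G. frobenius_char b x * frobenius_char b' (inv\<^bsub>G\<^esub> x)) =
      (\<Sum>a\<in>?A. \<Sum>\<sigma>\<in>?P. frobenius_char b (a, \<sigma>) * frobenius_char b' (inv\<^bsub>G\<^esub> (a, \<sigma>)))"
    unfolding carrier_G sum.cartesian_product by (intro sum.cong) auto
  also have "\<dots> = (\<Sum>\<sigma>\<in>?P. \<Sum>a\<in>?A. \<Sum>f\<in>?Fix \<sigma>. \<Sum>f'\<in>?Fix \<sigma>. ?C f f' * (?pw f a / ?pw f' a))"
    by (subst sum.swap) (intro sum.cong refl summand, auto)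
  also have "\<dots> = (\<Sum>\<sigma>\<in>?P. \<Sum>f\<in>?Fix \<sigma>. \<Sum>f'\<in>?Fix \<sigma>. ?C f f' * (\<Sum>a\<in>?A. ?pw f a / ?pw f' a))"
    unfolding sum_distrib_left
    by (rule sum.cong[OF refl], subst sum.swap, rule sum.cong[OF refl], subst sum.swap, rule refl)
  also have "\<dots> = (\<Sum>\<sigma>\<in>?P. \<Sum>f\<in>?Fix \<sigma>. \<Sum>f'\<in>?Fix \<sigma>.
      if \<forall>i\<in>{1..n}. fst (f i) = fst (f' i) then of_nat (r ^ n) * ?C f f' else 0)"
    by (intro sum.cong refl) (auto simp: sum_weight_ratio)
  also have "\<dots> = of_nat (r ^ n) * (\<Sum>\<sigma>\<in>?P. \<Sum>ff\<in>{ff \<in> ?Fix \<sigma> \<times> ?Fix \<sigma>. ?same ff}. ?C (fst ff) (snd ff))"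
    unfolding sum_distrib_left sum.cartesian_product case_prod_unfold
    by (rule sum.cong[OF refl], rule sum.inter_filter[symmetric]) (simp add: finFix)
  also have "\<dots> = of_nat (r ^ n) * (\<Sum>\<sigma>\<in>?P. \<Sum>h\<in>{h \<in> {1..n} \<rightarrow>\<^sub>E T. \<forall>i\<in>{1..n}. h (\<sigma> i) = h i}.
      of_int (coloured_alternant (\<lambda>(c, i). b (c, i) - int (\<Sum>j<n. colour_count {1..n} h (c, (i, j)))) *
        coloured_alternant (\<lambda>(c, j). b' (c, j) - int (\<Sum>i<n. colour_count {1..n} h (c, (i, j))))))"
  proof (rule arg_cong[of _ _ "\<lambda>z. of_nat (r ^ n) * z"], rule sum.cong[OF refl])
    fix \<sigma> assume "\<sigma> \<in> ?P"
    then have \<sigma>: "\<sigma> permutes {1..n}" by simp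
    have \<sigma>i: "\<sigma> i \<in> {1..n}" if "i \<in> {1..n}" for i using permutes_in_image[OF \<sigma>] that by blast
    let ?fst = "\<lambda>h :: nat \<Rightarrow> nat \<times> nat \<times> nat. \<lambda>i\<in>{1..n}. (fst (h i), fst (snd (h i)))"
    let ?snd = "\<lambda>h :: nat \<Rightarrow> nat \<times> nat \<times> nat. \<lambda>i\<in>{1..n}. (fst (h i), snd (snd (h i)))"
    \<comment> \<open>The shared colour is stored once, followed by the index of \<open>f\<close>
      and that of \<open>f'\<close>. Restriction to \<open>{1..n}\<close> keeps all three maps
      within extensional functions.\<close>
    let ?pair = "\<lambda>(f, f'). \<lambda>i\<in>{1..n}. (fst (f i), (snd (f i), snd (f' i)))"
    show "(\<Sum>ff\<in>{ff \<in> ?Fix \<sigma> \<times> ?Fix \<sigma>. ?same ff}. ?C (fst ff) (snd ff)) =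
      (\<Sum>h\<in>{h \<in> {1..n} \<rightarrow>\<^sub>E T. \<forall>i\<in>{1..n}. h (\<sigma> i) = h i}.
      of_int (coloured_alternant (\<lambda>(c, i). b (c, i) - int (\<Sum>j<n. colour_count {1..n} h (c, (i, j)))) *
        coloured_alternant (\<lambda>(c, j). b' (c, j) - int (\<Sum>i<n. colour_count {1..n} h (c, (i, j))))))"
    proof (rule sum.reindex_bij_witness[where i = "\<lambda>h. (?fst h, ?snd h)" and j = ?pair])
      fix ff assume ff: "ff \<in> {ff \<in> ?Fix \<sigma> \<times> ?Fix \<sigma>. ?same ff}"
      obtain f f' where ff_eq: "ff = (f, f')" by fastforce
      have f: "f \<in> ?Fix \<sigma>" "f' \<in> ?Fix \<sigma>" and same: "\<forall>i\<in>{1..n}. fst (f i) = fst (f' i)"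
        using ff by (auto simp: ff_eq)
      show inv: "(?fst (?pair ff), ?snd (?pair ff)) = ff"
        using f same by (auto simp: ff_eq fun_eq_iff prod_eq_iff colourings_def PiE_iff extensional_def)
      show h: "?pair ff \<in> {h \<in> {1..n} \<rightarrow>\<^sub>E T. \<forall>i\<in>{1..n}. h (\<sigma> i) = h i}"
        using f \<sigma>i by (auto simp: ff_eq colourings_def T_def PiE_iff mem_Times_iff)
      have eqs: "?fst (?pair ff) = f" "?snd (?pair ff) = f'" using inv by (auto simp: ff_eq)
      let ?h = "?pair ff"
      have hT: "?h i \<in> T" if "i \<in> {1..n}" for i using h that by auto
      have "coloured_alternant (\<lambda>(c, i). b (c, i) - int (\<Sum>j<n. colour_count {1..n} ?h (c, (i, j)))) = coeff b f"
        unfolding coeff_def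
      proof (rule arg_cong[of _ _ coloured_alternant], rule ext, clarify)
        fix c i
        \<comment> \<open>The coordinates with value \<open>(c, i)\<close> under \<open>f\<close>
          are split by the index that \<open>f'\<close> takes there.\<close>
        have "(\<Sum>j<n. colour_count {1..n} ?h (c, (i, j))) = colour_count {1..n} f (c, i)"
          unfolding colour_count_def
          by (subst card_UN_disjoint[symmetric])
            (use hT eqs in \<open>auto simp: ff_eq T_def intro!: arg_cong[of _ _ card]\<close>)
        then show "b (c, i) - int (\<Sum>j<n. colour_count {1..n} ?h (c, (i, j))) =
            b (c, i) - int (colour_count {1..n} f (c, i))" by simp
      qed
      moreover have "coloured_alternant (\<lambda>(c, j). b' (c, j) - int (\<Sum>i<n. colour_count {1..n} ?h (c, (i, j)))) = coeff b' f'"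
        unfolding coeff_def
      proof (rule arg_cong[of _ _ coloured_alternant], rule ext, clarify)
        fix c j
        have "(\<Sum>i<n. colour_count {1..n} ?h (c, (i, j))) = colour_count {1..n} f' (c, j)"
          unfolding colour_count_def
          by (subst card_UN_disjoint[symmetric])
            (use hT same in \<open>auto simp: ff_eq T_def intro!: arg_cong[of _ _ card]\<close>)
        then show "b' (c, j) - int (\<Sum>i<n. colour_count {1..n} ?h (c, (i, j))) =
            b' (c, j) - int (colour_count {1..n} f' (c, j))" by simp
      qed
      ultimately show "of_int (coloured_alternant (\<lambda>(c, i). b (c, i) - int (\<Sum>j<n. colour_count {1..n} ?h (c, (i, j)))) *
        coloured_alternant (\<lambda>(c, j). b' (c, j) - int (\<Sum>i<n. colour_count {1..n} ?h (c, (i, j))))) =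
        ?C (fst ff) (snd ff)" by (simp add: ff_eq)
    next
      fix h assume h: "h \<in> {h \<in> {1..n} \<rightarrow>\<^sub>E T. \<forall>i\<in>{1..n}. h (\<sigma> i) = h i}"
      show "?pair (?fst h, ?snd h) = h"
        using h by (auto simp: fun_eq_iff PiE_iff extensional_def)
      show "(?fst h, ?snd h) \<in> {ff \<in> ?Fix \<sigma> \<times> ?Fix \<sigma>. ?same ff}"
        using h \<sigma>i by (auto simp: colourings_def T_def PiE_iff mem_Times_iff)
    qed
  qed
  also have "\<dots> = of_nat (r ^ n) * (of_nat (fact n) * of_int (row_sign b b'))"
  proof -
    have finT: "finite T" by (simp add: T_def)
    have "(\<Sum>\<sigma>\<in>?P. \<Sum>h\<in>{h \<in> {1..n} \<rightarrow>\<^sub>E T. \<forall>i\<in>{1..n}. h (\<sigma> i) = h i}.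
      (of_int (coloured_alternant (\<lambda>(c, i). b (c, i) - int (\<Sum>j<n. colour_count {1..n} h (c, (i, j)))) *
        coloured_alternant (\<lambda>(c, j). b' (c, j) - int (\<Sum>i<n. colour_count {1..n} h (c, (i, j))))) :: complex)) =
      of_nat (fact (card {1..n})) * (\<Sum>\<kappa> | (\<forall>t. t \<notin> T \<longrightarrow> \<kappa> t = 0) \<and> sum \<kappa> T = card {1..n}.
        of_int (coloured_alternant (\<lambda>(c, i). b (c, i) - int (\<Sum>j<n. \<kappa> (c, (i, j)))) *
        coloured_alternant (\<lambda>(c, j). b' (c, j) - int (\<Sum>i<n. \<kappa> (c, (i, j))))))"
      by (rule sum_fixed_colourings[OF _ finT]) simp
    also have "\<dots> = of_nat (fact n) * of_int (row_sign b b')"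
      using sum_margins_coloured[OF b b'] unfolding T_def of_int_sum[symmetric] by simp
    finally show ?thesis by simp
  qed
  finally have total: "(\<Sum>x\<in>carrier G. frobenius_char b x * frobenius_char b' (inv\<^bsub>G\<^esub> x)) =
      of_nat (card (carrier G)) * of_int (row_sign b b')"
    by (simp add: card_G mult.assoc)
  show ?thesis
    unfolding cinner_def total by (rule nonzero_mult_div_cancel_left[OF card_carrier_nonzero])
qed

lemma degree_fun_not_inj_rows:
  assumes "\<not> inj_rows b" shows "degree_fun n b = 0"
  using skew_inj[OF skew_degree_fun, of n b] assms by (auto simp: inj_rows_def inj_on_def)

text \<open>\<open>?B\<close> leaves out vectors with two equal beads in a colour, for which
  \<open>frobenius_char\<close> has norm 0. Since \<open>degree_fun\<close> vanishes at them,
  neither the sum of squares nor the count of odd values changes. Both sides carry the factor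
  \<open>?w\<close>, which is cancelled at the end.\<close>

theorem num_odd_irreps_wreath:
  "num_odd_irreps G = r ^ card (binary_powers n) * \<Prod>(binary_powers n)"
proof -
  let ?B = "{b \<in> configs n. inj_rows b}"
  let ?w = "fact n ^ r :: nat"
  have "?w * num_odd_irreps G = card {b \<in> ?B. odd (degree_fun n b)}"
  proof (rule num_odd_irreps_by_virtual_chars[where s = frobenius_char and q = row_sign])
    fix b assume b: "b \<in> ?B"
    then have inj: "inj_rows b" by simp
    show "row_sign b b = 1"
      using inj by (simp add: row_sign_def inj_rows_def perm_sign_self)
    have "{b' \<in> ?B. row_sign b b' \<noteq> 0} =
        {b'. (\<forall>p. p \<notin> positions \<longrightarrow> b' p = 0) \<and> row_sign b b' \<noteq> 0}"
    proof (intro equalityI subsetI)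
      fix b' assume "b' \<in> {b' \<in> ?B. row_sign b b' \<noteq> 0}"
      then show "b' \<in> {b'. (\<forall>p. p \<notin> positions \<longrightarrow> b' p = 0) \<and> row_sign b b' \<noteq> 0}"
        by (simp add: configs_def)
    next
      fix b' assume "b' \<in> {b'. (\<forall>p. p \<notin> positions \<longrightarrow> b' p = 0) \<and> row_sign b b' \<noteq> 0}"
      then show "b' \<in> {b' \<in> ?B. row_sign b b' \<noteq> 0}" using row_sign_config[of b n b'] b by blast
    qed
    then show "card {b' \<in> ?B. row_sign b b' \<noteq> 0} = ?w"
      using card_row_sign_nonzero[OF inj] by simp
  next
    have "(\<Sum>b\<in>?B. (degree_fun n b)\<^sup>2) = norm_sq n (degree_fun n)"
      unfolding norm_sq_def using degree_fun_not_inj_rows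
      by (intro sum.mono_neutral_left) (auto simp: finite_configs)
    also have "\<dots> = int (?w * card (carrier G))"
      by (simp add: norm_sq_degree_fun norm_sq_coloured_alternant card_G)
    finally show "(\<Sum>b\<in>?B. (degree_fun n b)\<^sup>2) = int (?w * card (carrier G))" .
  qed (auto simp: finite_configs frobenius_char_virtual cinner_frobenius_char frobenius_char_one)
  also have "{b \<in> ?B. odd (degree_fun n b)} = {b \<in> configs n. odd (degree_fun n b)}"
    using degree_fun_not_inj_rows by fastforce
  also have "int (card {b \<in> configs n. odd (degree_fun n b)}) =
      int (?w * (r ^ card (binary_powers n) * \<Prod>(binary_powers n)))"
    by (simp add: card_odd_degree_fun norm_sq_coloured_alternant)
  then have "card {b \<in> configs n. odd (degree_fun n b)} =
      ?w * (r ^ card (binary_powers n) * \<Prod>(binary_powers n))" by (simp only: of_nat_eq_iff)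
  finally show ?thesis by simp
qed

end

lemma num_odd_irreps_sym_eq: "num_odd_irreps_sym n = \<Prod>(binary_powers n)"
proof -
  interpret wreath 1 n by unfold_locales simp
  \<comment> \<open>For \<open>r = 1\<close> the zero tuple is the only tuple of coordinates, so the
    generalized symmetric group is a copy of the symmetric group.\<close>
  let ?\<theta> = "\<lambda>\<sigma>. (\<lambda>i\<in>{1..n}. 0 :: int, \<sigma>)"
  have zero: "a = (\<lambda>i\<in>{1..n}. 0)" if "a \<in> {1..n} \<rightarrow>\<^sub>E {0..<int 1}" for a
    using that by (force simp: fun_eq_iff PiE_iff extensional_def)
  have "?\<theta> \<in> iso (sym_group n) G"
    unfolding iso_def hom_def
    by (auto simp: carrier_G mult_G sym_group_def bij_betw_def inj_on_def image_iff fun_eq_iff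
        permutes_compose dest!: zero[unfolded of_nat_1])
  moreover have "finite_group (sym_group n)"
    by (intro finite_group.intro sym_group_is_group finite_group_axioms.intro)
      (simp add: sym_group_def finite_permutations)
  ultimately have "num_odd_irreps (sym_group n) = num_odd_irreps G"
    using num_odd_irreps_iso[OF _ finite_group_axioms] by blast
  then show ?thesis using num_odd_irreps_wreath by (simp add: num_odd_irreps_sym_def)
qed

theorem theorem2:
  fixes n r :: nat
  assumes "n > 0" and "r > 0"
  shows "num_odd_irreps (generalized_sym_group n r) =
    r ^ card (binary_powers n) * num_odd_irreps_sym n"
proof -
  interpret wreath r n using assms(2) by unfold_locales
  show ?thesis by (simp add: num_odd_irreps_wreath num_odd_irreps_sym_eq)
qed

end
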